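(* Let $F_1:(M_1,g_1)\to(M_2,g_2)$ be a Riemannian submersion and $F_2:(M_2,g_2)\to(M_3,g_3)$ a pseudo-umbilical isometric immersion. Then the map $F_2\circ F_1:(M_1,g_1)\to(M_3,g_3)$ is a pseudo-umbilical Riemannian map.
   Context: All manifolds and maps are smooth; $(M_i,g_i)$ are Riemannian manifolds. A smooth map $F:(M,g)\to(N,h)$ of Riemannian manifolds with $\operatorname{rank}F>0$ is a Riemannian map if at every $p\in M$ the restriction of $F_{*p}$ to $(\ker F_{*p})^\perp$ is a linear isometry onto $\operatorname{range}F_{*p}\subset T_{F(p)}N$. Isometric immersions ($\ker F_*=0$) and Riemannian submersions ($F_*$ onto) are special cases. $(\operatorname{range}F_* )^\perp$ is the orthogonal complement of $\operatorname{range}F_*$ in $F^{-1}TN$. $\nabla$ is the Levi-Civita connection of $M$ and $\nabla^F$ is the pullback to $F^{-1}TN$ of that of $N$. The second fundamental form is $(\nabla F_* )(X,Y)=\nabla^F_XF_*(Y)-F_*(\nabla_XY)$; for a Riemannian map it takes values in $(\operatorname{range}F_* )^\perp$ for $X,Y\in\Gamma((\ker F_* )^\perp)$. The mean curvature vector field of $\operatorname{range}F_*$ is $H=\frac1r\sum_{i=1}^r(\nabla F_* )(e_i,e_i)$, where $r=\operatorname{rank}F$ and $\{e_i\}$ is a local orthonormal frame of $(\ker F_* )^\perp$. For a section $V$ of $(\operatorname{range}F_* )^\perp$ and $X\in\Gamma((\ker F_* )^\perp)$, $A_VF_*X$ is minus the $\operatorname{range}F_*$-component of $\nabla^F_XV$.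 A Riemannian map $F$ is pseudo-umbilical if there is $\lambda\in C^\infty(M)$ with $A_HF_*(X)=\lambda F_*(X)$ for all $X\in\Gamma((\ker F_* )^\perp)$. For an isometric immersion this is the usual notion: the shape operator in the direction of the mean curvature vector field is a function multiple of the identity. *)

theory Defs
  imports "HOL-Analysis.Analysis"
begin

section \<open>Smooth functions on open subsets of Euclidean spaces\<close>

primrec Ck_on :: "nat \<Rightarrow> 'e::euclidean_space set \<Rightarrow> ('e \<Rightarrow> 'f::real_normed_vector) \<Rightarrow> bool" where
  "Ck_on 0 = (\<lambda>S f. continuous_on S f)"
| "Ck_on (Suc k) = (\<lambda>S f. f differentiable_on S \<and>
      (\<forall>v. Ck_on k S (\<lambda>x. frechet_derivative f (at x) v)))"

text \<open>Only used for open \<open>S\<close>.\<close>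

definition smooth_on :: "'e::euclidean_space set \<Rightarrow> ('e \<Rightarrow> 'f::real_normed_vector) \<Rightarrow> bool" where
  "smooth_on S f \<longleftrightarrow> (\<forall>k. Ck_on k S f)"


section \<open>Smooth manifolds\<close>

text \<open>
  The points of a manifold are all elements of a topological type \<open>'a\<close> and the model space is a
  Euclidean space \<open>'e\<close>, so the dimension is \<open>DIM('e)\<close>. The smooth structure is given by an atlas,
  which need not be maximal. A chart is a pair of its domain and its coordinate map; outside its
  domain the coordinate map is irrelevant. The Hausdorff property and second countability are
  sort constraints on \<open>'a\<close>, imposed where manifolds are quantified over.
\<close>

type_synonym ('a, 'e) chart = "'a set \<times> ('a \<Rightarrow> 'e)"

definition cdom :: "('a, 'e) chart \<Rightarrow> 'a set" where
  "cdom c = fst c"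

definition coord :: "('a, 'e) chart \<Rightarrow> 'a \<Rightarrow> 'e" where
  "coord c = snd c"

definition cinv :: "('a, 'e) chart \<Rightarrow> 'e \<Rightarrow> 'a" where
  "cinv c = inv_into (cdom c) (coord c)"

definition is_chart :: "('a::topological_space, 'e::euclidean_space) chart \<Rightarrow> bool" where
  "is_chart c \<longleftrightarrow> open (cdom c) \<and> open (coord c ` cdom c) \<and>
     homeomorphism (cdom c) (coord c ` cdom c) (coord c) (cinv c)"

definition smooth_atlas :: "('a::topological_space, 'e::euclidean_space) chart set \<Rightarrow> bool" where
  "smooth_atlas A \<longleftrightarrow>
     (\<forall>c\<in>A. is_chart c) \<and> (\<Union>c\<in>A. cdom c) = UNIV \<and>
     (\<forall>c\<in>A. \<forall>d\<in>A. smooth_on (coord c ` (cdom c \<inter> cdom d)) (coord d \<circ> cinv c))"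

text \<open>
  Every point \<open>p\<close> gets a preferred chart, and the tangent space at \<open>p\<close> is the model space \<open>'e\<close>:
  a vector of \<open>'e\<close> stands for the tangent vector that has it as its components in the preferred
  chart. The functions \<open>components\<close> and \<open>coord_vec\<close> translate from and to the components in
  another chart around \<open>p\<close>.
\<close>

definition chart_at :: "('a, 'e) chart set \<Rightarrow> 'a \<Rightarrow> ('a, 'e) chart" where
  "chart_at A p = (SOME c. c \<in> A \<and> p \<in> cdom c)"

definition components ::
    "('a, 'e::euclidean_space) chart set \<Rightarrow> ('a, 'e) chart \<Rightarrow> 'a \<Rightarrow> 'e \<Rightarrow> 'e" where
  "components A c p v =
     frechet_derivative (coord c \<circ> cinv (chart_at A p)) (at (coord (chart_at A p) p)) v"

definition coord_vec ::
    "('a, 'e::euclidean_space) chart set \<Rightarrow> ('a, 'e) chart \<Rightarrow> 'a \<Rightarrow> 'e \<Rightarrow> 'e" where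
  "coord_vec A c p u =
     frechet_derivative (coord (chart_at A p) \<circ> cinv c) (at (coord c p)) u"

definition smooth_map ::
    "('a::topological_space, 'e::euclidean_space) chart set \<Rightarrow>
     ('b::topological_space, 'f::euclidean_space) chart set \<Rightarrow> ('a \<Rightarrow> 'b) \<Rightarrow> bool" where
  "smooth_map A B F \<longleftrightarrow> continuous_on UNIV F \<and>
     (\<forall>c\<in>A. \<forall>d\<in>B. smooth_on (coord c ` (cdom c \<inter> F -` cdom d)) (coord d \<circ> F \<circ> cinv c))"

definition smooth_fun :: "('a, 'e::euclidean_space) chart set \<Rightarrow> ('a \<Rightarrow> real) \<Rightarrow> bool" where
  "smooth_fun A f \<longleftrightarrow> (\<forall>c\<in>A. smooth_on (coord c ` cdom c) (f \<circ> cinv c))"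

definition differential ::
    "('a, 'e::euclidean_space) chart set \<Rightarrow> ('b, 'f::euclidean_space) chart set \<Rightarrow>
     ('a \<Rightarrow> 'b) \<Rightarrow> 'a \<Rightarrow> 'e \<Rightarrow> 'f" where
  "differential A B F p v =
     frechet_derivative (coord (chart_at B (F p)) \<circ> F \<circ> cinv (chart_at A p))
       (at (coord (chart_at A p) p)) v"

text \<open>
  Smooth sections over the open set \<open>U\<close> of the pullback of the tangent bundle of the target of
  \<open>F\<close>. With \<open>F = id\<close> these are the smooth vector fields on \<open>U\<close>.
\<close>

definition smooth_section ::
    "('a, 'e::euclidean_space) chart set \<Rightarrow> ('b, 'f::euclidean_space) chart set \<Rightarrow>
     ('a \<Rightarrow> 'b) \<Rightarrow> 'a set \<Rightarrow> ('a \<Rightarrow> 'f) \<Rightarrow> bool" where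
  "smooth_section A B F U V \<longleftrightarrow>
     (\<forall>c\<in>A. \<forall>d\<in>B. smooth_on (coord c ` (cdom c \<inter> U \<inter> F -` cdom d))
        (\<lambda>x. components B d (F (cinv c x)) (V (cinv c x))))"


section \<open>Riemannian metrics and the Levi-Civita connection\<close>

definition metric_in_chart ::
    "('a, 'e::euclidean_space) chart set \<Rightarrow> ('a \<Rightarrow> 'e \<Rightarrow> 'e \<Rightarrow> real) \<Rightarrow> ('a, 'e) chart \<Rightarrow>
     'e \<Rightarrow> 'e \<Rightarrow> 'e \<Rightarrow> real" where
  "metric_in_chart A g c x u v =
     g (cinv c x) (coord_vec A c (cinv c x) u) (coord_vec A c (cinv c x) v)"

definition riemannian_manifold ::
    "('a::topological_space, 'e::euclidean_space) chart set \<Rightarrow>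
     ('a \<Rightarrow> 'e \<Rightarrow> 'e \<Rightarrow> real) \<Rightarrow> bool" where
  "riemannian_manifold A g \<longleftrightarrow> smooth_atlas A \<and>
     (\<forall>p. bilinear (g p) \<and> (\<forall>u v. g p u v = g p v u) \<and> (\<forall>u. u \<noteq> 0 \<longrightarrow> g p u u > 0)) \<and>
     (\<forall>c\<in>A. \<forall>u v. smooth_on (coord c ` cdom c) (\<lambda>x. metric_in_chart A g c x u v))"

text \<open>
  The Christoffel symbols at \<open>p\<close> of the Levi-Civita connection in the chart \<open>c\<close>, as a bilinear map:
  \<open>christoffel A g c p u v\<close> is the covariant derivative at \<open>p\<close>, in the direction \<open>u\<close>, of the
  coordinate vector field with constant components \<open>v\<close>. Since coordinate vector fields commute,
  symmetry of this map says that the connection is torsion-free; the other condition says that it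
  is metric.
\<close>

definition christoffel ::
    "('a, 'e::euclidean_space) chart set \<Rightarrow> ('a \<Rightarrow> 'e \<Rightarrow> 'e \<Rightarrow> real) \<Rightarrow> ('a, 'e) chart \<Rightarrow>
     'a \<Rightarrow> 'e \<Rightarrow> 'e \<Rightarrow> 'e" where
  "christoffel A g c p =
     (THE \<Gamma>. bilinear \<Gamma> \<and> (\<forall>u v. \<Gamma> u v = \<Gamma> v u) \<and>
        (\<forall>w u v. frechet_derivative (\<lambda>x. metric_in_chart A g c x u v) (at (coord c p)) w =
           metric_in_chart A g c (coord c p) (\<Gamma> w u) v +
           metric_in_chart A g c (coord c p) u (\<Gamma> w v)))"

text \<open>
  The value at \<open>p\<close> of the covariant derivative, in the direction \<open>v\<close>, of a section \<open>V\<close> along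
  \<open>F\<close>, for the pullback by \<open>F\<close> of the Levi-Civita connection of the target; in coordinates
  \<open>v(V\<^sup>k) + \<Gamma>\<^sup>k\<^sub>i\<^sub>j(F p) (F\<^sub>*v)\<^sup>i V\<^sup>j\<close>.
  It is computed in the preferred charts at \<open>p\<close> and \<open>F p\<close>. With \<open>F = id\<close> it is the Levi-Civita
  connection itself.
\<close>

definition cov_deriv ::
    "('a, 'e::euclidean_space) chart set \<Rightarrow> ('b, 'f::euclidean_space) chart set \<Rightarrow>
     ('b \<Rightarrow> 'f \<Rightarrow> 'f \<Rightarrow> real) \<Rightarrow> ('a \<Rightarrow> 'b) \<Rightarrow> 'a \<Rightarrow> 'e \<Rightarrow> ('a \<Rightarrow> 'f) \<Rightarrow> 'f" where
  "cov_deriv A B h F p v V =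
     (let c = chart_at A p; d = chart_at B (F p) in
        frechet_derivative (\<lambda>x. components B d (F (cinv c x)) (V (cinv c x))) (at (coord c p)) v +
        christoffel B h d (F p) (differential A B F p v) (V p))"


section \<open>Riemannian maps\<close>

definition orth :: "('e \<Rightarrow> 'e \<Rightarrow> real) \<Rightarrow> 'e set \<Rightarrow> 'e set" where
  "orth G S = {u. \<forall>v\<in>S. G u v = 0}"

definition map_ker ::
    "('a, 'e::euclidean_space) chart set \<Rightarrow> ('b, 'f::euclidean_space) chart set \<Rightarrow>
     ('a \<Rightarrow> 'b) \<Rightarrow> 'a \<Rightarrow> 'e set" where
  "map_ker A B F p = {v. differential A B F p v = 0}"

definition map_range ::
    "('a, 'e::euclidean_space) chart set \<Rightarrow> ('b, 'f::euclidean_space) chart set \<Rightarrow>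
     ('a \<Rightarrow> 'b) \<Rightarrow> 'a \<Rightarrow> 'f set" where
  "map_range A B F p = range (differential A B F p)"

definition map_rank ::
    "('a, 'e::euclidean_space) chart set \<Rightarrow> ('b, 'f::euclidean_space) chart set \<Rightarrow>
     ('a \<Rightarrow> 'b) \<Rightarrow> 'a \<Rightarrow> nat" where
  "map_rank A B F p = dim (map_range A B F p)"

definition horizontal ::
    "('a, 'e::euclidean_space) chart set \<Rightarrow> ('a \<Rightarrow> 'e \<Rightarrow> 'e \<Rightarrow> real) \<Rightarrow>
     ('b, 'f::euclidean_space) chart set \<Rightarrow> ('a \<Rightarrow> 'b) \<Rightarrow> 'a \<Rightarrow> 'e set" where
  "horizontal A g B F p = orth (g p) (map_ker A B F p)"

definition riemannian_map ::
    "('a::topological_space, 'e::euclidean_space) chart set \<Rightarrow> ('a \<Rightarrow> 'e \<Rightarrow> 'e \<Rightarrow> real) \<Rightarrow>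
     ('b::topological_space, 'f::euclidean_space) chart set \<Rightarrow> ('b \<Rightarrow> 'f \<Rightarrow> 'f \<Rightarrow> real) \<Rightarrow>
     ('a \<Rightarrow> 'b) \<Rightarrow> bool" where
  "riemannian_map A g B h F \<longleftrightarrow> smooth_map A B F \<and>
     (\<forall>p. map_rank A B F p > 0 \<and>
        differential A B F p ` horizontal A g B F p = map_range A B F p \<and>
        (\<forall>u\<in>horizontal A g B F p. \<forall>v\<in>horizontal A g B F p.
           h (F p) (differential A B F p u) (differential A B F p v) = g p u v))"

definition riemannian_submersion ::
    "('a::topological_space, 'e::euclidean_space) chart set \<Rightarrow> ('a \<Rightarrow> 'e \<Rightarrow> 'e \<Rightarrow> real) \<Rightarrow>
     ('b::topological_space, 'f::euclidean_space) chart set \<Rightarrow> ('b \<Rightarrow> 'f \<Rightarrow> 'f \<Rightarrow> real) \<Rightarrow>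
     ('a \<Rightarrow> 'b) \<Rightarrow> bool" where
  "riemannian_submersion A g B h F \<longleftrightarrow>
     riemannian_map A g B h F \<and> (\<forall>p. surj (differential A B F p))"

definition isometric_immersion ::
    "('a::topological_space, 'e::euclidean_space) chart set \<Rightarrow> ('a \<Rightarrow> 'e \<Rightarrow> 'e \<Rightarrow> real) \<Rightarrow>
     ('b::topological_space, 'f::euclidean_space) chart set \<Rightarrow> ('b \<Rightarrow> 'f \<Rightarrow> 'f \<Rightarrow> real) \<Rightarrow>
     ('a \<Rightarrow> 'b) \<Rightarrow> bool" where
  "isometric_immersion A g B h F \<longleftrightarrow>
     riemannian_map A g B h F \<and> (\<forall>p. map_ker A B F p = {0})"


section \<open>Second fundamental form, mean curvature, pseudo-umbilical maps\<close>

definition second_ff ::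
    "('a, 'e::euclidean_space) chart set \<Rightarrow> ('a \<Rightarrow> 'e \<Rightarrow> 'e \<Rightarrow> real) \<Rightarrow>
     ('b, 'f::euclidean_space) chart set \<Rightarrow> ('b \<Rightarrow> 'f \<Rightarrow> 'f \<Rightarrow> real) \<Rightarrow>
     ('a \<Rightarrow> 'b) \<Rightarrow> ('a \<Rightarrow> 'e) \<Rightarrow> ('a \<Rightarrow> 'e) \<Rightarrow> 'a \<Rightarrow> 'f" where
  "second_ff A g B h F X Y p =
     cov_deriv A B h F p (X p) (\<lambda>q. differential A B F q (Y q)) -
     differential A B F p (cov_deriv A A g id p (X p) Y)"

definition horizontal_frame ::
    "('a, 'e::euclidean_space) chart set \<Rightarrow> ('a \<Rightarrow> 'e \<Rightarrow> 'e \<Rightarrow> real) \<Rightarrow>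
     ('b, 'f::euclidean_space) chart set \<Rightarrow> ('a \<Rightarrow> 'b) \<Rightarrow> nat \<Rightarrow> 'a set \<Rightarrow>
     (nat \<Rightarrow> 'a \<Rightarrow> 'e) \<Rightarrow> bool" where
  "horizontal_frame A g B F r U e \<longleftrightarrow>
     (\<forall>i<r. smooth_section A A id U (e i)) \<and>
     (\<forall>q\<in>U. span ((\<lambda>i. e i q) ` {..<r}) = horizontal A g B F q \<and>
        (\<forall>i<r. \<forall>j<r. g q (e i q) (e j q) = (if i = j then 1 else 0)))"

text \<open>The value at \<open>p\<close> does not depend on the choice of the orthonormal frame around \<open>p\<close>.\<close>

definition mean_curvature ::
    "('a::topological_space, 'e::euclidean_space) chart set \<Rightarrow> ('a \<Rightarrow> 'e \<Rightarrow> 'e \<Rightarrow> real) \<Rightarrow>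
     ('b, 'f::euclidean_space) chart set \<Rightarrow> ('b \<Rightarrow> 'f \<Rightarrow> 'f \<Rightarrow> real) \<Rightarrow>
     ('a \<Rightarrow> 'b) \<Rightarrow> 'a \<Rightarrow> 'f" where
  "mean_curvature A g B h F p =
     (let r = map_rank A B F p;
          e = (SOME e. \<exists>U. open U \<and> p \<in> U \<and> horizontal_frame A g B F r U e)
      in (1 / real r) *\<^sub>R (\<Sum>i<r. second_ff A g B h F (e i) (e i) p))"

definition range_component ::
    "('a, 'e::euclidean_space) chart set \<Rightarrow> ('b, 'f::euclidean_space) chart set \<Rightarrow>
     ('b \<Rightarrow> 'f \<Rightarrow> 'f \<Rightarrow> real) \<Rightarrow> ('a \<Rightarrow> 'b) \<Rightarrow> 'a \<Rightarrow> 'f \<Rightarrow> 'f" where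
  "range_component A B h F p w =
     (THE u. u \<in> map_range A B F p \<and> w - u \<in> orth (h (F p)) (map_range A B F p))"

text \<open>\<open>shape_op A B h F V X p\<close> is \<open>A\<^sub>V(F\<^sub>*X)\<close> at \<open>p\<close>, for horizontal \<open>X\<close>.\<close>

definition shape_op ::
    "('a, 'e::euclidean_space) chart set \<Rightarrow> ('b, 'f::euclidean_space) chart set \<Rightarrow>
     ('b \<Rightarrow> 'f \<Rightarrow> 'f \<Rightarrow> real) \<Rightarrow> ('a \<Rightarrow> 'b) \<Rightarrow> ('a \<Rightarrow> 'f) \<Rightarrow> ('a \<Rightarrow> 'e) \<Rightarrow> 'a \<Rightarrow> 'f" where
  "shape_op A B h F V X p = - range_component A B h F p (cov_deriv A B h F p (X p) V)"

definition pseudo_umbilical ::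
    "('a::topological_space, 'e::euclidean_space) chart set \<Rightarrow> ('a \<Rightarrow> 'e \<Rightarrow> 'e \<Rightarrow> real) \<Rightarrow>
     ('b::topological_space, 'f::euclidean_space) chart set \<Rightarrow> ('b \<Rightarrow> 'f \<Rightarrow> 'f \<Rightarrow> real) \<Rightarrow>
     ('a \<Rightarrow> 'b) \<Rightarrow> bool" where
  "pseudo_umbilical A g B h F \<longleftrightarrow>
     (\<exists>l. smooth_fun A l \<and>
        (\<forall>X. smooth_section A A id UNIV X \<and> (\<forall>p. X p \<in> horizontal A g B F p) \<longrightarrow>
           (\<forall>p. shape_op A B h F (mean_curvature A g B h F) X p =
                l p *\<^sub>R differential A B F p (X p))))"

end

theory Submission
  imports Defs
begin

text \<open>
  Write \<open>H\<close> for the mean curvature of the immersion \<open>F\<^sub>2\<close>. The second fundamental form obeys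
  \<open>S\<^bsub>F\<^sub>2\<circ>F\<^sub>1\<^esub>(u, v) = S\<^bsub>F\<^sub>2\<^esub>(F\<^sub>1\<^sub>*u, F\<^sub>1\<^sub>*v) + F\<^sub>2\<^sub>*(S\<^bsub>F\<^sub>1\<^esub>(u, v))\<close>, and that of a
  Riemannian submersion vanishes on horizontal vectors. As \<open>F\<^sub>1\<^sub>*\<close> maps horizontal orthonormal frames
  to orthonormal frames, the mean curvature of \<open>F\<^sub>2 \<circ> F\<^sub>1\<close> is \<open>H \<circ> F\<^sub>1\<close>. Its derivative in the
  direction \<open>v\<close> is by the chain rule the derivative of \<open>H\<close> in the direction \<open>F\<^sub>1\<^sub>*v\<close>, so the shape
  operator of \<open>F\<^sub>2 \<circ> F\<^sub>1\<close> is that of \<open>F\<^sub>2\<close> and \<open>\<lambda> \<circ> F\<^sub>1\<close> serves as the umbilicity function.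

  The chain rule needs \<open>H\<close> to be smooth. Since \<open>cov_deriv\<close> uses a different chart at every point,
  this requires the values of \<open>H\<close> in one fixed chart. The transformation law is not computed by
  hand: a change of charts is an isometry, hence a Riemannian submersion with vanishing second
  fundamental form, and the composition formula applies.
\<close>

section \<open>Calculus of smooth functions\<close>

text \<open>Umbilicity of \<open>F2\<close> is assumed for global vector fields only, while the
  image of a horizontal field under the derivative of \<open>F1\<close> need not be a field on the
  middle manifold, because the horizontal field need not be projectable. The hypothesis is therefore
  reduced to one tangent vector at a time, which takes a bump function to extend a vector to a
  global field. A second obstacle is that \<open>mean_curvature\<close> chooses its frame by
  \<open>SOME\<close>: nothing follows from the definition until a smooth horizontal frame is known
  to exist, and even then the frames chosen at neighbouring points are unrelated. Hence the formula
  for the mean curvature of the composite is proved for arbitrary charts around the image points and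
  an arbitrary orthonormal frame of the middle tangent space. With \<open>F1 = id\<close> the same
  formula describes \<open>F2\<close> itself, and with a frame that is smooth on a chart it shows
  that the mean curvature of \<open>F2\<close> is smooth.\<close>

abbreviation FD :: "('e::real_normed_vector \<Rightarrow> 'f::real_normed_vector) \<Rightarrow> 'e \<Rightarrow> 'e \<Rightarrow> 'f" where
  "FD f x \<equiv> frechet_derivative f (at x)"

lemma FD_eq: "(f has_derivative f') (at x) \<Longrightarrow> FD f x = f'"
  using frechet_derivative_at by metis

lemma FD_cong:
  assumes "open S" "x \<in> S" "f differentiable (at x)" "\<And>y. y \<in> S \<Longrightarrow> f y = g y"
  shows "FD f x = FD g x"
  using frechet_derivative_transform_within_open[OF assms(3,1,2)] assms(4) by simp

section \<open>Locality and closure properties of C^k functions\<close>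

lemma Ck_on_subset: "Ck_on k S f \<Longrightarrow> T \<subseteq> S \<Longrightarrow> Ck_on k T f"
  by (induction k arbitrary: f) (auto intro: continuous_on_subset differentiable_on_subset)

text \<open>Derivatives at a point of an open set depend only on nearby values, so agreement on
  \<open>S\<close> survives every differentiation. This lets coordinate expressions be replaced by
  formulas that hold on chart domains only.\<close>

lemma Ck_on_cong:
  assumes "open S" "\<And>x. x \<in> S \<Longrightarrow> f x = g x" "Ck_on k S f"
  shows "Ck_on k S g"
  using assms(2,3)
proof (induction k arbitrary: f g)
  case 0
  then show ?case using continuous_on_cong[of S S f g] by simp
next
  case (Suc k)
  have fd: "f differentiable (at x)" if "x \<in> S" for x
    using Suc.prems(2) that \<open>open S\<close> by (simp add: differentiable_on_eq_differentiable_at)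
  then have "g differentiable (at x)" if "x \<in> S" for x
    using that Suc.prems(1) \<open>open S\<close> unfolding differentiable_def
    by (meson has_derivative_transform_within_open)
  moreover have "Ck_on k S (\<lambda>x. FD g x v)" for v
    using Suc.IH[of "\<lambda>x. FD f x v" "\<lambda>x. FD g x v"] Suc.prems FD_cong[OF \<open>open S\<close> _ fd] by simp
  ultimately show ?case
    using \<open>open S\<close> by (simp add: differentiable_on_eq_differentiable_at)
qed

lemma Ck_on_local:
  assumes "\<And>x. x \<in> S \<Longrightarrow> \<exists>T. open T \<and> x \<in> T \<and> Ck_on k T f"
  shows "Ck_on k S f"
  using assms
proof (induction k arbitrary: f)
  case 0
  show ?case unfolding Ck_on.simps
  proof (rule continuous_at_imp_continuous_on, rule ballI)
    fix x assume "x \<in> S"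
    with 0 obtain T where "open T" "x \<in> T" "continuous_on T f" by auto
    then show "isCont f x" by (simp add: continuous_on_eq_continuous_at)
  qed
next
  case (Suc k)
  have "f differentiable (at x within S)" if x: "x \<in> S" for x
  proof -
    from Suc.prems[OF x] obtain T where "open T" "x \<in> T" "f differentiable_on T" by auto
    then show ?thesis
      by (simp add: differentiable_on_eq_differentiable_at differentiable_at_withinI)
  qed
  moreover have "Ck_on k S (\<lambda>x. FD f x v)" for v
    by (rule Suc.IH) (use Suc.prems in fastforce)
  ultimately show ?case by (simp add: differentiable_on_def)
qed

lemma Ck_on_SucD: "Ck_on (Suc k) S f \<Longrightarrow> Ck_on k S f"
  by (induction k arbitrary: f) (auto intro: differentiable_imp_continuous_on)

text \<open>\<open>Ck_on\<close> is phrased with \<open>frechet_derivative\<close>; this rule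
  accepts any explicit formula \<open>f' x\<close> for the derivative, so that closure properties
  can be proved by induction on the order.\<close>

lemma Ck_on_SucI:
  assumes "open S" "\<And>x. x \<in> S \<Longrightarrow> (f has_derivative f' x) (at x)"
    "\<And>v. Ck_on k S (\<lambda>x. f' x v)"
  shows "Ck_on (Suc k) S f"
proof -
  have "Ck_on k S (\<lambda>x. FD f x v)" for v
    by (rule Ck_on_cong[OF assms(1) _ assms(3)[of v]]) (simp add: FD_eq[OF assms(2)])
  moreover have "f differentiable_on S"
    using assms(1,2) by (auto simp: differentiable_on_eq_differentiable_at differentiable_def)
  ultimately show ?thesis by simp
qed

lemma Ck_on_has_derivative:
  assumes "Ck_on (Suc k) S f" "open S" "x \<in> S"
  shows "(f has_derivative FD f x) (at x)"
  using assms frechet_derivative_works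
  by (auto simp: differentiable_on_eq_differentiable_at)

lemma Ck_on_const: "Ck_on k S (\<lambda>x. c)"
  by (induction k arbitrary: c) auto

lemma Ck_on_bounded_linear:
  assumes "bounded_linear f" "open S"
  shows "Ck_on k S f"
proof (cases k)
  case 0
  then show ?thesis using assms by (simp add: linear_continuous_on)
next
  case (Suc m)
  show ?thesis unfolding Suc
    by (rule Ck_on_SucI[OF assms(2) bounded_linear_imp_has_derivative[OF assms(1)] Ck_on_const])
qed

lemma Ck_on_add:
  assumes "open S" "Ck_on k S f" "Ck_on k S g"
  shows "Ck_on k S (\<lambda>x. f x + g x)"
  using assms(2,3)
proof (induction k arbitrary: f g)
  case 0
  then show ?case by (simp add: continuous_on_add)
next
  case (Suc k)
  show ?case
  proof (rule Ck_on_SucI[OF assms(1)])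
    fix x assume "x \<in> S"
    then show "((\<lambda>x. f x + g x) has_derivative (\<lambda>v. FD f x v + FD g x v)) (at x)"
      using Suc.prems assms(1) by (intro has_derivative_add Ck_on_has_derivative)
  next
    fix v
    show "Ck_on k S (\<lambda>x. FD f x v + FD g x v)"
      using Suc.prems by (intro Suc.IH) auto
  qed
qed

lemma Ck_on_linear_comp:
  assumes "open S" "bounded_linear L" "Ck_on k S f"
  shows "Ck_on k S (\<lambda>x. L (f x))"
  using assms(3)
proof (induction k arbitrary: f)
  case 0
  then show ?case
    using bounded_linear.continuous_on[OF assms(2)] by simp
next
  case (Suc k)
  show ?case
    by (rule Ck_on_SucI[OF assms(1) bounded_linear.has_derivative[OF assms(2) Ck_on_has_derivative[OF Suc.prems assms(1)]]])
       (use Suc in auto)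
qed

lemma Ck_on_bilinear:
  assumes "open S" "bounded_bilinear B" "Ck_on k S f" "Ck_on k S g"
  shows "Ck_on k S (\<lambda>x. B (f x) (g x))"
  using assms(3,4)
proof (induction k arbitrary: f g)
  case 0
  then show ?case using bounded_bilinear.continuous_on[OF assms(2)] by simp
next
  case (Suc k)
  note fg = Ck_on_SucD[OF Suc.prems(1)] Ck_on_SucD[OF Suc.prems(2)]
  show ?case
  proof (rule Ck_on_SucI[OF assms(1)])
    fix x assume x: "x \<in> S"
    show "((\<lambda>x. B (f x) (g x)) has_derivative (\<lambda>v. B (f x) (FD g x v) + B (FD f x v) (g x))) (at x)"
      by (rule bounded_bilinear.FDERIV[OF assms(2)])
         (use Suc.prems x Ck_on_has_derivative[OF _ assms(1)] in blast)+
  next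
    fix v
    show "Ck_on k S (\<lambda>x. B (f x) (FD g x v) + B (FD f x v) (g x))"
      using Suc.prems by (intro Ck_on_add[OF assms(1)] Suc.IH fg) auto
  qed
qed

lemma Ck_on_sum:
  assumes "open S" "\<And>i. i \<in> I \<Longrightarrow> Ck_on k S (f i)"
  shows "Ck_on k S (\<lambda>x. \<Sum>i\<in>I. f i x)"
  using assms(2)
  by (induction I rule: infinite_finite_induct) (auto intro: Ck_on_const Ck_on_add[OF assms(1)])

lemma Ck_on_compose:
  fixes f :: "'e::euclidean_space \<Rightarrow> 'f::euclidean_space" and g :: "'f \<Rightarrow> 'g::real_normed_vector"
  assumes "open S" "open T" "f ` S \<subseteq> T" "Ck_on k S f" "Ck_on k T g"
  shows "Ck_on k S (\<lambda>x. g (f x))"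
  using assms(4,5)
proof (induction k arbitrary: g)
  case 0
  then show ?case using continuous_on_compose2[OF _ _ assms(3)] by simp
next
  case (Suc k)
  show ?case
  proof (rule Ck_on_SucI[OF assms(1)])
    fix x assume x: "x \<in> S"
    have f: "(f has_derivative FD f x) (at x)"
      using Suc.prems(1) x assms(1) Ck_on_has_derivative by blast
    have g: "(g has_derivative FD g (f x)) (at (f x))"
      using Suc.prems(2) x assms(2,3) Ck_on_has_derivative by blast
    \<comment> \<open>Both the base point and the direction of the derivative of \<open>g\<close>
      vary with \<open>x\<close>, while \<open>Ck_on\<close> speaks of fixed directions. Expanding
      the direction in the standard basis leaves products of scalar functions with
      \<open>FD g (f x) b\<close>, to which the induction hypothesis applies.\<close>
    have "FD g (f x) (FD f x v) = (\<Sum>b\<in>Basis. (FD f x v \<bullet> b) *\<^sub>R FD g (f x) b)" for v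
      by (subst euclidean_representation[of "FD f x v", symmetric])
         (simp add: linear_sum[OF has_derivative_linear[OF g]] linear_cmul[OF has_derivative_linear[OF g]])
    then show "((\<lambda>x. g (f x)) has_derivative
        (\<lambda>v. \<Sum>b\<in>Basis. (FD f x v \<bullet> b) *\<^sub>R FD g (f x) b)) (at x)"
      using has_derivative_compose[OF f g] by simp
  next
    fix v
    have "Ck_on k S (\<lambda>x. FD f x v)" "Ck_on k T (\<lambda>y. FD g y b)" for b
      using Suc.prems by auto
    then show "Ck_on k S (\<lambda>x. \<Sum>b\<in>Basis. (FD f x v \<bullet> b) *\<^sub>R FD g (f x) b)"
      using Suc.IH[of "\<lambda>y. FD g y _"] Ck_on_SucD[OF Suc.prems(1)]
      by (intro Ck_on_sum Ck_on_bilinear[OF _ bounded_bilinear_scaleR]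
          Ck_on_linear_comp[OF _ bounded_linear_inner_left] assms(1)) auto
  qed
qed

text \<open>In a fixed direction the derivative is a polynomial in \<open>inverse\<close> itself, so
  each order of smoothness yields the next.\<close>

lemma Ck_on_inverse: "Ck_on k (- {0}) (inverse :: real \<Rightarrow> real)"
proof (induction k)
  case 0
  then show ?case by (auto intro!: continuous_intros)
next
  case (Suc k)
  show ?case
  proof (rule Ck_on_SucI)
    fix x :: real assume "x \<in> - {0}"
    then show "(inverse has_derivative (\<lambda>v. - (inverse x * v * inverse x))) (at x)"
      by (intro has_derivative_inverse') auto
  next
    fix v :: real
    have "Ck_on k (- {0}) (\<lambda>x. (- v) * (inverse x * inverse x))"
      by (intro Ck_on_bilinear[OF _ bounded_bilinear_mult] Suc Ck_on_const) auto
    then show "Ck_on k (- {0}) (\<lambda>x. - (inverse x * v * inverse x))"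
      by (simp add: algebra_simps)
  qed auto
qed

lemma Ck_on_sqrt: "Ck_on k {0<..} sqrt"
proof (induction k)
  case 0
  then show ?case by (auto intro!: continuous_intros)
next
  case (Suc k)
  show ?case
  proof (rule Ck_on_SucI)
    fix x :: real assume "x \<in> {0<..}"
    then have "(sqrt has_real_derivative (inverse (sqrt x) / 2)) (at x)"
      using DERIV_real_sqrt by auto
    then show "(sqrt has_derivative (\<lambda>v. (v / 2) * inverse (sqrt x))) (at x)"
      by (rule has_derivative_eq_rhs[OF has_field_derivative_imp_has_derivative]) (auto simp: mult_ac)
  next
    fix v :: real
    show "Ck_on k {0<..} (\<lambda>x. (v / 2) * inverse (sqrt x))"
      by (intro Ck_on_bilinear[OF _ bounded_bilinear_mult] Ck_on_const
          Ck_on_compose[OF _ _ _ Suc Ck_on_inverse]) auto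
  qed auto
qed

section \<open>Closure properties of smooth functions\<close>

lemma smooth_on_subset: "smooth_on S f \<Longrightarrow> T \<subseteq> S \<Longrightarrow> smooth_on T f"
  by (auto simp: smooth_on_def intro: Ck_on_subset)

lemma smooth_on_cong:
  "open S \<Longrightarrow> smooth_on S f \<Longrightarrow> (\<And>x. x \<in> S \<Longrightarrow> f x = g x) \<Longrightarrow> smooth_on S g"
  unfolding smooth_on_def using Ck_on_cong[of S f g] by blast

lemma smooth_on_local:
  assumes "\<And>x. x \<in> S \<Longrightarrow> \<exists>T. open T \<and> x \<in> T \<and> smooth_on T f"
  shows "smooth_on S f"
  unfolding smooth_on_def
proof
  fix k
  show "Ck_on k S f"
    by (rule Ck_on_local) (use assms in \<open>auto simp: smooth_on_def\<close>)
qed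

lemma smooth_on_const: "smooth_on S (\<lambda>x. c)"
  by (simp add: smooth_on_def Ck_on_const)

lemma smooth_on_bounded_linear: "open S \<Longrightarrow> bounded_linear f \<Longrightarrow> smooth_on S f"
  by (simp add: smooth_on_def Ck_on_bounded_linear)

lemma smooth_on_ident: "open S \<Longrightarrow> smooth_on S (\<lambda>x. x)"
  by (rule smooth_on_bounded_linear) auto

lemma smooth_on_add:
  "open S \<Longrightarrow> smooth_on S f \<Longrightarrow> smooth_on S g \<Longrightarrow> smooth_on S (\<lambda>x. f x + g x)"
  by (simp add: smooth_on_def Ck_on_add)

lemma smooth_on_linear_comp:
  "open S \<Longrightarrow> bounded_linear L \<Longrightarrow> smooth_on S f \<Longrightarrow> smooth_on S (\<lambda>x. L (f x))"
  by (simp add: smooth_on_def Ck_on_linear_comp)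

lemma smooth_on_diff:
  "open S \<Longrightarrow> smooth_on S f \<Longrightarrow> smooth_on S g \<Longrightarrow> smooth_on S (\<lambda>x. f x - g x)"
  using smooth_on_add[of S f "\<lambda>x. - g x"]
    smooth_on_linear_comp[OF _ bounded_linear_minus[OF bounded_linear_ident], of S g] by simp

lemma smooth_on_scaleR:
  "open S \<Longrightarrow> smooth_on S f \<Longrightarrow> smooth_on S g \<Longrightarrow> smooth_on S (\<lambda>x. f x *\<^sub>R g x)"
  by (simp add: smooth_on_def Ck_on_bilinear[OF _ bounded_bilinear_scaleR])

lemma smooth_on_mult:
  fixes f g :: "'e::euclidean_space \<Rightarrow> real"
  shows "open S \<Longrightarrow> smooth_on S f \<Longrightarrow> smooth_on S g \<Longrightarrow> smooth_on S (\<lambda>x. f x * g x)"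
  by (simp add: smooth_on_def Ck_on_bilinear[OF _ bounded_bilinear_mult])

lemma smooth_on_inner:
  "open S \<Longrightarrow> smooth_on S f \<Longrightarrow> smooth_on S g \<Longrightarrow> smooth_on S (\<lambda>x. f x \<bullet> g x)"
  by (simp add: smooth_on_def Ck_on_bilinear[OF _ bounded_bilinear_inner])

lemma smooth_on_sum:
  "open S \<Longrightarrow> (\<And>i. i \<in> I \<Longrightarrow> smooth_on S (f i)) \<Longrightarrow> smooth_on S (\<lambda>x. \<Sum>i\<in>I. f i x)"
  by (simp add: smooth_on_def Ck_on_sum)

lemma smooth_on_compose:
  fixes f :: "'e::euclidean_space \<Rightarrow> 'f::euclidean_space"
  shows "open S \<Longrightarrow> open T \<Longrightarrow> f ` S \<subseteq> T \<Longrightarrow> smooth_on S f \<Longrightarrow> smooth_on T g \<Longrightarrow>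
    smooth_on S (\<lambda>x. g (f x))"
  by (simp add: smooth_on_def Ck_on_compose)

lemma smooth_on_inverse_sqrt:
  assumes "open S" "smooth_on S f" "\<And>x. x \<in> S \<Longrightarrow> f x > 0"
  shows "smooth_on S (\<lambda>x. inverse (sqrt (f x)))"
proof (rule smooth_on_compose[OF assms(1), of "- {0}" "\<lambda>x. sqrt (f x)" inverse])
  show "smooth_on S (\<lambda>x. sqrt (f x))"
    by (rule smooth_on_compose[OF assms(1) _ _ assms(2), of "{0<..}"])
       (use assms(3) Ck_on_sqrt in \<open>auto simp: smooth_on_def\<close>)
  show "smooth_on (- {0::real}) inverse"
    by (simp add: smooth_on_def Ck_on_inverse)
qed (use assms(3) in fastforce)+

lemma smooth_on_has_derivative:
  "smooth_on S f \<Longrightarrow> open S \<Longrightarrow> x \<in> S \<Longrightarrow> (f has_derivative FD f x) (at x)"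
  unfolding smooth_on_def using Ck_on_has_derivative by blast

lemma smooth_on_linear:
  "smooth_on S f \<Longrightarrow> open S \<Longrightarrow> x \<in> S \<Longrightarrow> linear (FD f x)"
  using smooth_on_has_derivative has_derivative_linear by blast

lemma smooth_on_FD:
  assumes "smooth_on S f"
  shows "smooth_on S (\<lambda>x. FD f x v)"
  unfolding smooth_on_def
proof
  fix k
  have "Ck_on (Suc k) S f" using assms unfolding smooth_on_def by blast
  then show "Ck_on k S (\<lambda>x. FD f x v)" by simp
qed

lemma smooth_on_continuous: "smooth_on S f \<Longrightarrow> continuous_on S f"
  unfolding smooth_on_def by (drule spec[of _ 0]) simp

section \<open>Linear and bilinear maps that depend on a point\<close>

lemma linear_Basis_sum:
  fixes L :: "'f::euclidean_space \<Rightarrow> 'g::real_normed_vector"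
  assumes "linear L"
  shows "L v = (\<Sum>b\<in>Basis. (v \<bullet> b) *\<^sub>R L b)"
  by (subst euclidean_representation[of v, symmetric])
     (simp add: linear_sum[OF assms] linear_cmul[OF assms])

text \<open>Expansion of \<open>X x\<close> in the standard basis reduces a varying argument to
  fixed ones. Families are therefore handled entry by entry, without a norm on a space of linear
  maps.\<close>

lemma smooth_on_linear_family:
  fixes L :: "'e::euclidean_space \<Rightarrow> 'f::euclidean_space \<Rightarrow> 'g::real_normed_vector"
  assumes "open S" "\<And>x. x \<in> S \<Longrightarrow> linear (L x)" "\<And>v. smooth_on S (\<lambda>x. L x v)" "smooth_on S X"
  shows "smooth_on S (\<lambda>x. L x (X x))"
proof (rule smooth_on_cong[OF assms(1)])
  show "smooth_on S (\<lambda>x. \<Sum>b\<in>Basis. (X x \<bullet> b) *\<^sub>R L x b)"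
    using assms by (intro smooth_on_sum smooth_on_scaleR smooth_on_inner smooth_on_const)
qed (rule linear_Basis_sum[OF assms(2), symmetric])

lemma smooth_on_FD_field:
  "open S \<Longrightarrow> smooth_on S f \<Longrightarrow> smooth_on S X \<Longrightarrow> smooth_on S (\<lambda>x. FD f x (X x))"
  by (rule smooth_on_linear_family[where L = "FD f"]) (auto intro: smooth_on_linear smooth_on_FD)

lemma smooth_on_bilinear_family:
  fixes G :: "'e::euclidean_space \<Rightarrow> 'f::euclidean_space \<Rightarrow> 'h::euclidean_space \<Rightarrow> 'g::real_normed_vector"
  assumes "open S" "\<And>x. x \<in> S \<Longrightarrow> bilinear (G x)" "\<And>u v. smooth_on S (\<lambda>x. G x u v)"
    "smooth_on S X" "smooth_on S Y"
  shows "smooth_on S (\<lambda>x. G x (X x) (Y x))"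
proof (rule smooth_on_linear_family[OF assms(1), where L = "\<lambda>x. G x (X x)"])
  show "smooth_on S (\<lambda>x. G x (X x) v)" for v
    by (rule smooth_on_linear_family[OF assms(1), where L = "\<lambda>x u. G x u v"])
       (use assms in \<open>auto simp: bilinear_def\<close>)
qed (use assms in \<open>auto simp: bilinear_def\<close>)

text \<open>In the standard basis this is a sum of ordinary products, so the product rule for
  scalars suffices. It is the source of the two terms in the derivative of a pushed-forward
  field.\<close>

lemma has_derivative_linear_family:
  fixes L :: "'e::euclidean_space \<Rightarrow> 'f::euclidean_space \<Rightarrow> 'g::real_normed_vector"
  assumes "open S" "x \<in> S" "\<And>y. y \<in> S \<Longrightarrow> linear (L y)"
    "\<And>v. ((\<lambda>y. L y v) has_derivative L' v) (at x)" "(X has_derivative X') (at x)"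
  shows "((\<lambda>y. L y (X y)) has_derivative (\<lambda>w. L' (X x) w + L x (X' w))) (at x)"
proof -
  have rep: "L y v = (\<Sum>b\<in>Basis. (v \<bullet> b) *\<^sub>R L y b)" if "y \<in> S" for y v
    using linear_Basis_sum[OF assms(3)[OF that]] .
  have 1: "((\<lambda>y. \<Sum>b\<in>Basis. (v \<bullet> b) *\<^sub>R L y b) has_derivative (\<lambda>w. \<Sum>b\<in>Basis. (v \<bullet> b) *\<^sub>R L' b w)) (at x)" for v
    by (intro has_derivative_sum has_derivative_scaleR_right assms(4))
  \<comment> \<open>\<open>L'\<close> is merely some derivative for each \<open>v\<close>; its
    linearity in \<open>v\<close> comes from uniqueness of derivatives.\<close>
  have 2: "L' v = (\<lambda>w. \<Sum>b\<in>Basis. (v \<bullet> b) *\<^sub>R L' b w)" for v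
  proof (rule has_derivative_unique[OF assms(4)])
    show "((\<lambda>y. L y v) has_derivative (\<lambda>w. \<Sum>b\<in>Basis. (v \<bullet> b) *\<^sub>R L' b w)) (at x)"
      by (rule has_derivative_transform_within_open[OF 1 assms(1,2)]) (rule rep[symmetric])
  qed
  have 3: "((\<lambda>y. \<Sum>b\<in>Basis. (X y \<bullet> b) *\<^sub>R L y b) has_derivative
     (\<lambda>w. \<Sum>b\<in>Basis. (X x \<bullet> b) *\<^sub>R L' b w + (X' w \<bullet> b) *\<^sub>R L x b)) (at x)"
    by (intro has_derivative_sum has_derivative_scaleR has_derivative_inner_left assms(4,5))
  have 4: "((\<lambda>y. L y (X y)) has_derivative
     (\<lambda>w. \<Sum>b\<in>Basis. (X x \<bullet> b) *\<^sub>R L' b w + (X' w \<bullet> b) *\<^sub>R L x b)) (at x)"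
    by (rule has_derivative_transform_within_open[OF 3 assms(1,2)]) (rule rep[symmetric])
  show ?thesis
    unfolding 2[of "X x"] rep[OF assms(2), of "X' _"] sum.distrib[symmetric] by (rule 4)
qed

lemma has_derivative_bilinear_family:
  fixes G :: "'e::euclidean_space \<Rightarrow> 'f::euclidean_space \<Rightarrow> 'h::euclidean_space \<Rightarrow> 'g::real_normed_vector"
  assumes "open S" "x \<in> S" "\<And>y. y \<in> S \<Longrightarrow> bilinear (G y)"
    "\<And>u v. ((\<lambda>y. G y u v) has_derivative G' u v) (at x)"
    "(X has_derivative X') (at x)" "(Y has_derivative Y') (at x)"
  shows "((\<lambda>y. G y (X y) (Y y)) has_derivative
    (\<lambda>w. G' (X x) (Y x) w + G x (X' w) (Y x) + G x (X x) (Y' w))) (at x)"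
proof -
  have *: "((\<lambda>y. G y (X y) v) has_derivative (\<lambda>w. G' (X x) v w + G x (X' w) v)) (at x)" for v
    by (rule has_derivative_linear_family[OF assms(1,2), where L = "\<lambda>y u. G y u v" and L' = "\<lambda>u. G' u v"])
       (use assms(3-5) in \<open>auto simp: bilinear_def\<close>)
  show ?thesis
    by (rule has_derivative_linear_family[OF assms(1,2) _ * assms(6)])
       (use assms(3) in \<open>auto simp: bilinear_def\<close>)
qed

section \<open>Symmetry of second derivatives\<close>

text \<open>The mean value theorem is applied twice: to the increment in direction \<open>v\<close>
  as a function of the coefficient of \<open>u\<close>, and to the derivative in direction
  \<open>u\<close> along \<open>v\<close>. The second difference is unchanged when \<open>u\<close>
  and \<open>v\<close> are exchanged, which is what the symmetry proof exploits.\<close>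

lemma second_difference:
  fixes f :: "'e::euclidean_space \<Rightarrow> real"
  assumes "open U" "smooth_on U f" "t > 0"
    "\<And>a b. a \<in> {0..t} \<Longrightarrow> b \<in> {0..t} \<Longrightarrow> x + a *\<^sub>R u + b *\<^sub>R v \<in> U"
  obtains a b where "a \<in> {0..t}" "b \<in> {0..t}"
    "f (x + t *\<^sub>R u + t *\<^sub>R v) - f (x + t *\<^sub>R u) - f (x + t *\<^sub>R v) + f x =
      t\<^sup>2 * FD (\<lambda>z. FD f z u) (x + a *\<^sub>R u + b *\<^sub>R v) v"
proof -
  have d: "((\<lambda>s. f (x + s *\<^sub>R u + b *\<^sub>R v)) has_derivative (\<lambda>h. FD f (x + s *\<^sub>R u + b *\<^sub>R v) (h *\<^sub>R u))) (at s)"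
    if "s \<in> {0..t}" "b \<in> {0..t}" for s b
    by (rule has_derivative_compose[where f = "\<lambda>s. x + s *\<^sub>R u + b *\<^sub>R v" and g = f,
          OF _ smooth_on_has_derivative[OF assms(2,1) assms(4)[OF that]]])
       (auto intro!: derivative_eq_intros)
  \<comment> \<open>The vanishing terms \<open>0 *\<^sub>R v\<close> are written out so that
    \<open>d\<close> supplies all derivatives, with \<open>b = t\<close> and
    \<open>b = 0\<close>.\<close>
  have "\<exists>a\<in>{0<..<t}. (f (x + t *\<^sub>R u + t *\<^sub>R v) - f (x + t *\<^sub>R u + 0 *\<^sub>R v)) -
      (f (x + 0 *\<^sub>R u + t *\<^sub>R v) - f (x + 0 *\<^sub>R u + 0 *\<^sub>R v)) =
      (FD f (x + a *\<^sub>R u + t *\<^sub>R v) ((t - 0) *\<^sub>R u) - FD f (x + a *\<^sub>R u + 0 *\<^sub>R v) ((t - 0) *\<^sub>R u))"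
    by (rule mvt_simple[OF \<open>t > 0\<close>, where f = "\<lambda>s. f (x + s *\<^sub>R u + t *\<^sub>R v) - f (x + s *\<^sub>R u + 0 *\<^sub>R v)" and
          f' = "\<lambda>a h. FD f (x + a *\<^sub>R u + t *\<^sub>R v) (h *\<^sub>R u) - FD f (x + a *\<^sub>R u + 0 *\<^sub>R v) (h *\<^sub>R u)"])
       (rule has_derivative_at_withinI[OF has_derivative_diff[OF d d]]; use \<open>t > 0\<close> in simp)
  then obtain a where "a \<in> {0<..<t}"
    and eq: "(f (x + t *\<^sub>R u + t *\<^sub>R v) - f (x + t *\<^sub>R u + 0 *\<^sub>R v)) -
      (f (x + 0 *\<^sub>R u + t *\<^sub>R v) - f (x + 0 *\<^sub>R u + 0 *\<^sub>R v)) =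
      FD f (x + a *\<^sub>R u + t *\<^sub>R v) ((t - 0) *\<^sub>R u) - FD f (x + a *\<^sub>R u + 0 *\<^sub>R v) ((t - 0) *\<^sub>R u)"
    by blast
  then have a: "a \<in> {0..t}" by simp
  have eq1: "f (x + t *\<^sub>R u + t *\<^sub>R v) - f (x + t *\<^sub>R u) - f (x + t *\<^sub>R v) + f x =
      FD f (x + a *\<^sub>R u + t *\<^sub>R v) (t *\<^sub>R u) - FD f (x + a *\<^sub>R u) (t *\<^sub>R u)"
    using eq by simp
  have d2: "((\<lambda>s. FD f (x + a *\<^sub>R u + s *\<^sub>R v) u) has_derivative
      (\<lambda>h. FD (\<lambda>z. FD f z u) (x + a *\<^sub>R u + s *\<^sub>R v) (h *\<^sub>R v))) (at s)"
    if "s \<in> {0..t}" for s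
    by (rule has_derivative_compose[where f = "\<lambda>s. x + a *\<^sub>R u + s *\<^sub>R v" and g = "\<lambda>z. FD f z u",
          OF _ smooth_on_has_derivative[OF smooth_on_FD[OF assms(2)] assms(1) assms(4)[OF a that]]])
       (auto intro!: derivative_eq_intros)
  have "\<exists>b\<in>{0<..<t}. FD f (x + a *\<^sub>R u + t *\<^sub>R v) u - FD f (x + a *\<^sub>R u + 0 *\<^sub>R v) u =
      FD (\<lambda>z. FD f z u) (x + a *\<^sub>R u + b *\<^sub>R v) ((t - 0) *\<^sub>R v)"
    by (rule mvt_simple[OF \<open>t > 0\<close>, where f = "\<lambda>s. FD f (x + a *\<^sub>R u + s *\<^sub>R v) u" and
          f' = "\<lambda>b h. FD (\<lambda>z. FD f z u) (x + a *\<^sub>R u + b *\<^sub>R v) (h *\<^sub>R v)"])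
       (rule has_derivative_at_withinI[OF d2]; use \<open>t > 0\<close> in simp)
  then obtain b where "b \<in> {0<..<t}" and eq: "FD f (x + a *\<^sub>R u + t *\<^sub>R v) u - FD f (x + a *\<^sub>R u + 0 *\<^sub>R v) u =
      FD (\<lambda>z. FD f z u) (x + a *\<^sub>R u + b *\<^sub>R v) ((t - 0) *\<^sub>R v)"
    by blast
  then have b: "b \<in> {0..t}" by simp
  have eq2: "FD f (x + a *\<^sub>R u + t *\<^sub>R v) u - FD f (x + a *\<^sub>R u) u =
      FD (\<lambda>z. FD f z u) (x + a *\<^sub>R u + b *\<^sub>R v) (t *\<^sub>R v)"
    using eq by simp
  have l: "linear (FD f (x + a *\<^sub>R u + t *\<^sub>R v))" "linear (FD f (x + a *\<^sub>R u))"
      "linear (FD (\<lambda>z. FD f z u) (x + a *\<^sub>R u + b *\<^sub>R v))"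
    using a b \<open>t > 0\<close> assms(4)[of a t] assms(4)[of a 0] assms(4)[of a b]
    by (simp_all add: smooth_on_linear[OF _ assms(1)] smooth_on_FD assms(2))
  have "f (x + t *\<^sub>R u + t *\<^sub>R v) - f (x + t *\<^sub>R u) - f (x + t *\<^sub>R v) + f x =
      t * (FD f (x + a *\<^sub>R u + t *\<^sub>R v) u - FD f (x + a *\<^sub>R u) u)"
    unfolding eq1 linear_cmul[OF l(1)] linear_cmul[OF l(2)] by (simp add: right_diff_distrib)
  also have "\<dots> = t\<^sup>2 * FD (\<lambda>z. FD f z u) (x + a *\<^sub>R u + b *\<^sub>R v) v"
    unfolding eq2 by (simp add: linear_cmul[OF l(3)] power2_eq_square)
  finally show thesis using that a b by blast
qed

lemma FD_FD_symmetric_real: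
  fixes f :: "'e::euclidean_space \<Rightarrow> real"
  assumes "open U" "smooth_on U f" "x \<in> U"
  shows "FD (\<lambda>y. FD f y v) x u = FD (\<lambda>y. FD f y u) x v"
proof (rule ccontr)
  let ?A = "\<lambda>u v y. FD (\<lambda>y. FD f y v) y u"
  assume neq: "?A u v x \<noteq> ?A v u x"
  \<comment> \<open>Half the gap: a common value of the two mixed derivatives, taken at nearby
    points, cannot be this close to both of their values at \<open>x\<close>.\<close>
  define \<epsilon> where "\<epsilon> = \<bar>?A u v x - ?A v u x\<bar> / 2"
  have "\<epsilon> > 0" using neq by (simp add: \<epsilon>_def)
  have cont: "\<exists>\<delta>>0. \<forall>y. dist y x < \<delta> \<longrightarrow> dist (?A u v y) (?A u v x) < \<epsilon>" for u v
  proof -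
    have "isCont (?A u v) x"
      using smooth_on_continuous[OF smooth_on_FD[OF smooth_on_FD[OF assms(2)]], of v u] assms(1,3)
      by (simp add: continuous_on_eq_continuous_at)
    then show ?thesis using \<open>\<epsilon> > 0\<close> unfolding continuous_at_eps_delta by simp
  qed
  obtain d1 where d1: "d1 > 0" "\<And>y. dist y x < d1 \<Longrightarrow> dist (?A u v y) (?A u v x) < \<epsilon>"
    using cont[of v u] by blast
  obtain d2 where d2: "d2 > 0" "\<And>y. dist y x < d2 \<Longrightarrow> dist (?A v u y) (?A v u x) < \<epsilon>"
    using cont[of u v] by blast
  obtain d3 where d3: "d3 > 0" "ball x d3 \<subseteq> U" using assms(1,3) by (auto simp: open_contains_ball)
  define d where "d = min d1 (min d2 d3)"
  \<comment> \<open>With this side length the parallelogram spanned by \<open>t *\<^sub>R u\<close>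
    and \<open>t *\<^sub>R v\<close> stays within distance \<open>d\<close> of \<open>x\<close>; the
    summand 1 keeps the denominator positive when both vectors vanish.\<close>
  define t where "t = d / (norm u + norm v + 1)"
  have pos: "norm u + norm v + 1 > 0" by (simp add: add_nonneg_pos)
  have "d > 0" using d1(1) d2(1) d3(1) unfolding d_def by simp
  then have "t > 0" using pos by (simp add: t_def)
  have near: "dist (x + a *\<^sub>R u + b *\<^sub>R v) x < d" if "a \<in> {0..t}" "b \<in> {0..t}" for a b
  proof -
    have "norm (a *\<^sub>R u + b *\<^sub>R v) \<le> a * norm u + b * norm v"
      using norm_triangle_ineq[of "a *\<^sub>R u" "b *\<^sub>R v"] that by simp
    also have "\<dots> \<le> t * norm u + t * norm v"
      using that by (intro add_mono mult_right_mono) auto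
    also have "\<dots> < t * (norm u + norm v + 1)" using \<open>t > 0\<close> by (simp add: distrib_left)
    also have "\<dots> = d" using pos by (simp add: t_def)
    finally show ?thesis by (simp add: dist_norm add.assoc)
  qed
  have near': "dist (x + b *\<^sub>R v + a *\<^sub>R u) x < d" if "a \<in> {0..t}" "b \<in> {0..t}" for a b
    using near[OF that] by (simp add: add.assoc add.commute[of "b *\<^sub>R v"])
  have U: "y \<in> U" if "dist y x < d" for y
    using that d3(2) unfolding d_def by (auto simp: dist_commute)
  obtain a b where ab: "a \<in> {0..t}" "b \<in> {0..t}" and 1:
    "f (x + t *\<^sub>R u + t *\<^sub>R v) - f (x + t *\<^sub>R u) - f (x + t *\<^sub>R v) + f x =
      t\<^sup>2 * ?A v u (x + a *\<^sub>R u + b *\<^sub>R v)"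
    by (rule second_difference[OF assms(1,2) \<open>t > 0\<close> U[OF near]])
  obtain b' a' where ab': "b' \<in> {0..t}" "a' \<in> {0..t}" and 2:
    "f (x + t *\<^sub>R v + t *\<^sub>R u) - f (x + t *\<^sub>R v) - f (x + t *\<^sub>R u) + f x =
      t\<^sup>2 * ?A u v (x + b' *\<^sub>R v + a' *\<^sub>R u)"
    by (rule second_difference[OF assms(1,2) \<open>t > 0\<close> U[OF near']])
  have swap: "x + t *\<^sub>R v + t *\<^sub>R u = x + t *\<^sub>R u + t *\<^sub>R v" by (simp add: add_ac)
  have "t\<^sup>2 * ?A v u (x + a *\<^sub>R u + b *\<^sub>R v) = t\<^sup>2 * ?A u v (x + b' *\<^sub>R v + a' *\<^sub>R u)"
    using 1 2[unfolded swap] by linarith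
  then have eqs: "?A v u (x + a *\<^sub>R u + b *\<^sub>R v) = ?A u v (x + b' *\<^sub>R v + a' *\<^sub>R u)"
    using \<open>t > 0\<close> by simp
  have d12: "dist (?A u v (x + b' *\<^sub>R v + a' *\<^sub>R u)) (?A u v x) < \<epsilon>"
    using near'[OF ab'(2,1)] unfolding d_def by (intro d1(2)) simp
  have d21: "dist (?A v u (x + a *\<^sub>R u + b *\<^sub>R v)) (?A v u x) < \<epsilon>"
    using near[OF ab] unfolding d_def by (intro d2(2)) simp
  have contra: False if "A = B" "dist B p < \<bar>p - q\<bar> / 2" "dist A q < \<bar>p - q\<bar> / 2" for A B p q :: real
    using that unfolding dist_real_def by (simp add: abs_if split: if_splits)
  show False by (rule contra[OF eqs d12[unfolded \<epsilon>_def] d21[unfolded \<epsilon>_def]])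
qed

lemma FD_FD_symmetric:
  fixes f :: "'e::euclidean_space \<Rightarrow> 'f::euclidean_space"
  assumes "open U" "smooth_on U f" "x \<in> U"
  shows "FD (\<lambda>y. FD f y v) x u = FD (\<lambda>y. FD f y u) x v"
proof (rule euclidean_eqI)
  fix b :: 'f
  have s: "smooth_on U (\<lambda>y. f y \<bullet> b)"
    by (rule smooth_on_linear_comp[OF assms(1) bounded_linear_inner_left assms(2)])
  have 1: "FD (\<lambda>y. f y \<bullet> b) y w = FD f y w \<bullet> b" if "y \<in> U" for y w
    using FD_eq[OF has_derivative_inner_left[OF smooth_on_has_derivative[OF assms(2,1) that]]] by metis
  have 2: "FD (\<lambda>y. FD (\<lambda>y. f y \<bullet> b) y w) x w' = FD (\<lambda>y. FD f y w) x w' \<bullet> b" for w w'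
  proof -
    have "((\<lambda>y. FD f y w \<bullet> b) has_derivative (\<lambda>w'. FD (\<lambda>y. FD f y w) x w' \<bullet> b)) (at x)"
      by (intro has_derivative_inner_left smooth_on_has_derivative[OF smooth_on_FD[OF assms(2)]] assms)
    then have "((\<lambda>y. FD (\<lambda>y. f y \<bullet> b) y w) has_derivative (\<lambda>w'. FD (\<lambda>y. FD f y w) x w' \<bullet> b)) (at x)"
      by (rule has_derivative_transform_within_open[OF _ assms(1,3)]) (simp add: 1)
    from FD_eq[OF this] show ?thesis by simp
  qed
  show "FD (\<lambda>y. FD f y v) x u \<bullet> b = FD (\<lambda>y. FD f y u) x v \<bullet> b"
    using FD_FD_symmetric_real[OF assms(1) s assms(3), of v u] unfolding 2 .
qed

section \<open>Bump functions\<close>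

text \<open>
  The functions \<open>exp(-1/t)/t\<^sup>n\<close> are closed under differentiation up to linear
  combinations, so all orders of smoothness follow by one induction.
\<close>

definition flat_exp :: "nat \<Rightarrow> real \<Rightarrow> real" where
  "flat_exp n t = (if t > 0 then exp (- 1 / t) / t ^ n else 0)"

text \<open>Raising 1 + s \<le> exp s with s = 1/(m t) to the power m gives exp(-1/t) \<le> m^m t^m.
  The choice m = n + 2 leaves a factor t^2 after division by t^n, which makes the difference
  quotient at 0 tend to 0; the constant is m^m.\<close>

lemma flat_exp_bound: "\<bar>flat_exp n t\<bar> \<le> real ((n + 2) ^ (n + 2)) * t\<^sup>2"
proof (cases "t > 0")
  case True
  obtain m where m: "m = n + 2" "real m > 0" by auto
  have "(1 / t / real m) ^ m \<le> exp (1 / t / real m) ^ m"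
    using True exp_ge_add_one_self[of "1 / t / real m"] by (intro power_mono) (linarith, simp)
  also have "\<dots> = exp (1 / t)" by (rule exp_divide_power_eq) (use m(2) in simp)
  finally have "1 \<le> exp (1 / t) * (t ^ m * real m ^ m)"
    using True m(2) by (simp add: power_divide power_mult_distrib pos_divide_le_eq mult.assoc)
  then have "exp (- 1 / t) \<le> real m ^ m * t ^ m"
    by (simp add: exp_minus field_simps)
  also have "t ^ m = t ^ n * t\<^sup>2" by (simp add: m(1) power_add power2_eq_square)
  finally show ?thesis using True
    unfolding m(1)[symmetric] by (simp add: flat_exp_def pos_divide_le_eq mult_ac)
qed (simp add: flat_exp_def)

lemma flat_exp_has_derivative:
  "(flat_exp n has_real_derivative (flat_exp (n + 2) t - real n * flat_exp (n + 1) t)) (at t)"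
proof -
  consider "t < 0" | "t = 0" | "t > 0" by linarith
  then show ?thesis
  proof cases
    case 1
    have "((\<lambda>x. 0 :: real) has_real_derivative 0) (at t)" by simp
    then have "(flat_exp n has_real_derivative 0) (at t)"
      by (rule has_field_derivative_transform_within_open[of _ _ _ "{..<0}"]) (use 1 in \<open>auto simp: flat_exp_def\<close>)
    then show ?thesis using 1 by (simp add: flat_exp_def)
  next
    case 2
    define C where "C = real ((n + 2) ^ (n + 2))"
    have "(\<lambda>h. (flat_exp n (0 + h) - flat_exp n 0) / h) \<midarrow>0\<rightarrow> 0"
    proof (rule Lim_null_comparison)
      have "norm ((flat_exp n (0 + h) - flat_exp n 0) / h) \<le> C * \<bar>h\<bar>" for h
      proof (cases "h = 0")
        case False
        then have "\<bar>flat_exp n h\<bar> \<le> C * \<bar>h\<bar> * \<bar>h\<bar>"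
          using flat_exp_bound[of n h] by (simp add: C_def power2_eq_square mult.assoc)
        then show ?thesis
          using False by (simp add: flat_exp_def[of n 0] divide_le_eq)
      qed simp
      then show "\<forall>\<^sub>F h in at 0. norm ((flat_exp n (0 + h) - flat_exp n 0) / h) \<le> C * \<bar>h\<bar>"
        by simp
      show "(\<lambda>h. C * \<bar>h\<bar>) \<midarrow>0\<rightarrow> 0"
        by (rule tendsto_eq_intros refl | simp)+
    qed
    then show ?thesis using 2 by (simp add: DERIV_def flat_exp_def[of _ 0])
  next
    case 3
    have "((\<lambda>t. exp (- 1 / t) / t ^ n) has_real_derivative
        (exp (- 1 / t) / t ^ (n + 2) - real n * (exp (- 1 / t) / t ^ (n + 1)))) (at t)"
    proof -
      have alg: "(E / (t * t) * p - E * (N * p / t)) / (p * p) = E / (p * (t * t)) - N * (E / (p * t))"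
        if "t > 0" "p > 0" for t p E N :: real
        using that by (simp add: field_simps)
      have "real n * t ^ (n - Suc 0) = real n * t ^ n / t" using 3 by (cases n) auto
      then have p: "((\<lambda>t. t ^ n) has_real_derivative real n * t ^ n / t) (at t)"
        using DERIV_pow[of n t] by simp
      have e: "((\<lambda>t. exp (- 1 / t)) has_real_derivative exp (- 1 / t) / (t * t)) (at t)"
        using 3 by (auto intro!: derivative_eq_intros)
      have pow: "t ^ (n + 2) = t ^ n * (t * t)" "t ^ (n + 1) = t ^ n * t" by (simp_all add: power_add)
      show ?thesis
        unfolding pow by (rule DERIV_cong[OF DERIV_divide[OF e p] alg]) (use 3 in simp_all)
    qed
    then have "(flat_exp n has_real_derivative
        (exp (- 1 / t) / t ^ (n + 2) - real n * (exp (- 1 / t) / t ^ (n + 1)))) (at t)"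
      by (rule has_field_derivative_transform_within_open[of _ _ _ "{0<..}"]) (use 3 in \<open>auto simp: flat_exp_def\<close>)
    then show ?thesis using 3 by (simp add: flat_exp_def)
  qed
qed

lemma Ck_on_flat_exp: "Ck_on k UNIV (flat_exp n)"
proof (induction k arbitrary: n)
  case 0
  then show ?case
    by (auto intro!: continuous_at_imp_continuous_on DERIV_isCont[OF flat_exp_has_derivative])
next
  case (Suc k)
  show ?case
  proof (rule Ck_on_SucI)
    fix t
    show "(flat_exp n has_derivative (\<lambda>v. (flat_exp (n + 2) t + (- real n) * flat_exp (n + 1) t) * v)) (at t)"
      using flat_exp_has_derivative[of n t] by (simp add: has_field_derivative_def)
  next
    fix v :: real
    show "Ck_on k UNIV (\<lambda>t. (flat_exp (n + 2) t + (- real n) * flat_exp (n + 1) t) * v)"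
      by (intro Ck_on_bilinear[OF _ bounded_bilinear_mult] Ck_on_add Ck_on_const Suc.IH) auto
  qed auto
qed

text \<open>The profile \<open>flat_exp 0\<close> is applied to e^2 - |x - x0|^2, which is positive
  exactly inside the ball, and normalised by its value at the centre. The compact \<open>K\<close>
  is part of the conclusion because its image in a manifold will have to be closed.\<close>

lemma smooth_bump:
  fixes x0 :: "'e::euclidean_space"
  assumes "open S" "x0 \<in> S"
  obtains \<rho> :: "'e \<Rightarrow> real" and K where "smooth_on UNIV \<rho>" "\<rho> x0 = 1" "compact K" "K \<subseteq> S"
    "\<forall>x. x \<notin> K \<longrightarrow> \<rho> x = 0"
proof -
  obtain e where e: "e > 0" "cball x0 e \<subseteq> S" using assms open_contains_cball by blast
  define \<rho> where "\<rho> x = flat_exp 0 (e\<^sup>2 - (x - x0) \<bullet> (x - x0)) * inverse (flat_exp 0 (e\<^sup>2))" for x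
  have "smooth_on UNIV (\<lambda>x. flat_exp 0 (e\<^sup>2 - (x - x0) \<bullet> (x - x0)))"
  proof (rule smooth_on_compose[where T = UNIV and g = "flat_exp 0"])
    show "smooth_on UNIV (\<lambda>x. e\<^sup>2 - (x - x0) \<bullet> (x - x0))"
      by (intro smooth_on_diff smooth_on_inner smooth_on_const smooth_on_ident) auto
    show "smooth_on UNIV (flat_exp 0)" by (simp add: smooth_on_def Ck_on_flat_exp)
  qed auto
  note s = this
  have 1: "smooth_on UNIV \<rho>"
    unfolding \<rho>_def by (rule smooth_on_mult[OF open_UNIV s smooth_on_const])
  have 2: "\<rho> x0 = 1" using e(1) by (simp add: \<rho>_def flat_exp_def)
  have zero: "\<rho> x = 0" if "x \<notin> cball x0 e" for x
  proof -
    have "e < norm (x - x0)" using that by (simp add: dist_norm norm_minus_commute)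
    then have "e\<^sup>2 < (norm (x - x0))\<^sup>2" using e(1) by (intro power_strict_mono) auto
    then show ?thesis by (simp add: \<rho>_def flat_exp_def power2_norm_eq_inner)
  qed
  have 3: "\<forall>x. x \<notin> cball x0 e \<longrightarrow> \<rho> x = 0" using zero by blast
  show thesis by (rule that[OF 1 2 compact_cball e(2) 3])
qed

section \<open>Metrics on open sets and their Christoffel symbols\<close>

definition inner_form :: "('v::euclidean_space \<Rightarrow> 'v \<Rightarrow> real) \<Rightarrow> bool" where
  "inner_form G \<longleftrightarrow> bilinear G \<and> (\<forall>u v. G u v = G v u) \<and> (\<forall>u. u \<noteq> 0 \<longrightarrow> G u u > 0)"

definition orthonormal_frame :: "('v::euclidean_space \<Rightarrow> 'v \<Rightarrow> real) \<Rightarrow> nat \<Rightarrow> (nat \<Rightarrow> 'v) \<Rightarrow> bool" where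
  "orthonormal_frame G n e \<longleftrightarrow> span (e ` {..<n}) = UNIV \<and>
     (\<forall>i<n. \<forall>j<n. G (e i) (e j) = (if i = j then 1 else 0))"

definition local_metric :: "'e::euclidean_space set \<Rightarrow> ('e \<Rightarrow> 'e \<Rightarrow> 'e \<Rightarrow> real) \<Rightarrow> bool" where
  "local_metric U G \<longleftrightarrow> open U \<and> (\<forall>x\<in>U. inner_form (G x)) \<and> (\<forall>u v. smooth_on U (\<lambda>x. G x u v))"

lemma bilinear_linear:
  assumes "bilinear G"
  shows "linear (G u)" "linear (\<lambda>u. G u v)"
  using assms by (auto simp: bilinear_def)

lemma inner_formD:
  assumes "inner_form G"
  shows "bilinear G" "G u v = G v u" "u \<noteq> 0 \<Longrightarrow> G u u > 0" "linear (G u)" "linear (\<lambda>u. G u v)"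
  using assms by (auto simp: inner_form_def bilinear_def)

lemma inner_form_eqI:
  assumes "inner_form G" "\<And>w. G u w = G v w"
  shows "u = v"
proof (rule ccontr)
  assume "u \<noteq> v"
  then have "G (u - v) (u - v) > 0" using inner_formD(3)[OF assms(1)] by simp
  moreover have "G (u - v) (u - v) = 0"
    using linear_diff[OF inner_formD(5)[OF assms(1)]] assms(2) by simp
  ultimately show False by simp
qed

lemma linear_sum_scaleR:
  assumes "\<And>i. i \<in> I \<Longrightarrow> linear (\<phi> i :: _ \<Rightarrow> real)"
  shows "linear (\<lambda>u. \<Sum>i\<in>I. \<phi> i u *\<^sub>R a i)"
  using assms
  by (intro linearI)
     (simp_all add: linear_add linear_cmul scaleR_add_left sum.distrib scaleR_sum_right)

lemma orthonormal_expand: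
  assumes "inner_form G" "orthonormal_frame G n e"
  shows "u = (\<Sum>i<n. G u (e i) *\<^sub>R e i)"
proof -
  note l = inner_formD(4,5)[OF assms(1)]
  have "linear (\<lambda>u. \<Sum>i<n. G u (e i) *\<^sub>R e i)"
    by (rule linear_sum_scaleR[OF l(2)])
  moreover have "u \<in> span (e ` {..<n})" using assms(2) by (simp add: orthonormal_frame_def)
  moreover have "v = (\<Sum>i<n. G v (e i) *\<^sub>R e i)" if "v \<in> e ` {..<n}" for v
  proof -
    obtain j where j: "j < n" "v = e j" using \<open>v \<in> e ` {..<n}\<close> by auto
    have "(\<Sum>i<n. G v (e i) *\<^sub>R e i) = (\<Sum>i<n. if i = j then e i else 0)"
      using assms(2) j by (intro sum.cong) (auto simp: orthonormal_frame_def)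
    then show ?thesis using j by simp
  qed
  ultimately show ?thesis
    using linear_eq_on[where f = "\<lambda>u. u" and B = "e ` {..<n}", OF linear_ident] by blast
qed

text \<open>This is the Riesz vector of \<open>\<phi>\<close>. Christoffel symbols and horizontal
  lifts are built from it: its explicit coefficients make the dependence on the base point visibly
  smooth.\<close>

lemma orthonormal_represent:
  assumes "inner_form G" "orthonormal_frame G n e" "linear \<phi>"
  shows "G (\<Sum>i<n. \<phi> (e i) *\<^sub>R e i) u = \<phi> u"
proof -
  note l = inner_formD(4,5)[OF assms(1)]
  have "G (\<Sum>i<n. \<phi> (e i) *\<^sub>R e i) u = (\<Sum>i<n. \<phi> (e i) * G (e i) u)"
    by (simp add: linear_sum[OF l(2)] linear_cmul[OF l(2)])
  also have "\<dots> = \<phi> (\<Sum>i<n. G u (e i) *\<^sub>R e i)"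
    by (simp add: linear_sum[OF assms(3)] linear_cmul[OF assms(3)] inner_formD(2)[OF assms(1), of u] mult.commute)
  also have "\<dots> = \<phi> u" by (simp only: orthonormal_expand[OF assms(1,2), symmetric])
  finally show ?thesis .
qed

text \<open>Expanding in the other frame turns either trace into the same double sum of G(e_i, e'_j)
  S(e_i, e'_j). This frees the mean curvature from the frame that \<open>SOME\<close>
  selects.\<close>

lemma trace_frame_independent:
  fixes S :: "'v::euclidean_space \<Rightarrow> 'v \<Rightarrow> 'w::real_vector"
  assumes "inner_form G" "orthonormal_frame G n e" "orthonormal_frame G m e'" "bilinear S"
  shows "(\<Sum>i<n. S (e i) (e i)) = (\<Sum>j<m. S (e' j) (e' j))"
proof -
  note l = bilinear_linear[OF assms(4)]
  have "(\<Sum>i<n. S (e i) (e i)) = (\<Sum>i<n. S (e i) (\<Sum>j<m. G (e i) (e' j) *\<^sub>R e' j))"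
    by (simp only: orthonormal_expand[OF assms(1,3), symmetric])
  also have "\<dots> = (\<Sum>i<n. \<Sum>j<m. G (e i) (e' j) *\<^sub>R S (e i) (e' j))"
    by (simp add: linear_sum[OF l(1)] linear_cmul[OF l(1)])
  also have "\<dots> = (\<Sum>j<m. \<Sum>i<n. G (e i) (e' j) *\<^sub>R S (e i) (e' j))" by (rule sum.swap)
  also have "\<dots> = (\<Sum>j<m. S (\<Sum>i<n. G (e' j) (e i) *\<^sub>R e i) (e' j))"
    by (simp add: linear_sum[OF l(2)] linear_cmul[OF l(2)] inner_formD(2)[OF assms(1), of "e' _"])
  also have "\<dots> = (\<Sum>j<m. S (e' j) (e' j))"
    by (simp only: orthonormal_expand[OF assms(1,2), symmetric])
  finally show ?thesis .
qed

section \<open>Smooth orthonormal frames by Gram-Schmidt\<close>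

lemma local_metricD:
  assumes "local_metric U G"
  shows "open U" "x \<in> U \<Longrightarrow> inner_form (G x)" "smooth_on U (\<lambda>x. G x u v)"
  using assms by (auto simp: local_metric_def)

lemma local_metric_subset: "local_metric U G \<Longrightarrow> open T \<Longrightarrow> T \<subseteq> U \<Longrightarrow> local_metric T G"
  unfolding local_metric_def using smooth_on_subset by blast

lemma smooth_on_metric:
  assumes "local_metric U G" "smooth_on U X" "smooth_on U Y"
  shows "smooth_on U (\<lambda>x. G x (X x) (Y x))"
  by (rule smooth_on_bilinear_family[where G = G, OF local_metricD(1)[OF assms(1)]
        inner_formD(1)[OF local_metricD(2)[OF assms(1)]] local_metricD(3)[OF assms(1)] assms(2,3)])

text \<open>Gram-Schmidt applied to a constant sequence \<open>b\<close>. The span clause carries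
  the induction: it places the projection in the span of the earlier \<open>b\<close>, so the
  remainder \<open>w\<close> vanishes at no point of \<open>U\<close> and normalising it keeps
  smoothness.\<close>

lemma gram_schmidt_fields:
  fixes b :: "nat \<Rightarrow> 'e::euclidean_space"
  assumes G: "local_metric U G"
    and b: "\<And>k. k < n \<Longrightarrow> b k \<notin> span (b ` {..<k})"
  shows "\<exists>e. (\<forall>i<n. smooth_on U (e i)) \<and> (\<forall>x\<in>U.
    (\<forall>i<n. \<forall>j<n. G x (e i x) (e j x) = (if i = j then 1 else 0)) \<and>
    span ((\<lambda>i. e i x) ` {..<n}) = span (b ` {..<n}))"
  using b
proof (induction n)
  case 0
  then show ?case by simp
next
  case (Suc n)
  have "\<exists>e. (\<forall>i<n. smooth_on U (e i)) \<and> (\<forall>x\<in>U.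
    (\<forall>i<n. \<forall>j<n. G x (e i x) (e j x) = (if i = j then 1 else 0)) \<and>
    span ((\<lambda>i. e i x) ` {..<n}) = span (b ` {..<n}))"
    by (rule Suc.IH) (simp add: Suc.prems)
  then obtain e where e: "\<forall>i<n. smooth_on U (e i)"
    "\<forall>x\<in>U. (\<forall>i<n. \<forall>j<n. G x (e i x) (e j x) = (if i = j then 1 else 0)) \<and>
      span ((\<lambda>i. e i x) ` {..<n}) = span (b ` {..<n})"
    by (elim exE conjE)
  have smooth: "smooth_on U (e i)" if "i < n" for i using e(1) that by simp
  have orth: "G x (e i x) (e j x) = (if i = j then 1 else 0)" if "x \<in> U" "i < n" "j < n" for x i j
    using e(2)[rule_format, OF that(1)] that(2,3) by simp
  have span: "span ((\<lambda>i. e i x) ` {..<n}) = span (b ` {..<n})" if "x \<in> U" for x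
    using e(2)[rule_format, OF that] by simp
  note U = local_metricD(1)[OF G]
  define w where "w x = b n - (\<Sum>i<n. G x (b n) (e i x) *\<^sub>R e i x)" for x
  define en where "en x = inverse (sqrt (G x (w x) (w x))) *\<^sub>R w x" for x
  define e' where "e' = e(n := en)"
  have w_smooth: "smooth_on U w"
    unfolding w_def using smooth
    by (intro smooth_on_diff smooth_on_sum smooth_on_scaleR smooth_on_const smooth_on_metric[OF G] U) auto
  have proj: "(\<Sum>i<n. G x (b n) (e i x) *\<^sub>R e i x) \<in> span (b ` {..<n})" if "x \<in> U" for x
    unfolding span[OF that, symmetric] by (intro span_sum span_scale span_base) auto
  have w_pos: "G x (w x) (w x) > 0" if "x \<in> U" for x
  proof (rule inner_formD(3)[OF local_metricD(2)[OF G that]])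
    show "w x \<noteq> 0"
    proof
      assume "w x = 0"
      then have "(\<Sum>i<n. G x (b n) (e i x) *\<^sub>R e i x) = b n"
        unfolding w_def using eq_iff_diff_eq_0 by metis
      then show False using proj[OF that] Suc.prems[of n] by simp
    qed
  qed
  have en_smooth: "smooth_on U en"
    unfolding en_def by (intro smooth_on_scaleR smooth_on_inverse_sqrt smooth_on_metric[OF G] w_smooth U w_pos)
  have w_orth: "G x (w x) (e j x) = 0" if "x \<in> U" "j < n" for x j
  proof -
    note l = inner_formD(5)[OF local_metricD(2)[OF G that(1)]]
    have "G x (w x) (e j x) = G x (b n) (e j x) - (\<Sum>i<n. G x (b n) (e i x) * (if i = j then 1 else 0))"
      by (simp add: w_def linear_diff[OF l] linear_sum[OF l] linear_cmul[OF l] orth that)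
    also have "\<dots> = 0" using that by (simp add: if_distrib cong: if_cong)
    finally show ?thesis .
  qed
  have orth': "G x (e' i x) (e' j x) = (if i = j then 1 else 0)" if "x \<in> U" "i < Suc n" "j < Suc n" for x i j
  proof -
    note f = local_metricD(2)[OF G \<open>x \<in> U\<close>]
    note l = inner_formD(4,5)[OF f]
    have "G x (en x) (en x) = 1"
      using w_pos[OF \<open>x \<in> U\<close>] by (simp add: en_def linear_cmul[OF l(1)] linear_cmul[OF l(2)] field_simps)
    moreover have "G x (en x) (e k x) = 0" "G x (e k x) (en x) = 0" if "k < n" for k
      using w_orth[OF \<open>x \<in> U\<close> that] inner_formD(2)[OF f, of "e k x"]
      by (simp_all add: en_def linear_cmul[OF l(2)])
    ultimately show ?thesis using that(2,3) orth[OF that(1), of i j]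
      by (cases "i = n"; cases "j = n") (simp_all add: e'_def)
  qed
  have span': "span ((\<lambda>i. e' i x) ` {..<Suc n}) = span (b ` {..<Suc n})" if x: "x \<in> U" for x
  proof -
    let ?s = "sqrt (G x (w x) (w x))"
    have E: "(\<lambda>i. e' i x) ` {..<Suc n} = insert (en x) ((\<lambda>i. e i x) ` {..<n})"
      by (simp add: e'_def lessThan_Suc)
    have B: "b ` {..<Suc n} = insert (b n) (b ` {..<n})" by (simp add: lessThan_Suc)
    let ?P = "\<Sum>i<n. G x (b n) (e i x) *\<^sub>R e i x"
    have P: "?P \<in> span (insert (b n) (b ` {..<n}))"
      by (rule subsetD[OF span_mono[OF subset_insertI] proj[OF x]])
    have "w x \<in> span (insert (b n) (b ` {..<n}))"
      unfolding w_def by (rule span_diff[OF span_base P]) simp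
    then have 1: "en x \<in> span (insert (b n) (b ` {..<n}))"
      unfolding en_def by (rule span_scale)
    have "(\<lambda>i. e i x) ` {..<n} \<subseteq> span (b ` {..<n})"
      unfolding span[OF x, symmetric] by (rule span_superset)
    then have 2: "(\<lambda>i. e i x) ` {..<n} \<subseteq> span (insert (b n) (b ` {..<n}))"
      by (rule order_trans[OF _ span_mono[OF subset_insertI]])
    have "b ` {..<n} \<subseteq> span ((\<lambda>i. e i x) ` {..<n})"
      unfolding span[OF x] by (rule span_superset)
    then have 3: "b ` {..<n} \<subseteq> span (insert (en x) ((\<lambda>i. e i x) ` {..<n}))"
      by (rule order_trans[OF _ span_mono[OF subset_insertI]])
    have Q: "?P \<in> span (insert (en x) ((\<lambda>i. e i x) ` {..<n}))"
      by (intro span_sum span_scale span_base) auto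
    have sw: "?s *\<^sub>R en x = w x" using w_pos[OF x] by (simp add: en_def)
    have eq: "?s *\<^sub>R en x + ?P = b n" unfolding sw unfolding w_def by simp
    have "?s *\<^sub>R en x + ?P \<in> span (insert (en x) ((\<lambda>i. e i x) ` {..<n}))"
      by (rule span_add[OF span_scale[OF span_base[OF insertI1]] Q])
    then have 4: "b n \<in> span (insert (en x) ((\<lambda>i. e i x) ` {..<n}))"
      unfolding eq .
    show ?thesis unfolding E B span_eq insert_subset by (intro conjI 1 2 3 4)
  qed
  have "smooth_on U (e' i)" if "i < Suc n" for i
    using that smooth[of i] en_smooth by (cases "i = n") (simp_all add: e'_def)
  then show ?case
    using orth' span' by (intro exI[of _ e'] conjI ballI allI impI)
qed

lemma local_orthonormal_frame:
  fixes G :: "'e::euclidean_space \<Rightarrow> 'e \<Rightarrow> 'e \<Rightarrow> real"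
  assumes "local_metric U G"
  obtains e where "\<forall>i<DIM('e). smooth_on U (e i)"
    "\<forall>x\<in>U. orthonormal_frame (G x) DIM('e) (\<lambda>i. e i x)"
proof -
  obtain b where b: "bij_betw b {0..<DIM('e)} (Basis :: 'e set)"
    using ex_bij_betw_nat_finite[OF finite_Basis] by blast
  have image: "b ` {..<DIM('e)} = Basis"
    using b by (simp add: bij_betw_def atLeast0LessThan)
  have "b k \<notin> span (b ` {..<k})" if "k < DIM('e)" for k
  proof -
    have "b ` {..<k} \<subseteq> Basis - {b k}"
    proof
      fix y assume "y \<in> b ` {..<k}"
      then obtain j where j: "j < k" "y = b j" by auto
      have "b j \<noteq> b k"
        using inj_onD[OF bij_betw_imp_inj_on[OF b], of j k] j that by auto
      then show "y \<in> Basis - {b k}" using j that image by force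
    qed
    moreover have "b k \<notin> span (Basis - {b k})"
      using independent_Basis that image unfolding dependent_def by blast
    ultimately show ?thesis using span_mono by blast
  qed
  then obtain e where
    e: "\<forall>i<DIM('e). smooth_on U (e i)"
    "\<forall>x\<in>U. (\<forall>i<DIM('e). \<forall>j<DIM('e). G x (e i x) (e j x) = (if i = j then 1 else 0)) \<and>
      span ((\<lambda>i. e i x) ` {..<DIM('e)}) = span (b ` {..<DIM('e)})"
    using gram_schmidt_fields[OF assms, of "DIM('e)" b] by (elim meta_impE exE conjE)
  show thesis
    by (rule that[of e]) (use e in \<open>simp_all add: orthonormal_frame_def image\<close>)
qed

section \<open>Christoffel symbols from the Koszul formula\<close>

text \<open>The right-hand side of the Koszul formula for coordinate vector fields, whose brackets
  vanish: a Christoffel symbol of the first kind.\<close>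

definition koszul :: "('e::euclidean_space \<Rightarrow> 'e \<Rightarrow> 'e \<Rightarrow> real) \<Rightarrow> 'e \<Rightarrow> 'e \<Rightarrow> 'e \<Rightarrow> 'e \<Rightarrow> real" where
  "koszul G x w u v =
     (FD (\<lambda>y. G y u v) x w + FD (\<lambda>y. G y w v) x u - FD (\<lambda>y. G y w u) x v) / 2"

text \<open>The condition in the definition of \<open>christoffel\<close>, for a metric on an open
  set of the model space. Keeping its exact form makes \<open>christoffel_eq_Chr\<close> a matter of
  unfolding.\<close>

definition is_Chr :: "('e::euclidean_space \<Rightarrow> 'e \<Rightarrow> 'e \<Rightarrow> real) \<Rightarrow> 'e \<Rightarrow> ('e \<Rightarrow> 'e \<Rightarrow> 'e) \<Rightarrow> bool" where
  "is_Chr G x \<Gamma> \<longleftrightarrow> bilinear \<Gamma> \<and> (\<forall>u v. \<Gamma> u v = \<Gamma> v u) \<and>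
     (\<forall>w u v. FD (\<lambda>y. G y u v) x w = G x (\<Gamma> w u) v + G x u (\<Gamma> w v))"

definition Chr :: "('e::euclidean_space \<Rightarrow> 'e \<Rightarrow> 'e \<Rightarrow> real) \<Rightarrow> 'e \<Rightarrow> 'e \<Rightarrow> 'e \<Rightarrow> 'e" where
  "Chr G x = (THE \<Gamma>. is_Chr G x \<Gamma>)"

lemma FD_metric_sym:
  assumes "local_metric U G" "x \<in> U"
  shows "FD (\<lambda>y. G y u v) x = FD (\<lambda>y. G y v u) x"
proof (rule FD_cong[OF local_metricD(1)[OF assms(1)] assms(2)])
  show "(\<lambda>y. G y u v) differentiable at x"
    using smooth_on_has_derivative[OF local_metricD(3,1)[OF assms(1)] assms(2)] by (rule differentiableI)
qed (rule inner_formD(2)[OF local_metricD(2)[OF assms(1)]])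

lemma FD_metric_linear:
  assumes "local_metric U G" "x \<in> U"
  shows "linear (FD (\<lambda>y. G y u v) x)" "linear (\<lambda>u. FD (\<lambda>y. G y u v) x w)" "linear (\<lambda>v. FD (\<lambda>y. G y u v) x w)"
proof -
  note m = local_metricD[OF assms(1)]
  have d: "((\<lambda>y. G y u v) has_derivative FD (\<lambda>y. G y u v) x) (at x)" for u v
    by (rule smooth_on_has_derivative[OF m(3,1) assms(2)])
  show "linear (FD (\<lambda>y. G y u v) x)" by (rule has_derivative_linear[OF d])
  show *: "linear (\<lambda>u. FD (\<lambda>y. G y u v) x w)" for v w
  proof (rule linearI)
    fix a b :: 'a and r :: real
    have "((\<lambda>y. G y (a + b) v) has_derivative (\<lambda>w. FD (\<lambda>y. G y a v) x w + FD (\<lambda>y. G y b v) x w)) (at x)"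
      by (rule has_derivative_transform_within_open[OF has_derivative_add[OF d d] m(1) assms(2)])
         (simp add: linear_add[OF inner_formD(5)[OF m(2)]])
    from FD_eq[OF this] show "FD (\<lambda>y. G y (a + b) v) x w = FD (\<lambda>y. G y a v) x w + FD (\<lambda>y. G y b v) x w" by simp
    have "((\<lambda>y. G y (r *\<^sub>R a) v) has_derivative (\<lambda>w. r *\<^sub>R FD (\<lambda>y. G y a v) x w)) (at x)"
      by (rule has_derivative_transform_within_open[OF has_derivative_scaleR_right[OF d] m(1) assms(2)])
         (simp add: linear_cmul[OF inner_formD(5)[OF m(2)]])
    from FD_eq[OF this] show "FD (\<lambda>y. G y (r *\<^sub>R a) v) x w = r *\<^sub>R FD (\<lambda>y. G y a v) x w" by simp
  qed
  show "linear (\<lambda>v. FD (\<lambda>y. G y u v) x w)" by (subst FD_metric_sym[OF assms]) (rule *)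
qed

lemma koszul_linear:
  assumes "local_metric U G" "x \<in> U"
  shows "linear (\<lambda>w. koszul G x w u v)" "linear (\<lambda>u. koszul G x w u v)" "linear (koszul G x w u)"
proof -
  note l = FD_metric_linear[OF assms]
  note [simp] = linear_add[OF l(1)] linear_add[OF l(2)] linear_add[OF l(3)]
    linear_cmul[OF l(1)] linear_cmul[OF l(2)] linear_cmul[OF l(3)]
  show "linear (\<lambda>w. koszul G x w u v)" "linear (\<lambda>u. koszul G x w u v)" "linear (koszul G x w u)"
    by (rule linearI; simp add: koszul_def field_simps)+
qed

lemma koszul_sym:
  assumes "local_metric U G" "x \<in> U"
  shows "koszul G x w u v = koszul G x u w v"
  unfolding koszul_def by (simp add: FD_metric_sym[OF assms, of w u])

text \<open>When the three derivatives in \<open>koszul\<close> are rewritten by metric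
  compatibility, symmetry of \<open>\<Gamma>\<close> cancels all but two equal terms. With
  nondegeneracy of the metric this gives uniqueness.\<close>

lemma is_Chr_koszul:
  assumes "local_metric U G" "x \<in> U" "is_Chr G x \<Gamma>"
  shows "G x (\<Gamma> w u) v = koszul G x w u v"
proof -
  note f = inner_formD(2)[OF local_metricD(2)[OF assms(1,2)]]
  have s: "\<Gamma> a b = \<Gamma> b a" for a b using assms(3) by (auto simp: is_Chr_def)
  have D: "FD (\<lambda>y. G y b c) x a = G x (\<Gamma> a b) c + G x (\<Gamma> a c) b" for a b c
    using assms(3) f[of b] by (auto simp: is_Chr_def)
  show ?thesis unfolding koszul_def D s[of u w] s[of v w] s[of v u] by simp
qed

text \<open>Existence: the Koszul formula is solved by the Riesz vector of
  \<open>koszul G x w u\<close>. Metric compatibility holds since the two values of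
  \<open>koszul\<close> with the last arguments exchanged add up to the derivative of the
  metric.\<close>

lemma is_Chr_frame:
  assumes "local_metric U G" "x \<in> U" "orthonormal_frame (G x) n e"
  shows "is_Chr G x (\<lambda>w u. \<Sum>i<n. koszul G x w u (e i) *\<^sub>R e i)" (is "is_Chr G x ?\<Gamma>")
proof -
  note f = local_metricD(2)[OF assms(1,2)]
  note k = koszul_linear[OF assms(1,2)]
  have G: "G x (?\<Gamma> w u) v = koszul G x w u v" for w u v
    by (rule orthonormal_represent[OF f assms(3) k(3)])
  have "bilinear ?\<Gamma>"
    unfolding bilinear_def
    by (intro conjI allI linear_sum_scaleR k)
  moreover have "?\<Gamma> w u = ?\<Gamma> u w" for w u by (simp add: koszul_sym[OF assms(1,2), of w])
  moreover have "FD (\<lambda>y. G y u v) x w = G x (?\<Gamma> w u) v + G x u (?\<Gamma> w v)" for w u v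
  proof -
    have "koszul G x w u v + koszul G x w v u = FD (\<lambda>y. G y u v) x w"
      unfolding koszul_def
      by (simp add: FD_metric_sym[OF assms(1,2), of v u] FD_metric_sym[OF assms(1,2), of v w] FD_metric_sym[OF assms(1,2), of u w] field_simps)
    then show ?thesis
      using G[of w u v] G[of w v u] inner_formD(2)[OF f, of u "?\<Gamma> w v"] by linarith
  qed
  ultimately show ?thesis unfolding is_Chr_def by blast
qed

lemma is_Chr_unique:
  assumes "local_metric U G" "x \<in> U" "is_Chr G x \<Gamma>" "is_Chr G x \<Gamma>'"
  shows "\<Gamma> = \<Gamma>'"
  by (intro ext inner_form_eqI[OF local_metricD(2)[OF assms(1,2)]])
     (simp add: is_Chr_koszul[OF assms(1,2,3)] is_Chr_koszul[OF assms(1,2,4)])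

lemma Chr_eq:
  assumes "local_metric U G" "x \<in> U" "is_Chr G x \<Gamma>"
  shows "Chr G x = \<Gamma>"
  unfolding Chr_def using is_Chr_unique[OF assms(1,2)] assms(3) by blast

lemma is_Chr_Chr:
  assumes "local_metric U G" "x \<in> U"
  shows "is_Chr G x (Chr G x)"
proof -
  obtain e where "\<forall>i<DIM('a). smooth_on U (e i)"
    and e: "\<forall>x\<in>U. orthonormal_frame (G x) DIM('a) (\<lambda>i. e i x)"
    by (rule local_orthonormal_frame[OF assms(1)])
  from is_Chr_frame[OF assms e[rule_format, OF assms(2)]] have \<Gamma>: "is_Chr G x
      (\<lambda>w u. \<Sum>i<DIM('a). koszul G x w u (e i x) *\<^sub>R e i x)" .
  show ?thesis unfolding Chr_eq[OF assms \<Gamma>] by (rule \<Gamma>)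
qed

lemma ChrD:
  assumes "local_metric U G" "x \<in> U"
  shows "bilinear (Chr G x)" "Chr G x u v = Chr G x v u"
    "FD (\<lambda>y. G y u v) x w = G x (Chr G x w u) v + G x u (Chr G x w v)"
  using is_Chr_Chr[OF assms] by (auto simp: is_Chr_def)

text \<open>The definite description gives no control over how \<open>Chr G x\<close> varies with
  \<open>x\<close>; the formula of \<open>is_Chr_frame\<close> in a smooth frame does.\<close>

lemma smooth_on_Chr:
  fixes G :: "'e::euclidean_space \<Rightarrow> 'e \<Rightarrow> 'e \<Rightarrow> real"
  assumes "local_metric U G"
  shows "smooth_on U (\<lambda>x. Chr G x u v)"
proof -
  note m = local_metricD[OF assms(1)]
  obtain e where e: "\<forall>i<DIM('e). smooth_on U (e i)"
    "\<forall>x\<in>U. orthonormal_frame (G x) DIM('e) (\<lambda>i. e i x)"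
    by (rule local_orthonormal_frame[OF assms(1)])
  have k: "smooth_on U (\<lambda>x. koszul G x u v w)" for w
    unfolding koszul_def divide_real_def
    by (intro smooth_on_mult smooth_on_add smooth_on_diff smooth_on_FD smooth_on_const m)
  have "smooth_on U (\<lambda>x. \<Sum>i<DIM('e). koszul G x u v (e i x) *\<^sub>R e i x)"
  proof (intro smooth_on_sum smooth_on_scaleR m(1))
    fix i assume "i \<in> {..<DIM('e)}"
    then show "smooth_on U (e i)" using e(1) by simp
    then show "smooth_on U (\<lambda>x. koszul G x u v (e i x))"
      using smooth_on_linear_family[where L = "\<lambda>x. koszul G x u v", OF m(1) _ k] koszul_linear(3)[OF assms] by blast
  qed
  then show ?thesis
    by (rule smooth_on_cong[OF m(1)])
       (simp add: Chr_eq[OF assms _ is_Chr_frame[OF assms _ e(2)[rule_format]]])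
qed

section \<open>The second fundamental form in coordinates\<close>

definition local_map :: "'e::euclidean_space set \<Rightarrow> ('e \<Rightarrow> 'e \<Rightarrow> 'e \<Rightarrow> real) \<Rightarrow>
    'f::euclidean_space set \<Rightarrow> ('f \<Rightarrow> 'f \<Rightarrow> 'f \<Rightarrow> real) \<Rightarrow> ('e \<Rightarrow> 'f) \<Rightarrow> bool" where
  "local_map U G V H f \<longleftrightarrow> local_metric U G \<and> local_metric V H \<and> smooth_on U f \<and> f ` U \<subseteq> V"

text \<open>The second fundamental form on tangent vectors instead of fields: \<open>u\<close> and
  \<open>v\<close> are extended with constant coefficients. That derivatives of the second field
  cancel in general is shown in \<open>second_ff_eq_local_sff\<close>.\<close>

definition local_sff :: "('e::euclidean_space \<Rightarrow> 'e \<Rightarrow> 'e \<Rightarrow> real) \<Rightarrow>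
    ('f::euclidean_space \<Rightarrow> 'f \<Rightarrow> 'f \<Rightarrow> real) \<Rightarrow> ('e \<Rightarrow> 'f) \<Rightarrow> 'e \<Rightarrow> 'e \<Rightarrow> 'e \<Rightarrow> 'f" where
  "local_sff G H f x u v =
     FD (\<lambda>y. FD f y v) x u + Chr H (f x) (FD f x u) (FD f x v) - FD f x (Chr G x u v)"

definition local_hor :: "('e::euclidean_space \<Rightarrow> 'e \<Rightarrow> 'e \<Rightarrow> real) \<Rightarrow>
    ('e \<Rightarrow> 'f::euclidean_space) \<Rightarrow> 'e \<Rightarrow> 'e set" where
  "local_hor G f x = {u. \<forall>k. FD f x k = 0 \<longrightarrow> G x u k = 0}"

definition local_submersion :: "'e::euclidean_space set \<Rightarrow> ('e \<Rightarrow> 'e \<Rightarrow> 'e \<Rightarrow> real) \<Rightarrow>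
    'f::euclidean_space set \<Rightarrow> ('f \<Rightarrow> 'f \<Rightarrow> 'f \<Rightarrow> real) \<Rightarrow> ('e \<Rightarrow> 'f) \<Rightarrow> bool" where
  "local_submersion U G V H f \<longleftrightarrow> local_map U G V H f \<and>
     (\<forall>x\<in>U. FD f x ` local_hor G f x = UNIV \<and>
       (\<forall>u\<in>local_hor G f x. \<forall>v\<in>local_hor G f x. H (f x) (FD f x u) (FD f x v) = G x u v))"

definition local_isometry :: "'e::euclidean_space set \<Rightarrow> ('e \<Rightarrow> 'e \<Rightarrow> 'e \<Rightarrow> real) \<Rightarrow>
    'f::euclidean_space set \<Rightarrow> ('f \<Rightarrow> 'f \<Rightarrow> 'f \<Rightarrow> real) \<Rightarrow> ('e \<Rightarrow> 'f) \<Rightarrow> bool" where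
  "local_isometry U G V H f \<longleftrightarrow> local_map U G V H f \<and>
     (\<forall>x\<in>U. surj (FD f x) \<and> (\<forall>u v. H (f x) (FD f x u) (FD f x v) = G x u v))"

lemma local_mapD:
  assumes "local_map U G V H f"
  shows "local_metric U G" "local_metric V H" "open U" "open V" "smooth_on U f"
    "x \<in> U \<Longrightarrow> f x \<in> V" "x \<in> U \<Longrightarrow> (f has_derivative FD f x) (at x)" "x \<in> U \<Longrightarrow> linear (FD f x)"
    "x \<in> U \<Longrightarrow> ((\<lambda>y. FD f y v) has_derivative FD (\<lambda>y. FD f y v) x) (at x)"
proof -
  show 1: "local_metric U G" "local_metric V H" "smooth_on U f" "x \<in> U \<Longrightarrow> f x \<in> V"
    using assms by (auto simp: local_map_def)
  show 2: "open U" "open V" using 1(1,2)[THEN local_metricD(1)] .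
  show "x \<in> U \<Longrightarrow> (f has_derivative FD f x) (at x)" "x \<in> U \<Longrightarrow> linear (FD f x)"
    by (rule smooth_on_has_derivative[OF 1(3) 2(1)], assumption)
       (rule smooth_on_linear[OF 1(3) 2(1)], assumption)
  show "x \<in> U \<Longrightarrow> ((\<lambda>y. FD f y v) has_derivative FD (\<lambda>y. FD f y v) x) (at x)"
    by (rule smooth_on_has_derivative[OF smooth_on_FD[OF 1(3)] 2(1)])
qed

lemma local_map_subset:
  assumes "local_map U G V H f" "open T" "T \<subseteq> U"
  shows "local_map T G V H f"
  using assms local_metric_subset[OF local_mapD(1)[OF assms(1)] assms(2,3)]
    smooth_on_subset[OF local_mapD(5)[OF assms(1)] assms(3)]
  unfolding local_map_def by blast

lemma local_map_compose:
  assumes "local_map U G V H f" "local_map V H W K h"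
  shows "local_map U G W K (\<lambda>x. h (f x))"
proof -
  have "smooth_on U (\<lambda>x. h (f x))"
    by (rule smooth_on_compose[where g = h, OF local_mapD(3)[OF assms(1)] local_mapD(4)[OF assms(1)] _
          local_mapD(5)[OF assms(1)] local_mapD(5)[OF assms(2)]])
       (use assms(1) in \<open>simp add: local_map_def\<close>)
  then show ?thesis using assms unfolding local_map_def by blast
qed

lemma FD_compose:
  assumes "local_map U G V H f" "local_map V H W K h" "x \<in> U"
  shows "FD (\<lambda>x. h (f x)) x v = FD h (f x) (FD f x v)"
  using FD_eq[OF has_derivative_compose[OF local_mapD(7)[OF assms(1,3)]
      local_mapD(7)[OF assms(2) local_mapD(6)[OF assms(1,3)]]]] by simp

lemma FD_FD_compose:
  assumes f: "local_map U G V H f" and h: "local_map V H W K h" and x: "x \<in> U"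
  shows "FD (\<lambda>y. FD (\<lambda>x. h (f x)) y v) x u =
    FD (\<lambda>z. FD h z (FD f x v)) (f x) (FD f x u) + FD h (f x) (FD (\<lambda>y. FD f y v) x u)"
proof -
  note fx = local_mapD(6)[OF f]
  have L: "((\<lambda>y. FD h (f y) a) has_derivative (\<lambda>w. FD (\<lambda>z. FD h z a) (f x) (FD f x w))) (at x)" for a
    by (rule has_derivative_compose[where g = "\<lambda>z. FD h z a",
          OF local_mapD(7)[OF f x] local_mapD(9)[OF h fx[OF x]]])
  have "((\<lambda>y. FD h (f y) (FD f y v)) has_derivative
      (\<lambda>w. FD (\<lambda>z. FD h z (FD f x v)) (f x) (FD f x w) + FD h (f x) (FD (\<lambda>y. FD f y v) x w))) (at x)"
    by (rule has_derivative_linear_family[where L = "\<lambda>y. FD h (f y)" and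
          L' = "\<lambda>a w. FD (\<lambda>z. FD h z a) (f x) (FD f x w)",
          OF local_mapD(3)[OF f] x local_mapD(8)[OF h fx] L local_mapD(9)[OF f x]])
  then have "((\<lambda>y. FD (\<lambda>x. h (f x)) y v) has_derivative
      (\<lambda>w. FD (\<lambda>z. FD h z (FD f x v)) (f x) (FD f x w) + FD h (f x) (FD (\<lambda>y. FD f y v) x w))) (at x)"
    by (rule has_derivative_transform_within_open[OF _ local_mapD(3)[OF f] x])
       (rule FD_compose[OF f h, symmetric])
  from FD_eq[OF this] show ?thesis by simp
qed

text \<open>The second-order chain rule accounts for the second derivatives, and the image under the
  derivative of \<open>h\<close> of the Christoffel term of the middle metric occurs once with each
  sign.\<close>

lemma local_sff_compose:
  assumes f: "local_map U G V H f" and h: "local_map V H W K h" and x: "x \<in> U"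
  shows "local_sff G K (\<lambda>x. h (f x)) x u v =
    local_sff H K h (f x) (FD f x u) (FD f x v) + FD h (f x) (local_sff G H f x u v)"
proof -
  note l = local_mapD(8)[OF h local_mapD(6)[OF f x]]
  show ?thesis
    unfolding local_sff_def FD_FD_compose[OF f h x] FD_compose[OF f h x]
    by (simp add: linear_add[OF l] linear_diff[OF l])
qed

lemma local_sff_sym:
  assumes f: "local_map U G V H f" and x: "x \<in> U"
  shows "local_sff G H f x u v = local_sff G H f x v u"
  unfolding local_sff_def
  using FD_FD_symmetric[OF local_mapD(3,5)[OF f] x, of v u] ChrD(2)[OF local_mapD(1)[OF f] x, of u v]
    ChrD(2)[OF local_mapD(2)[OF f] local_mapD(6)[OF f x], of "FD f x u" "FD f x v"] by simp

lemma local_sff_bilinear: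
  assumes f: "local_map U G V H f" and x: "x \<in> U"
  shows "bilinear (local_sff G H f x)"
proof -
  note l = local_mapD(8)[OF f x] has_derivative_linear[OF local_mapD(9)[OF f x]]
    bilinear_linear(2)[OF ChrD(1)[OF local_mapD(1)[OF f] x]]
    bilinear_linear(2)[OF ChrD(1)[OF local_mapD(2)[OF f] local_mapD(6)[OF f x]]]
  have "linear (\<lambda>u. local_sff G H f x u v)" for v
    by (rule linearI)
       (simp_all add: local_sff_def linear_add[OF l(1)] linear_add[OF l(2)] linear_add[OF l(3)] linear_add[OF l(4)]
        linear_cmul[OF l(1)] linear_cmul[OF l(2)] linear_cmul[OF l(3)] linear_cmul[OF l(4)] algebra_simps)
  moreover from this have "linear (local_sff G H f x u)" for u
    using local_sff_sym[OF f x, of u] by (subst ext[of "local_sff G H f x u" "\<lambda>v. local_sff G H f x v u"]) auto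
  ultimately show ?thesis by (simp add: bilinear_def)
qed

lemma local_sff_cong:
  assumes f: "local_map U G V H f" and x: "x \<in> U" and eq: "\<And>y. y \<in> U \<Longrightarrow> f y = g y"
  shows "local_sff G H f x = local_sff G H g x"
proof -
  have 1: "FD f y = FD g y" if "y \<in> U" for y
    by (rule FD_cong[OF local_mapD(3)[OF f] that differentiableI[OF local_mapD(7)[OF f that]] eq])
  have "FD (\<lambda>y. FD f y v) x = FD (\<lambda>y. FD g y v) x" for v
    by (rule FD_cong[OF local_mapD(3)[OF f] x differentiableI[OF local_mapD(9)[OF f x]]]) (simp add: 1)
  then show ?thesis by (intro ext) (simp add: local_sff_def 1[OF x] eq[OF x])
qed

lemma smooth_on_local_sff:
  assumes f: "local_map U G V H f" and X: "smooth_on U X" and Y: "smooth_on U Y"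
  shows "smooth_on U (\<lambda>x. local_sff G H f x (X x) (Y x))"
proof (rule smooth_on_bilinear_family[where G = "\<lambda>x. local_sff G H f x"])
  note U = local_mapD(3)[OF f] and s = local_mapD(5)[OF f]
  show "smooth_on U (\<lambda>x. local_sff G H f x u v)" for u v
    unfolding local_sff_def
  proof (rule smooth_on_diff[OF U smooth_on_add[OF U]])
    show "smooth_on U (\<lambda>x. FD (\<lambda>y. FD f y v) x u)"
      by (rule smooth_on_FD[OF smooth_on_FD[OF s]])
    show "smooth_on U (\<lambda>x. FD f x (Chr G x u v))"
      by (rule smooth_on_FD_field[OF U s smooth_on_Chr[OF local_mapD(1)[OF f]]])
    show "smooth_on U (\<lambda>x. Chr H (f x) (FD f x u) (FD f x v))"
    proof (rule smooth_on_bilinear_family[where G = "\<lambda>x. Chr H (f x)", OF U])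
      show "smooth_on U (\<lambda>x. Chr H (f x) a b)" for a b
        by (rule smooth_on_compose[where g = "\<lambda>z. Chr H z a b", OF U local_mapD(4)[OF f] _ s smooth_on_Chr[OF local_mapD(2)[OF f]]])
           (use f in \<open>simp add: local_map_def\<close>)
      show "bilinear (Chr H (f x))" if "x \<in> U" for x
        by (rule ChrD(1)[OF local_mapD(2)[OF f] local_mapD(6)[OF f that]])
    qed (rule smooth_on_FD[OF s])+
  qed
  show "bilinear (local_sff G H f x)" if "x \<in> U" for x
    by (rule local_sff_bilinear[OF f that])
qed (rule local_mapD(3)[OF f] X Y)+

section \<open>Horizontal lifts and the second fundamental form of a submersion\<close>

text \<open>The vector \<open>u\<close> has the same image as some horizontal \<open>u'\<close>, and
  \<open>u - u'\<close> lies in the kernel, to which \<open>v\<close> is orthogonal. So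
  horizontality of one argument is enough.\<close>

lemma local_submersion_hor:
  assumes f: "local_submersion U G V H f" and x: "x \<in> U" and v: "v \<in> local_hor G f x"
  shows "H (f x) (FD f x u) (FD f x v) = G x u v"
proof -
  have m: "local_map U G V H f" using f by (simp add: local_submersion_def)
  have "FD f x u \<in> FD f x ` local_hor G f x" using f x by (simp add: local_submersion_def)
  then obtain u' where u': "u' \<in> local_hor G f x" "FD f x u = FD f x u'" by auto
  note G = local_metricD(2)[OF local_mapD(1)[OF m] x]
  have "FD f x (u - u') = 0" using u'(2) linear_diff[OF local_mapD(8)[OF m x]] by simp
  then have "G x v (u - u') = 0" using v by (simp add: local_hor_def)
  then have "G x u v = G x u' v"
    using linear_diff[OF inner_formD(4)[OF G]] inner_formD(2)[OF G, of v] by simp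
  moreover have "H (f x) (FD f x u') (FD f x v) = G x u' v"
    using f x u'(1) v by (simp add: local_submersion_def)
  ultimately show ?thesis using u'(2) by simp
qed

text \<open>
  The lift of \<open>a\<close> is the image of \<open>a\<close> under the metric adjoint of the derivative,
  which makes its smoothness evident.
\<close>

lemma horizontal_lift:
  fixes f :: "'e::euclidean_space \<Rightarrow> 'f::euclidean_space"
  assumes f: "local_submersion U G V H f"
  obtains X where "\<forall>Y. smooth_on U Y \<longrightarrow> smooth_on U (\<lambda>x. X (Y x) x)"
    "\<forall>x\<in>U. \<forall>a u. G x (X a x) u = H (f x) a (FD f x u)"
proof -
  have m: "local_map U G V H f" using f by (simp add: local_submersion_def)
  note U = local_mapD(3)[OF m] and s = local_mapD(5)[OF m]
  obtain e where e: "\<forall>i<DIM('e). smooth_on U (e i)"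
    "\<forall>x\<in>U. orthonormal_frame (G x) DIM('e) (\<lambda>i. e i x)"
    by (rule local_orthonormal_frame[OF local_mapD(1)[OF m]])
  define X where "X a x = (\<Sum>i<DIM('e). H (f x) a (FD f x (e i x)) *\<^sub>R e i x)" for a x
  have "smooth_on U (\<lambda>x. X (Y x) x)" if Y: "smooth_on U Y" for Y
    unfolding X_def
  proof (intro smooth_on_sum smooth_on_scaleR U)
    fix i assume "i \<in> {..<DIM('e)}"
    then show ei: "smooth_on U (e i)" using e(1) by simp
    show "smooth_on U (\<lambda>x. H (f x) (Y x) (FD f x (e i x)))"
    proof (rule smooth_on_bilinear_family[where G = "\<lambda>x. H (f x)", OF U _ _ Y smooth_on_FD_field[OF U s ei]])
      show "bilinear (H (f x))" if "x \<in> U" for x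
        by (rule inner_formD(1)[OF local_metricD(2)[OF local_mapD(2)[OF m] local_mapD(6)[OF m that]]])
      show "smooth_on U (\<lambda>x. H (f x) a b)" for a b
        by (rule smooth_on_compose[where g = "\<lambda>z. H z a b", OF U local_mapD(4)[OF m] _ s local_metricD(3)[OF local_mapD(2)[OF m]]])
           (use m in \<open>simp add: local_map_def\<close>)
    qed
  qed
  moreover have "G x (X a x) u = H (f x) a (FD f x u)" if x: "x \<in> U" for x a u
    unfolding X_def
  proof (rule orthonormal_represent[where \<phi> = "\<lambda>u. H (f x) a (FD f x u)"])
    show "linear (\<lambda>u. H (f x) a (FD f x u))"
      using linear_compose[OF local_mapD(8)[OF m x]
          inner_formD(4)[OF local_metricD(2)[OF local_mapD(2)[OF m] local_mapD(6)[OF m x]], of a]]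
      by (simp add: o_def)
  qed (use local_metricD(2)[OF local_mapD(1)[OF m] x] e(2) x in auto)
  ultimately show thesis by (intro that[of X]) simp_all
qed

text \<open>The hypothesis makes \<open>w\<close> the image of \<open>a\<close> under the metric
  adjoint of the derivative. Pairing with kernel vectors gives 0, hence horizontality; pairing with
  horizontal vectors identifies the image of \<open>w\<close>, because their images exhaust the
  target.\<close>

lemma horizontal_liftD:
  assumes f: "local_submersion U G V H f" and x: "x \<in> U"
    and X: "\<And>u. G x w u = H (f x) a (FD f x u)"
  shows "w \<in> local_hor G f x" "FD f x w = a"
proof -
  have m: "local_map U G V H f" using f by (simp add: local_submersion_def)
  note H = local_metricD(2)[OF local_mapD(2)[OF m] local_mapD(6)[OF m x]]
  show "w \<in> local_hor G f x"
    using X linear_0[OF inner_formD(4)[OF H]] by (simp add: local_hor_def)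
  show "FD f x w = a"
  proof (rule inner_form_eqI[OF H])
    fix b
    have "b \<in> FD f x ` local_hor G f x" using f x by (simp add: local_submersion_def)
    then obtain v where v: "v \<in> local_hor G f x" "b = FD f x v" by auto
    show "H (f x) (FD f x w) b = H (f x) a b"
      unfolding v(2) local_submersion_hor[OF f x v(1)] X ..
  qed
qed

text \<open>\<open>X\<close> and \<open>Y\<close> are horizontal lifts of the constants
  \<open>a\<close> and \<open>b\<close>, so G(X, Y) is H(a, b) composed with \<open>f\<close>. This
  identity is differentiated in direction \<open>w\<close>, and metric compatibility of both
  connections turns the result into the claim.\<close>

lemma local_submersion_sff_skew:
  assumes f: "local_submersion U G V H f" and x: "x \<in> U"
    and smooth: "smooth_on U X" "smooth_on U Y"
    and X: "\<And>x u. x \<in> U \<Longrightarrow> G x (X x) u = H (f x) a (FD f x u)"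
    and Y: "\<And>x u. x \<in> U \<Longrightarrow> G x (Y x) u = H (f x) b (FD f x u)"
  shows "H (f x) (local_sff G H f x w (X x)) b + H (f x) a (local_sff G H f x w (Y x)) = 0"
proof -
  have m: "local_map U G V H f" using f by (simp add: local_submersion_def)
  note U = local_mapD(3)[OF m] and s = local_mapD(5)[OF m]
  note mG = local_mapD(1)[OF m] and mH = local_mapD(2)[OF m]
  note G = local_metricD(2)[OF mG x] and H = local_metricD(2)[OF mH local_mapD(6)[OF m x]]
  note lf = local_mapD(8)[OF m x]
  \<comment> \<open>The derivative of \<open>f\<close> sends the lift \<open>Z\<close> to the
    constant \<open>c\<close>. Differentiating this replaces the second derivative of
    \<open>f\<close> by a derivative of \<open>Z\<close>, so the second fundamental form becomes the
    covariant derivative of a constant field minus the image of that of \<open>Z\<close>.\<close>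
  have sff: "local_sff G H f x w (Z x) =
      Chr H (f x) (FD f x w) c - FD f x (FD Z x w + Chr G x w (Z x))"
    if Z: "smooth_on U Z" "\<And>x u. x \<in> U \<Longrightarrow> G x (Z x) u = H (f x) c (FD f x u)" for Z c
  proof -
    have FZ: "FD f y (Z y) = c" if "y \<in> U" for y
      by (rule horizontal_liftD(2)[OF f that Z(2)[OF that]])
    have "((\<lambda>y. FD f y (Z y)) has_derivative (\<lambda>w. FD (\<lambda>y. FD f y (Z x)) x w + FD f x (FD Z x w))) (at x)"
      by (rule has_derivative_linear_family[where L = "FD f" and L' = "\<lambda>v. FD (\<lambda>y. FD f y v) x",
            OF U x local_mapD(8)[OF m] local_mapD(9)[OF m x] smooth_on_has_derivative[OF Z(1) U x]])
    moreover have "((\<lambda>y. FD f y (Z y)) has_derivative (\<lambda>w. 0)) (at x)"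
      by (rule has_derivative_transform_within_open[OF has_derivative_const[of c] U x]) (simp add: FZ)
    ultimately have "FD (\<lambda>y. FD f y (Z x)) x w + FD f x (FD Z x w) = 0"
      using has_derivative_unique by (metis (no_types, lifting))
    then show ?thesis
      unfolding local_sff_def FZ[OF x] linear_add[OF lf] by (simp add: algebra_simps eq_neg_iff_add_eq_0)
  qed
  have "((\<lambda>y. G y (X y) (Y y)) has_derivative
      (\<lambda>w. FD (\<lambda>y. G y (X x) (Y x)) x w + G x (FD X x w) (Y x) + G x (X x) (FD Y x w))) (at x)"
    by (rule has_derivative_bilinear_family[where G = G and G' = "\<lambda>u v. FD (\<lambda>y. G y u v) x",
          OF U x inner_formD(1)[OF local_metricD(2)[OF mG]] smooth_on_has_derivative[OF local_metricD(3)[OF mG] U x]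
          smooth_on_has_derivative[OF smooth(1) U x] smooth_on_has_derivative[OF smooth(2) U x]])
  moreover have "((\<lambda>y. G y (X y) (Y y)) has_derivative (\<lambda>w. FD (\<lambda>z. H z a b) (f x) (FD f x w))) (at x)"
  proof (rule has_derivative_transform_within_open[OF _ U x])
    show "((\<lambda>y. H (f y) a b) has_derivative (\<lambda>w. FD (\<lambda>z. H z a b) (f x) (FD f x w))) (at x)"
      by (rule has_derivative_compose[where g = "\<lambda>z. H z a b", OF local_mapD(7)[OF m x]
            smooth_on_has_derivative[OF local_metricD(3)[OF mH] local_mapD(4)[OF m] local_mapD(6)[OF m x]]])
    show "H (f y) a b = G y (X y) (Y y)" if "y \<in> U" for y
      unfolding X[OF that] horizontal_liftD(2)[OF f that Y[OF that]] ..
  qed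
  ultimately have "FD (\<lambda>y. G y (X x) (Y x)) x w + G x (FD X x w) (Y x) + G x (X x) (FD Y x w) =
      FD (\<lambda>z. H z a b) (f x) (FD f x w)"
    using has_derivative_unique by (metis (no_types, lifting))
  then have eq: "G x (Chr G x w (X x)) (Y x) + G x (X x) (Chr G x w (Y x)) + G x (FD X x w) (Y x) + G x (X x) (FD Y x w) =
      H (f x) (Chr H (f x) (FD f x w) a) b + H (f x) a (Chr H (f x) (FD f x w) b)"
    unfolding ChrD(3)[OF mG x] ChrD(3)[OF mH local_mapD(6)[OF m x]] .
  \<comment> \<open>Products with \<open>Y x\<close> upstairs become products with \<open>b\<close>
    downstairs, by adjointness.\<close>
  have GY: "G x u (Y x) = H (f x) (FD f x u) b" for u
    using inner_formD(2)[OF G, of u "Y x"] inner_formD(2)[OF H, of "FD f x u" b] Y[OF x] by simp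
  note lH = inner_formD(4,5)[OF H]
  have sX: "local_sff G H f x w (X x) = Chr H (f x) (FD f x w) a - FD f x (FD X x w + Chr G x w (X x))"
    by (rule sff[OF smooth(1) X])
  have sY: "local_sff G H f x w (Y x) = Chr H (f x) (FD f x w) b - FD f x (FD Y x w + Chr G x w (Y x))"
    by (rule sff[OF smooth(2) Y])
  show ?thesis
    using eq unfolding sX sY GY X[OF x]
    by (simp add: linear_diff[OF lH(1)] linear_diff[OF lH(2)] linear_add[OF lH(1)] linear_add[OF lH(2)] linear_add[OF lf])
qed

text \<open>
  In terms of horizontal lifts of constant fields, \<open>H(S(X\<^sub>a, X\<^sub>b), c)\<close> is
  symmetric in \<open>a, b\<close> and skew in \<open>b, c\<close>, hence zero.
\<close>

lemma local_submersion_sff: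
  assumes f: "local_submersion U G V H f" and x: "x \<in> U"
    and u: "u \<in> local_hor G f x" and v: "v \<in> local_hor G f x"
  shows "local_sff G H f x u v = 0"
proof -
  have m: "local_map U G V H f" using f by (simp add: local_submersion_def)
  note G = local_metricD(2)[OF local_mapD(1)[OF m] x]
  note H = local_metricD(2)[OF local_mapD(2)[OF m] local_mapD(6)[OF m x]]
  obtain X where X: "\<forall>Y. smooth_on U Y \<longrightarrow> smooth_on U (\<lambda>x. X (Y x) x)"
    "\<forall>x\<in>U. \<forall>a u. G x (X a x) u = H (f x) a (FD f x u)"
    by (rule horizontal_lift[OF f])
  have Xs: "smooth_on U (X a)" for a
    using X(1)[rule_format, OF smooth_on_const[of U a]] .
  \<comment> \<open>A horizontal vector is the lift of its own image, so the lifts of constants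
    exhaust the horizontal space.\<close>
  have X_hor: "X (FD f x u) x = u" if "u \<in> local_hor G f x" for u
    by (rule inner_form_eqI[OF G])
       (simp add: X(2)[rule_format, OF x] local_submersion_hor[OF f x that, symmetric]
         inner_formD(2)[OF H, of "FD f x u"] inner_formD(2)[OF G, of u])
  define T where "T a b c = H (f x) (local_sff G H f x (X a x) (X b x)) c" for a b c
  have skew: "T a b c = - T a c b" for a b c
  proof -
    have "H (f x) (local_sff G H f x (X a x) (X b x)) c + H (f x) b (local_sff G H f x (X a x) (X c x)) = 0"
      by (rule local_submersion_sff_skew[OF f x Xs Xs]) (simp_all add: X(2))
    then show ?thesis unfolding T_def inner_formD(2)[OF H, of b] by linarith
  qed
  have sym: "T a b c = T b a c" for a b c
    unfolding T_def local_sff_sym[OF m x, of "X a x"] ..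
  \<comment> \<open>Alternating the two relations passes through all six orders of the arguments and
    comes back with the opposite sign.\<close>
  have "T a b c = 0" for a b c
    using skew[of a b c] sym[of a c b] skew[of c a b] sym[of c b a] skew[of b c a] sym[of a b c] by linarith
  then have "local_sff G H f x (X a x) (X b x) = 0" for a b
    using inner_formD(3)[OF H, of "local_sff G H f x (X a x) (X b x)"] by (fastforce simp: T_def)
  from this[of "FD f x u" "FD f x v"] show ?thesis unfolding X_hor[OF u] X_hor[OF v] .
qed

lemma local_isometry_sff:
  assumes f: "local_isometry U G V H f" and x: "x \<in> U"
  shows "local_sff G H f x u v = 0"
proof -
  have m: "local_map U G V H f" using f by (simp add: local_isometry_def)
  have hor: "local_hor G f y = UNIV" if y: "y \<in> U" for y
  proof -
    note l = linear_0[OF inner_formD(4)[OF local_metricD(2)[OF local_mapD(2)[OF m] local_mapD(6)[OF m y]]]]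
    have "G y u k = H (f y) (FD f y u) (FD f y k)" for u k
      using f y by (simp add: local_isometry_def)
    then show ?thesis by (simp add: local_hor_def l)
  qed
  have "local_submersion U G V H f"
    using f m by (simp add: local_submersion_def local_isometry_def hor)
  from local_submersion_sff[OF this x] show ?thesis by (simp add: hor[OF x])
qed

section \<open>Charts\<close>

lemma smooth_atlasD:
  fixes A :: "('a::topological_space, 'e::euclidean_space) chart set"
  assumes "smooth_atlas A" "c \<in> A"
  shows "open (cdom c)" "open (coord c ` cdom c)" "p \<in> cdom c \<Longrightarrow> cinv c (coord c p) = p"
    "x \<in> coord c ` cdom c \<Longrightarrow> coord c (cinv c x) = x" "x \<in> coord c ` cdom c \<Longrightarrow> cinv c x \<in> cdom c"
    "continuous_on (coord c ` cdom c) (cinv c)"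
    "open S \<Longrightarrow> open (coord c ` (cdom c \<inter> S))"
proof -
  have c: "is_chart c" using assms by (simp add: smooth_atlas_def)
  then have h: "homeomorphism (cdom c) (coord c ` cdom c) (coord c) (cinv c)" by (simp add: is_chart_def)
  show o: "open (cdom c)" "open (coord c ` cdom c)" using c by (simp_all add: is_chart_def)
  show 1: "p \<in> cdom c \<Longrightarrow> cinv c (coord c p) = p" for p using h by (simp add: homeomorphism_def)
  show "x \<in> coord c ` cdom c \<Longrightarrow> coord c (cinv c x) = x" "x \<in> coord c ` cdom c \<Longrightarrow> cinv c x \<in> cdom c"
    using 1 by auto
  show "continuous_on (coord c ` cdom c) (cinv c)" using h by (simp add: homeomorphism_def)
  assume "open S"
  then have "openin (top_of_set (cdom c)) (cdom c \<inter> S)" by (rule openin_open_Int)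
  then have "openin (top_of_set (coord c ` cdom c)) (coord c ` (cdom c \<inter> S))"
    by (rule homeomorphism_imp_open_map[OF h])
  then show "open (coord c ` (cdom c \<inter> S))" using o(2) by (simp add: openin_open_eq)
qed

lemma coord_image_iff:
  assumes "smooth_atlas A" "c \<in> A"
  shows "x \<in> coord c ` (cdom c \<inter> S) \<longleftrightarrow> x \<in> coord c ` cdom c \<and> cinv c x \<in> S"
proof
  assume "x \<in> coord c ` (cdom c \<inter> S)"
  then obtain p where "p \<in> cdom c" "p \<in> S" "x = coord c p" by auto
  then show "x \<in> coord c ` cdom c \<and> cinv c x \<in> S" using smooth_atlasD(3)[OF assms] by auto
next
  assume x: "x \<in> coord c ` cdom c \<and> cinv c x \<in> S"
  then show "x \<in> coord c ` (cdom c \<inter> S)"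
    using smooth_atlasD(4,5)[OF assms, of x] by (intro image_eqI[of _ _ "cinv c x"]) auto
qed

lemma chart_at:
  assumes "smooth_atlas A"
  shows "chart_at A p \<in> A" "p \<in> cdom (chart_at A p)"
proof -
  have "p \<in> (\<Union>c\<in>A. cdom c)" using assms by (simp add: smooth_atlas_def)
  then have "\<exists>c. c \<in> A \<and> p \<in> cdom c" by blast
  from someI_ex[OF this] show "chart_at A p \<in> A" "p \<in> cdom (chart_at A p)"
    by (simp_all add: chart_at_def)
qed

section \<open>Representatives and differentials in arbitrary charts\<close>

definition chart_rep :: "('a, 'e) chart \<Rightarrow> ('b, 'f) chart \<Rightarrow> ('a \<Rightarrow> 'b) \<Rightarrow> 'e \<Rightarrow> 'f" where
  "chart_rep c d F x = coord d (F (cinv c x))"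

definition rep_dom :: "('a, 'e) chart \<Rightarrow> ('b, 'f) chart \<Rightarrow> ('a \<Rightarrow> 'b) \<Rightarrow> 'e set" where
  "rep_dom c d F = coord c ` (cdom c \<inter> F -` cdom d)"

text \<open>One operator covers \<open>components\<close>, \<open>coord_vec\<close> and
  \<open>differential\<close>: the first two are the differential of \<open>id\<close> between the
  preferred chart and another one. All rules for changing charts thereby become instances of the
  chain rule.\<close>

definition tdiff :: "('a, 'e::real_normed_vector) chart \<Rightarrow> ('b, 'f::real_normed_vector) chart \<Rightarrow>
    ('a \<Rightarrow> 'b) \<Rightarrow> 'a \<Rightarrow> 'e \<Rightarrow> 'f" where
  "tdiff c d F p = FD (chart_rep c d F) (coord c p)"

lemma components_tdiff: "components A c p = tdiff (chart_at A p) c id p"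
  by (intro ext) (simp add: components_def tdiff_def chart_rep_def[abs_def] o_def)

lemma coord_vec_tdiff: "coord_vec A c p = tdiff c (chart_at A p) id p"
  by (intro ext) (simp add: coord_vec_def tdiff_def chart_rep_def[abs_def] o_def)

lemma differential_tdiff:
  "differential A B F p = tdiff (chart_at A p) (chart_at B (F p)) F p"
  by (intro ext) (simp add: differential_def tdiff_def chart_rep_def[abs_def] o_def)

lemma smooth_map_id: "smooth_atlas A \<Longrightarrow> smooth_map A A id"
  by (simp add: smooth_map_def smooth_atlas_def o_def)

lemma rep_dom_iff:
  assumes "smooth_atlas A" "c \<in> A"
  shows "x \<in> rep_dom c d F \<longleftrightarrow> x \<in> coord c ` cdom c \<and> F (cinv c x) \<in> cdom d"
  unfolding rep_dom_def coord_image_iff[OF assms] by simp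

lemma smooth_mapD:
  assumes "smooth_atlas A" "smooth_atlas B" "smooth_map A B F" "c \<in> A" "d \<in> B"
  shows "open (rep_dom c d F)" "smooth_on (rep_dom c d F) (chart_rep c d F)"
    "open S \<Longrightarrow> open (F -` S)"
proof -
  show v: "open S \<Longrightarrow> open (F -` S)" for S
    using assms(3) by (simp add: smooth_map_def continuous_on_open_vimage)
  show "open (rep_dom c d F)"
    unfolding rep_dom_def
    by (intro smooth_atlasD(7)[OF assms(1,4)] v smooth_atlasD(1)[OF assms(2,5)])
  show "smooth_on (rep_dom c d F) (chart_rep c d F)"
    using assms(3-5) unfolding smooth_map_def rep_dom_def chart_rep_def[abs_def] o_def by blast
qed

lemma coord_in_rep_dom: "p \<in> cdom c \<Longrightarrow> F p \<in> cdom d \<Longrightarrow> coord c p \<in> rep_dom c d F"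
  by (auto simp: rep_dom_def)

lemma tdiff_linear:
  assumes "smooth_atlas A" "smooth_atlas B" "smooth_map A B F" "c \<in> A" "d \<in> B"
    "p \<in> cdom c" "F p \<in> cdom d"
  shows "linear (tdiff c d F p)"
  unfolding tdiff_def
  by (rule smooth_on_linear[OF smooth_mapD(2,1)[OF assms(1-5)] coord_in_rep_dom[where F = F, OF assms(6,7)]])

lemma chart_rep_coord: 
  assumes "smooth_atlas A" "c \<in> A" "p \<in> cdom c"
  shows "chart_rep c d F (coord c p) = coord d (F p)"
  using smooth_atlasD(3)[OF assms(1,2,3)] by (simp add: chart_rep_def)

lemma chart_rep_compose:
  assumes B: "smooth_atlas B" "d \<in> B" and "F (cinv c x) \<in> cdom d"
  shows "chart_rep c e (G \<circ> F) x = chart_rep d e G (chart_rep c d F x)"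
  using smooth_atlasD(3)[OF B assms(3)] by (simp add: chart_rep_def)

lemma smooth_map_compose:
  assumes A: "smooth_atlas A" and B: "smooth_atlas B" and C: "smooth_atlas C"
    and F: "smooth_map A B F" and G: "smooth_map B C G"
  shows "smooth_map A C (G \<circ> F)"
  unfolding smooth_map_def
proof (intro conjI ballI)
  have "continuous_on UNIV F" "continuous_on UNIV G" using F G by (simp_all add: smooth_map_def)
  then show "continuous_on UNIV (G \<circ> F)"
    by (intro continuous_on_compose) (auto intro: continuous_on_subset)
  fix c e assume c: "c \<in> A" and e: "e \<in> C"
  have "smooth_on (rep_dom c e (G \<circ> F)) (chart_rep c e (G \<circ> F))"
  proof (rule smooth_on_local)
    fix x assume x: "x \<in> rep_dom c e (G \<circ> F)"
    define d where "d = chart_at B (F (cinv c x))"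
    have d: "d \<in> B" "F (cinv c x) \<in> cdom d" unfolding d_def by (rule chart_at[OF B])+
    define T where "T = coord c ` (cdom c \<inter> F -` (cdom d \<inter> G -` cdom e))"
    have T_iff: "y \<in> T \<longleftrightarrow> y \<in> coord c ` cdom c \<and> F (cinv c y) \<in> cdom d \<and> G (F (cinv c y)) \<in> cdom e" for y
      unfolding T_def coord_image_iff[OF A c] by simp
    have oT: "open T"
      unfolding T_def
      by (intro smooth_atlasD(7)[OF A c] smooth_mapD(3)[OF A B F c d(1)] open_Int
          smooth_atlasD(1)[OF B d(1)] smooth_mapD(3)[OF B C G d(1) e] smooth_atlasD(1)[OF C e])
    have xT: "x \<in> T" using x d(2) unfolding T_iff rep_dom_iff[OF A c] by simp
    have "smooth_on T (\<lambda>x. chart_rep d e G (chart_rep c d F x))"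
    proof (rule smooth_on_compose[where g = "chart_rep d e G", OF oT smooth_mapD(1)[OF B C G d(1) e] _ _ smooth_mapD(2)[OF B C G d(1) e]])
      show "chart_rep c d F ` T \<subseteq> rep_dom d e G"
        by (auto simp: T_iff rep_dom_def chart_rep_def)
      have "T \<subseteq> rep_dom c d F" by (auto simp: T_iff rep_dom_iff[OF A c])
      then show "smooth_on T (chart_rep c d F)"
        by (rule smooth_on_subset[OF smooth_mapD(2)[OF A B F c d(1)]])
    qed
    then have "smooth_on T (chart_rep c e (G \<circ> F))"
      by (rule smooth_on_cong[OF oT]) (simp add: chart_rep_compose[OF B d(1)] T_iff)
    then show "\<exists>T. open T \<and> x \<in> T \<and> smooth_on T (chart_rep c e (G \<circ> F))" using oT xT by blast
  qed
  then show "smooth_on (coord c ` (cdom c \<inter> (G \<circ> F) -` cdom e)) (coord e \<circ> (G \<circ> F) \<circ> cinv c)"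
    unfolding rep_dom_def chart_rep_def[abs_def] o_def .
qed

lemma tdiff_compose:
  assumes A: "smooth_atlas A" and B: "smooth_atlas B" and C: "smooth_atlas C"
    and F: "smooth_map A B F" and G: "smooth_map B C G"
    and ch: "c \<in> A" "d \<in> B" "e \<in> C" and p: "p \<in> cdom c" "F p \<in> cdom d" "G (F p) \<in> cdom e"
  shows "tdiff c e (G \<circ> F) p v = tdiff d e G (F p) (tdiff c d F p v)"
proof -
  let ?x = "coord c p"
  have Fx: "chart_rep c d F ?x = coord d (F p)" by (rule chart_rep_coord[OF A ch(1) p(1)])
  have f: "(chart_rep c d F has_derivative FD (chart_rep c d F) ?x) (at ?x)"
    by (rule smooth_on_has_derivative[OF smooth_mapD(2,1)[OF A B F ch(1,2)] coord_in_rep_dom[where F = F, OF p(1,2)]])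
  have g: "(chart_rep d e G has_derivative FD (chart_rep d e G) (coord d (F p))) (at (chart_rep c d F ?x))"
    unfolding Fx
    by (rule smooth_on_has_derivative[OF smooth_mapD(2,1)[OF B C G ch(2,3)] coord_in_rep_dom[where F = G, OF p(2,3)]])
  have "(chart_rep c e (G \<circ> F) has_derivative (\<lambda>v. FD (chart_rep d e G) (coord d (F p)) (FD (chart_rep c d F) ?x v))) (at ?x)"
    by (rule has_derivative_transform_within_open[OF has_derivative_compose[OF f g]
          smooth_mapD(1)[OF A B F ch(1,2)] coord_in_rep_dom[where F = F, OF p(1,2)]])
       (simp add: rep_dom_iff[OF A ch(1)] chart_rep_compose[OF B ch(2)])
  from FD_eq[OF this] show ?thesis by (simp add: tdiff_def)
qed

lemma tdiff_id:
  assumes A: "smooth_atlas A" "c \<in> A" "p \<in> cdom c"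
  shows "tdiff c c id p v = v"
proof -
  have "(chart_rep c c id has_derivative (\<lambda>v. v)) (at (coord c p))"
    by (rule has_derivative_transform_within_open[OF has_derivative_ident smooth_atlasD(2)[OF A(1,2)]])
       (use A in \<open>auto simp: chart_rep_def smooth_atlasD(3)[OF A(1,2)]\<close>)
  from FD_eq[OF this] show ?thesis by (simp add: tdiff_def)
qed

lemma tdiff_id_compose:
  assumes A: "smooth_atlas A" and "c \<in> A" "d \<in> A" "e \<in> A" "p \<in> cdom c" "p \<in> cdom d" "p \<in> cdom e"
  shows "tdiff d e id p (tdiff c d id p v) = tdiff c e id p v"
  using tdiff_compose[OF A A A smooth_map_id[OF A] smooth_map_id[OF A] assms(2-4), of p v] assms(5-7)
  by simp

lemma coord_vec_components:
  assumes A: "smooth_atlas A" and c: "c \<in> A" "p \<in> cdom c"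
  shows "coord_vec A c p (components A c p v) = v" "components A c p (coord_vec A c p v) = v"
  unfolding coord_vec_tdiff components_tdiff
  by (simp_all add: tdiff_id_compose[OF A] chart_at[OF A] c tdiff_id[OF A])

lemma components_chart_at:
  assumes "smooth_atlas A"
  shows "components A (chart_at A p) p v = v" "coord_vec A (chart_at A p) p v = v"
  by (simp_all add: components_tdiff coord_vec_tdiff tdiff_id[OF assms chart_at[OF assms]])

lemma linear_components:
  assumes "smooth_atlas A" "c \<in> A" "p \<in> cdom c"
  shows "linear (components A c p)" "linear (coord_vec A c p)"
  unfolding components_tdiff coord_vec_tdiff
  by (rule tdiff_linear[OF assms(1,1) smooth_map_id[OF assms(1)]]; simp add: chart_at[OF assms(1)] assms)+

lemma coord_vec_change:
  assumes "smooth_atlas A" "c \<in> A" "d \<in> A" "p \<in> cdom c" "p \<in> cdom d"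
  shows "coord_vec A d p (tdiff c d id p u) = coord_vec A c p u"
  unfolding coord_vec_tdiff
  by (rule tdiff_id_compose[OF assms(1-3) chart_at(1)[OF assms(1)] assms(4,5) chart_at(2)[OF assms(1)]])

lemma linear_differential:
  assumes "smooth_atlas A" "smooth_atlas B" "smooth_map A B F"
  shows "linear (differential A B F p)"
  unfolding differential_tdiff
  by (rule tdiff_linear[OF assms]) (simp_all add: chart_at[OF assms(1)] chart_at[OF assms(2)])

lemma differential_compose:
  assumes "smooth_atlas A" "smooth_atlas B" "smooth_atlas C" "smooth_map A B F" "smooth_map B C G"
  shows "differential A C (G \<circ> F) p v = differential B C G (F p) (differential A B F p v)"
  unfolding differential_tdiff
  using tdiff_compose[OF assms chart_at(1)[OF assms(1)] chart_at(1)[OF assms(2)] chart_at(1)[OF assms(3)]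
    chart_at(2)[OF assms(1)] chart_at(2)[OF assms(2)] chart_at(2)[OF assms(3)]] by simp

lemma differential_id: "smooth_atlas A \<Longrightarrow> differential A A id p v = v"
  by (simp add: differential_tdiff tdiff_id chart_at)

text \<open>Both sides come from the chain rule for the same map, written once as
  \<open>id \<circ> F\<close> and once as \<open>F \<circ> id\<close>.\<close>

lemma components_differential:
  assumes A: "smooth_atlas A" and B: "smooth_atlas B" and F: "smooth_map A B F"
    and c: "c \<in> A" "p \<in> cdom c" and d: "d \<in> B" "F p \<in> cdom d"
  shows "components B d (F p) (differential A B F p v) = tdiff c d F p (components A c p v)"
proof -
  note a = chart_at[OF A] and b = chart_at[OF B]
  have "components B d (F p) (differential A B F p v) = tdiff (chart_at A p) d (id \<circ> F) p v"
    unfolding components_tdiff differential_tdiff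
    by (subst tdiff_compose[OF A B B F smooth_map_id[OF B] a(1) b(1) d(1) a(2) b(2)]) (simp_all add: d)
  also have "\<dots> = tdiff (chart_at A p) d (F \<circ> id) p v" by simp
  also have "\<dots> = tdiff c d F p (components A c p v)"
    unfolding components_tdiff
    by (subst tdiff_compose[OF A A B smooth_map_id[OF A] F a(1) c(1) d(1) a(2)]) (simp_all add: c d)
  finally show ?thesis .
qed

section \<open>Smooth vector fields from local data\<close>

text \<open>One chart around each point suffices, although \<open>smooth_section\<close> asks for
  all pairs of charts: the components in a chart \<open>d\<close> are the Jacobian of a transition
  applied to \<open>y\<close>, and reading them in a chart \<open>c'\<close> composes with another
  transition.\<close>

lemma smooth_section_localI:
  fixes A :: "('a::topological_space, 'e::euclidean_space) chart set"
  assumes A: "smooth_atlas A"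
    and loc: "\<And>q. q \<in> U \<Longrightarrow> \<exists>W c y. open W \<and> q \<in> W \<and> c \<in> A \<and> W \<subseteq> cdom c \<and> smooth_on (coord c ` W) y \<and>
      (\<forall>q\<in>W. Y q = coord_vec A c q (y (coord c q)))"
  shows "smooth_section A A id U Y"
  unfolding smooth_section_def
proof (intro ballI smooth_on_local)
  fix c' d x assume c': "c' \<in> A" and d: "d \<in> A" and x: "x \<in> coord c' ` (cdom c' \<inter> U \<inter> id -` cdom d)"
  then obtain q where q: "q \<in> cdom c'" "q \<in> U" "q \<in> cdom d" "x = coord c' q" by auto
  obtain W c y where W: "open W" "q \<in> W" and c: "c \<in> A" "W \<subseteq> cdom c" and y: "smooth_on (coord c ` W) y"
    and Y: "\<forall>q\<in>W. Y q = coord_vec A c q (y (coord c q))"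
    using loc[OF q(2)] by (elim exE conjE)
  note i = smooth_map_id[OF A]
  define T where "T = coord c' ` (cdom c' \<inter> (cdom d \<inter> W))"
  define Z where "Z = coord c ` (cdom c \<inter> (cdom d \<inter> W))"
  have oT: "open T" and oZ: "open Z"
    unfolding T_def Z_def by (intro smooth_atlasD(7)[OF A] c' c(1) open_Int smooth_atlasD(1)[OF A d] W(1))+
  have "smooth_on Z (\<lambda>z. FD (chart_rep c d id) z (y z))"
  proof (rule smooth_on_FD_field[OF oZ])
    show "smooth_on Z (chart_rep c d id)"
      by (rule smooth_on_subset[OF smooth_mapD(2)[OF A A i c(1) d]]) (auto simp: Z_def rep_dom_def)
    show "smooth_on Z y"
      by (rule smooth_on_subset[OF y]) (auto simp: Z_def)
  qed
  moreover have "smooth_on T (chart_rep c' c id)"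
    by (rule smooth_on_subset[OF smooth_mapD(2)[OF A A i c' c(1)]]) (use c(2) in \<open>auto simp: T_def rep_dom_def\<close>)
  moreover have "chart_rep c' c id ` T \<subseteq> Z"
    using c(2) by (auto simp: T_def Z_def chart_rep_coord[OF A c'])
  ultimately have s: "smooth_on T (\<lambda>x. FD (chart_rep c d id) (chart_rep c' c id x) (y (chart_rep c' c id x)))"
    by (intro smooth_on_compose[where g = "\<lambda>z. FD (chart_rep c d id) z (y z)", OF oT oZ])
  have "smooth_on T (\<lambda>x. components A d (id (cinv c' x)) (Y (cinv c' x)))"
  proof (rule smooth_on_cong[OF oT s])
    fix x' assume "x' \<in> T"
    then obtain q' where q': "q' \<in> cdom c'" "q' \<in> cdom d" "q' \<in> W" "x' = coord c' q'" by (auto simp: T_def)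
    have qc: "q' \<in> cdom c" using q'(3) c(2) by auto
    have "components A d q' (Y q') = components A d q' (coord_vec A d q' (tdiff c d id q' (y (coord c q'))))"
      using Y q'(3) by (simp add: coord_vec_change[OF A c(1) d qc q'(2)])
    also have "\<dots> = tdiff c d id q' (y (coord c q'))"
      by (rule coord_vec_components(2)[OF A d q'(2)])
    finally show "FD (chart_rep c d id) (chart_rep c' c id x') (y (chart_rep c' c id x')) =
        components A d (id (cinv c' x')) (Y (cinv c' x'))"
      unfolding q'(4) by (simp add: chart_rep_coord[OF A c' q'(1)] smooth_atlasD(3)[OF A c' q'(1)] tdiff_def)
  qed
  moreover have "x \<in> T" using q W(2) by (auto simp: T_def)
  ultimately show "\<exists>T. open T \<and> x \<in> T \<and> smooth_on T (\<lambda>x. components A d (id (cinv c' x)) (Y (cinv c' x)))"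
    using oT by blast
qed

text \<open>A bump function cuts off the field that is constant in a chart. Its extension by zero is
  smooth because the compact \<open>L\<close> is closed in the Hausdorff manifold, so that points
  outside the chart have a neighbourhood on which the field vanishes.\<close>

lemma vector_field_extension:
  fixes A :: "('a::t2_space, 'e::euclidean_space) chart set"
  assumes A: "smooth_atlas A"
  obtains Y where "smooth_section A A id UNIV Y" "Y p = v"
proof -
  define c where "c = chart_at A p"
  have c: "c \<in> A" "p \<in> cdom c" unfolding c_def by (rule chart_at[OF A])+
  obtain \<rho> :: "'e \<Rightarrow> real" and K where \<rho>: "smooth_on UNIV \<rho>" "\<rho> (coord c p) = 1" "compact K" "K \<subseteq> coord c ` cdom c"
    and zero: "\<forall>x. x \<notin> K \<longrightarrow> \<rho> x = 0"
    by (rule smooth_bump[OF smooth_atlasD(2)[OF A c(1)] imageI[OF c(2)]])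
  define L where "L = cinv c ` K"
  have "compact L"
    unfolding L_def by (rule compact_continuous_image[OF continuous_on_subset[OF smooth_atlasD(6)[OF A c(1)] \<rho>(4)] \<rho>(3)])
  then have L: "closed L" by (rule compact_imp_closed)
  have Lc: "L \<subseteq> cdom c" unfolding L_def using \<rho>(4) smooth_atlasD(5)[OF A c(1)] by auto
  have zero': "\<rho> (coord c q) = 0" if "q \<in> cdom c" "q \<notin> L" for q
  proof (rule zero[rule_format])
    show "coord c q \<notin> K" using that smooth_atlasD(3)[OF A c(1) that(1)] unfolding L_def by (metis image_eqI)
  qed
  define Y where "Y q = (if q \<in> cdom c then coord_vec A c q (\<rho> (coord c q) *\<^sub>R v) else 0)" for q
  have "smooth_section A A id UNIV Y"
  proof (rule smooth_section_localI[OF A])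
    fix q
    show "\<exists>W c y. open W \<and> q \<in> W \<and> c \<in> A \<and> W \<subseteq> cdom c \<and> smooth_on (coord c ` W) y \<and>
      (\<forall>q\<in>W. Y q = coord_vec A c q (y (coord c q)))"
    proof (cases "q \<in> cdom c")
      case True
      have "smooth_on (coord c ` cdom c) (\<lambda>x. \<rho> x *\<^sub>R v)"
        by (rule smooth_on_subset[OF smooth_on_scaleR[OF open_UNIV \<rho>(1) smooth_on_const]]) simp
      then show ?thesis
        using True smooth_atlasD(1)[OF A c(1)] c(1)
        by (intro exI[of _ "cdom c"] exI[of _ c] exI[of _ "\<lambda>x. \<rho> x *\<^sub>R v"]) (simp add: Y_def)
    next
      case False
      define d where "d = chart_at A q"
      have d: "d \<in> A" "q \<in> cdom d" unfolding d_def by (rule chart_at[OF A])+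
      \<comment> \<open>Inside \<open>cdom c\<close> the bump function vanishes off
        \<open>L\<close>; outside it the field is zero by definition.\<close>
      have "Y q' = coord_vec A d q' 0" if "q' \<in> cdom d - L" for q'
      proof (cases "q' \<in> cdom c")
        case True
        then show ?thesis
          using zero'[OF True] that linear_0[OF linear_components(2)[OF A c(1) True]]
            linear_0[OF linear_components(2)[OF A d(1), of q']] by (simp add: Y_def)
      next
        case False
        then show ?thesis
          using that linear_0[OF linear_components(2)[OF A d(1), of q']] by (simp add: Y_def)
      qed
      then show ?thesis
        using d False Lc smooth_atlasD(1)[OF A d(1)] L
        by (intro exI[of _ "cdom d - L"] exI[of _ d] exI[of _ "\<lambda>x. 0"])
           (auto simp: smooth_on_const)
    qed
  qed
  moreover have "Y p = v"
    using c(2) \<rho>(2) components_chart_at(2)[OF A, of p] by (simp add: Y_def c_def)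
  ultimately show thesis by (rule that)
qed

lemma smooth_fun_compose:
  assumes A: "smooth_atlas A" and B: "smooth_atlas B" and F: "smooth_map A B F" and l: "smooth_fun B l"
  shows "smooth_fun A (l \<circ> F)"
  unfolding smooth_fun_def
proof (intro ballI smooth_on_local)
  fix c x assume c: "c \<in> A" and x: "x \<in> coord c ` cdom c"
  define d where "d = chart_at B (F (cinv c x))"
  have d: "d \<in> B" "F (cinv c x) \<in> cdom d" unfolding d_def by (rule chart_at[OF B])+
  note o = smooth_mapD(1)[OF A B F c d(1)]
  have "smooth_on (rep_dom c d F) (\<lambda>x. (l \<circ> cinv d) (chart_rep c d F x))"
  proof (rule smooth_on_compose[where g = "l \<circ> cinv d", OF o smooth_atlasD(2)[OF B d(1)] _ smooth_mapD(2)[OF A B F c d(1)]])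
    show "chart_rep c d F ` rep_dom c d F \<subseteq> coord d ` cdom d"
      by (auto simp: rep_dom_iff[OF A c] chart_rep_def)
    show "smooth_on (coord d ` cdom d) (l \<circ> cinv d)" using l d(1) by (simp add: smooth_fun_def)
  qed
  then have "smooth_on (rep_dom c d F) (l \<circ> F \<circ> cinv c)"
    by (rule smooth_on_cong[OF o]) (simp add: chart_rep_def rep_dom_iff[OF A c] smooth_atlasD(3)[OF B d(1)])
  moreover have "x \<in> rep_dom c d F" using x d(2) by (simp add: rep_dom_iff[OF A c])
  ultimately show "\<exists>T. open T \<and> x \<in> T \<and> smooth_on T (l \<circ> F \<circ> cinv c)" using o by blast
qed

section \<open>Riemannian manifolds in charts\<close>

lemma riemannian_manifoldD:
  assumes "riemannian_manifold A g"
  shows "smooth_atlas A" "inner_form (g p)"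
    "c \<in> A \<Longrightarrow> smooth_on (coord c ` cdom c) (\<lambda>x. metric_in_chart A g c x u v)"
  using assms by (auto simp: riemannian_manifold_def inner_form_def)

lemma metric_in_chart_coord:
  assumes "smooth_atlas A" "c \<in> A" "p \<in> cdom c"
  shows "metric_in_chart A g c (coord c p) u v = g p (coord_vec A c p u) (coord_vec A c p v)"
  by (simp add: metric_in_chart_def smooth_atlasD(3)[OF assms])

lemma metric_in_chart_components:
  assumes "smooth_atlas A" "c \<in> A" "p \<in> cdom c"
  shows "metric_in_chart A g c (coord c p) (components A c p u) (components A c p v) = g p u v"
  by (simp add: metric_in_chart_coord[OF assms] coord_vec_components[OF assms])

lemma components_eq_0_iff:
  assumes "smooth_atlas A" "c \<in> A" "p \<in> cdom c"
  shows "components A c p v = 0 \<longleftrightarrow> v = 0" "coord_vec A c p v = 0 \<longleftrightarrow> v = 0"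
  using coord_vec_components[OF assms, of v] linear_0[OF linear_components(1)[OF assms]]
    linear_0[OF linear_components(2)[OF assms]] by metis+

lemma local_metric_chart:
  fixes A :: "('a::topological_space, 'e::euclidean_space) chart set"
  assumes M: "riemannian_manifold A g" and c: "c \<in> A"
  shows "local_metric (coord c ` cdom c) (metric_in_chart A g c)"
  unfolding local_metric_def
proof (intro conjI ballI allI)
  note A = riemannian_manifoldD(1)[OF M]
  show "open (coord c ` cdom c)" by (rule smooth_atlasD(2)[OF A c])
  show "smooth_on (coord c ` cdom c) (\<lambda>x. metric_in_chart A g c x u v)" for u v
    by (rule riemannian_manifoldD(3)[OF M c])
  fix x assume "x \<in> coord c ` cdom c"
  then obtain p where p: "p \<in> cdom c" "x = coord c p" by auto
  note g = riemannian_manifoldD(2)[OF M, of p]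
  note l = linear_components(2)[OF A c p(1)]
  have eq: "metric_in_chart A g c x = (\<lambda>u v. g p (coord_vec A c p u) (coord_vec A c p v))"
    unfolding p(2) by (intro ext) (rule metric_in_chart_coord[OF A c p(1)])
  show "inner_form (metric_in_chart A g c x)"
    unfolding eq inner_form_def bilinear_def
  proof (intro conjI allI impI)
    show "linear (\<lambda>v. g p (coord_vec A c p u) (coord_vec A c p v))" for u
      using linear_compose[OF l inner_formD(4)[OF g]] by (simp add: o_def)
    show "linear (\<lambda>u. g p (coord_vec A c p u) (coord_vec A c p v))" for v
      using linear_compose[OF l inner_formD(5)[OF g]] by (simp add: o_def)
    show "g p (coord_vec A c p u) (coord_vec A c p v) = g p (coord_vec A c p v) (coord_vec A c p u)" for u v
      by (rule inner_formD(2)[OF g])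
    show "g p (coord_vec A c p u) (coord_vec A c p u) > 0" if "u \<noteq> 0" for u
      by (rule inner_formD(3)[OF g]) (simp add: components_eq_0_iff[OF A c p(1)] that)
  qed
qed

lemma local_map_chart:
  assumes M: "riemannian_manifold A g" and N: "riemannian_manifold B h" and F: "smooth_map A B F"
    and c: "c \<in> A" and d: "d \<in> B"
  shows "local_map (rep_dom c d F) (metric_in_chart A g c) (coord d ` cdom d) (metric_in_chart B h d) (chart_rep c d F)"
  unfolding local_map_def
proof (intro conjI)
  note A = riemannian_manifoldD(1)[OF M] and B = riemannian_manifoldD(1)[OF N]
  note s = smooth_mapD[OF A B F c d]
  show "local_metric (rep_dom c d F) (metric_in_chart A g c)"
    by (rule local_metric_subset[OF local_metric_chart[OF M c] s(1)]) (auto simp: rep_dom_def)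
  show "local_metric (coord d ` cdom d) (metric_in_chart B h d)" by (rule local_metric_chart[OF N d])
  show "smooth_on (rep_dom c d F) (chart_rep c d F)" by (rule s(2))
  show "chart_rep c d F ` rep_dom c d F \<subseteq> coord d ` cdom d"
    by (auto simp: rep_dom_iff[OF A c] chart_rep_def)
qed

lemma local_map_restrict:
  assumes "local_map U G V H f" "open T" "T \<subseteq> U" "open W" "W \<subseteq> V" "f ` T \<subseteq> W"
  shows "local_map T G W H f"
  unfolding local_map_def
  by (intro conjI local_metric_subset[OF local_mapD(1)[OF assms(1)] assms(2,3)]
      local_metric_subset[OF local_mapD(2)[OF assms(1)] assms(4,5)]
      smooth_on_subset[OF local_mapD(5)[OF assms(1)] assms(3)] assms(6))

text \<open>The chart form of \<open>local_sff_compose\<close>. Representatives compose only where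
  the middle point lies in \<open>cdom d\<close>, hence the smaller open set \<open>T\<close>; on it
  the composite agrees with the representative of \<open>G \<circ> F\<close>, and
  \<open>local_sff\<close> is local.\<close>

lemma chart_sff_compose:
  assumes M: "riemannian_manifold A gA" and N: "riemannian_manifold B gB" and P: "riemannian_manifold C gC"
    and F: "smooth_map A B F" and G: "smooth_map B C G"
    and ch: "c \<in> A" "d \<in> B" "e \<in> C" and p: "p \<in> cdom c" "F p \<in> cdom d" "G (F p) \<in> cdom e"
  shows "local_sff (metric_in_chart A gA c) (metric_in_chart C gC e) (chart_rep c e (G \<circ> F)) (coord c p) u v =
    local_sff (metric_in_chart B gB d) (metric_in_chart C gC e) (chart_rep d e G) (coord d (F p))
      (tdiff c d F p u) (tdiff c d F p v) +
    tdiff d e G (F p)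
      (local_sff (metric_in_chart A gA c) (metric_in_chart B gB d) (chart_rep c d F) (coord c p) u v)"
proof -
  note A = riemannian_manifoldD(1)[OF M] and B = riemannian_manifoldD(1)[OF N] and C = riemannian_manifoldD(1)[OF P]
  define T where "T = coord c ` (cdom c \<inter> F -` (cdom d \<inter> G -` cdom e))"
  have T_iff: "y \<in> T \<longleftrightarrow> y \<in> coord c ` cdom c \<and> F (cinv c y) \<in> cdom d \<and> G (F (cinv c y)) \<in> cdom e" for y
    unfolding T_def coord_image_iff[OF A ch(1)] by simp
  have oT: "open T"
    unfolding T_def
    by (intro smooth_atlasD(7)[OF A ch(1)] smooth_mapD(3)[OF A B F ch(1,2)] open_Int
        smooth_atlasD(1)[OF B ch(2)] smooth_mapD(3)[OF B C G ch(2,3)] smooth_atlasD(1)[OF C ch(3)])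
  have xT: "coord c p \<in> T" using p by (auto simp: T_def)
  have f: "local_map T (metric_in_chart A gA c) (rep_dom d e G) (metric_in_chart B gB d) (chart_rep c d F)"
  proof (rule local_map_restrict[OF local_map_chart[OF M N F ch(1,2)] oT _ smooth_mapD(1)[OF B C G ch(2,3)]])
    show "T \<subseteq> rep_dom c d F" by (auto simp: T_iff rep_dom_iff[OF A ch(1)])
    show "rep_dom d e G \<subseteq> coord d ` cdom d" by (auto simp: rep_dom_def)
    show "chart_rep c d F ` T \<subseteq> rep_dom d e G" by (auto simp: T_iff rep_dom_def chart_rep_def)
  qed
  note h = local_map_chart[OF N P G ch(2,3)]
  have "local_sff (metric_in_chart A gA c) (metric_in_chart C gC e) (\<lambda>x. chart_rep d e G (chart_rep c d F x)) (coord c p) =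
    local_sff (metric_in_chart A gA c) (metric_in_chart C gC e) (chart_rep c e (G \<circ> F)) (coord c p)"
    by (rule local_sff_cong[OF local_map_compose[OF f h] xT]) (simp add: chart_rep_compose[OF B ch(2)] T_iff)
  then show ?thesis
    using local_sff_compose[OF f h xT, of u v] by (simp add: chart_rep_coord[OF A ch(1) p(1)] tdiff_def)
qed

lemma tdiff_eq_components:
  assumes A: "smooth_atlas A" and B: "smooth_atlas B" and F: "smooth_map A B F"
    and c: "c \<in> A" "p \<in> cdom c" and d: "d \<in> B" "F p \<in> cdom d"
  shows "tdiff c d F p k = components B d (F p) (differential A B F p (coord_vec A c p k))"
  by (simp add: components_differential[OF A B F c d] coord_vec_components[OF A c])

lemma local_isometry_chart:
  assumes M: "riemannian_manifold A g" and c: "c \<in> A" and d: "d \<in> A"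
  shows "local_isometry (rep_dom c d id) (metric_in_chart A g c) (coord d ` cdom d) (metric_in_chart A g d) (chart_rep c d id)"
  unfolding local_isometry_def
proof (intro conjI ballI)
  note A = riemannian_manifoldD(1)[OF M]
  show "local_map (rep_dom c d id) (metric_in_chart A g c) (coord d ` cdom d) (metric_in_chart A g d) (chart_rep c d id)"
    by (rule local_map_chart[OF M M smooth_map_id[OF A] c d])
  fix x assume "x \<in> rep_dom c d id"
  then obtain q where q: "q \<in> cdom c" "q \<in> cdom d" "x = coord c q" by (auto simp: rep_dom_def)
  have D: "FD (chart_rep c d id) x = tdiff c d id q" by (simp add: tdiff_def q(3))
  have cr: "chart_rep c d id (coord c q) = coord d q"
    by (simp add: chart_rep_coord[OF A c q(1)])
  show "surj (FD (chart_rep c d id) x)"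
    unfolding D
  proof (rule surjI)
    show "tdiff c d id q (tdiff d c id q v) = v" for v
      by (simp add: tdiff_id_compose[OF A d c d q(2,1,2)] tdiff_id[OF A d q(2)])
  qed
  show "\<forall>u v. metric_in_chart A g d (chart_rep c d id x) (FD (chart_rep c d id) x u) (FD (chart_rep c d id) x v) =
      metric_in_chart A g c x u v"
    unfolding D unfolding q(3) cr
      metric_in_chart_coord[OF A c q(1)] metric_in_chart_coord[OF A d q(2)] coord_vec_change[OF A c d q(1,2)] by simp
qed

lemma horizontal_iff:
  "u \<in> horizontal A g B F p \<longleftrightarrow> (\<forall>k. differential A B F p k = 0 \<longrightarrow> g p u k = 0)"
  by (auto simp: horizontal_def orth_def map_ker_def)

lemma local_hor_chart:
  assumes A: "smooth_atlas A" and B: "smooth_atlas B" and F: "smooth_map A B F"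
    and c: "c \<in> A" "p \<in> cdom c" and d: "d \<in> B" "F p \<in> cdom d"
  shows "u \<in> local_hor (metric_in_chart A g c) (chart_rep c d F) (coord c p) \<longleftrightarrow>
    coord_vec A c p u \<in> horizontal A g B F p"
proof -
  have "u \<in> local_hor (metric_in_chart A g c) (chart_rep c d F) (coord c p) \<longleftrightarrow>
      (\<forall>k. differential A B F p (coord_vec A c p k) = 0 \<longrightarrow> g p (coord_vec A c p u) (coord_vec A c p k) = 0)"
    unfolding local_hor_def tdiff_def[symmetric] tdiff_eq_components[OF A B F c d]
    by (simp add: components_eq_0_iff[OF B d] metric_in_chart_coord[OF A c])
  also have "\<dots> \<longleftrightarrow> (\<forall>k. differential A B F p k = 0 \<longrightarrow> g p (coord_vec A c p u) k = 0)"
    using coord_vec_components(1)[OF A c] by metis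
  finally show ?thesis by (simp add: horizontal_iff)
qed

lemma local_submersion_chart:
  assumes M: "riemannian_manifold A g" and N: "riemannian_manifold B h" and F: "riemannian_submersion A g B h F"
    and c: "c \<in> A" and d: "d \<in> B"
  shows "local_submersion (rep_dom c d F) (metric_in_chart A g c) (coord d ` cdom d) (metric_in_chart B h d) (chart_rep c d F)"
  unfolding local_submersion_def
proof (intro conjI ballI)
  note A = riemannian_manifoldD(1)[OF M] and B = riemannian_manifoldD(1)[OF N]
  have Fs: "smooth_map A B F" and rm: "riemannian_map A g B h F" using F
    by (auto simp: riemannian_submersion_def riemannian_map_def)
  show "local_map (rep_dom c d F) (metric_in_chart A g c) (coord d ` cdom d) (metric_in_chart B h d) (chart_rep c d F)"
    by (rule local_map_chart[OF M N Fs c d])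
  fix x assume "x \<in> rep_dom c d F"
  then obtain q where q: "q \<in> cdom c" "F q \<in> cdom d" and x: "x = coord c q" by (auto simp: rep_dom_def)
  have D: "FD (chart_rep c d F) x k = components B d (F q) (differential A B F q (coord_vec A c q k))" for k
    using tdiff_eq_components[OF A B Fs c q(1) d q(2)] by (simp add: tdiff_def x)
  have hor: "u \<in> local_hor (metric_in_chart A g c) (chart_rep c d F) x \<longleftrightarrow>
      coord_vec A c q u \<in> horizontal A g B F q" for u
    unfolding x by (rule local_hor_chart[OF A B Fs c q(1) d q(2)])
  show "FD (chart_rep c d F) x ` local_hor (metric_in_chart A g c) (chart_rep c d F) x = UNIV"
  proof (intro equalityI subset_UNIV subsetI)
    fix b
    have "differential A B F q ` horizontal A g B F q = UNIV"
      using F rm by (auto simp: riemannian_submersion_def riemannian_map_def map_range_def)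
    then have "coord_vec B d (F q) b \<in> differential A B F q ` horizontal A g B F q" by simp
    then obtain u where u: "u \<in> horizontal A g B F q" "coord_vec B d (F q) b = differential A B F q u" by auto
    have "FD (chart_rep c d F) x (components A c q u) = b"
      by (simp add: D coord_vec_components[OF A c q(1)] u(2)[symmetric] coord_vec_components[OF B d q(2)])
    moreover have "components A c q u \<in> local_hor (metric_in_chart A g c) (chart_rep c d F) x"
      by (simp add: hor coord_vec_components[OF A c q(1)] u(1))
    ultimately show "b \<in> FD (chart_rep c d F) x ` local_hor (metric_in_chart A g c) (chart_rep c d F) x"
      by (metis imageI)
  qed
  fix u v assume uv: "u \<in> local_hor (metric_in_chart A g c) (chart_rep c d F) x"
    "v \<in> local_hor (metric_in_chart A g c) (chart_rep c d F) x"
  have "h (F q) (differential A B F q (coord_vec A c q u)) (differential A B F q (coord_vec A c q v)) =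
      g q (coord_vec A c q u) (coord_vec A c q v)"
    using rm uv unfolding hor riemannian_map_def by blast
  then show "metric_in_chart B h d (chart_rep c d F x) (FD (chart_rep c d F) x u) (FD (chart_rep c d F) x v) =
      metric_in_chart A g c x u v"
    unfolding D
    by (simp add: x chart_rep_coord[OF A c q(1)] metric_in_chart_components[OF B d q(2)] metric_in_chart_coord[OF A c q(1)])
qed

lemma christoffel_eq_Chr: "christoffel A g c p = Chr (metric_in_chart A g c) (coord c p)"
  unfolding christoffel_def Chr_def is_Chr_def ..

text \<open>Tensoriality: the derivative of the components of \<open>Y\<close> enters once through
  the product rule and once through the connection of the source, and the two contributions cancel.
  Smoothness is asked on a neighbourhood \<open>U\<close>, since the frames in
  \<open>mean_curvature\<close> are local.\<close>

lemma second_ff_eq_local_sff: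
  assumes M: "riemannian_manifold A g" and N: "riemannian_manifold B h" and F: "smooth_map A B F"
    and U: "open U" "p \<in> U" and Y: "smooth_section A A id U Y"
  shows "second_ff A g B h F X Y p =
    local_sff (metric_in_chart A g (chart_at A p)) (metric_in_chart B h (chart_at B (F p)))
      (chart_rep (chart_at A p) (chart_at B (F p)) F) (coord (chart_at A p) p) (X p) (Y p)"
proof -
  note A = riemannian_manifoldD(1)[OF M] and B = riemannian_manifoldD(1)[OF N]
  define c where "c = chart_at A p"
  define d where "d = chart_at B (F p)"
  have c: "c \<in> A" "p \<in> cdom c" and d: "d \<in> B" "F p \<in> cdom d"
    unfolding c_def d_def by (rule chart_at[OF A] chart_at[OF B])+
  define f where "f = chart_rep c d F"
  define x where "x = coord c p"
  define y where "y z = components A c (cinv c z) (Y (cinv c z))" for z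
  define W where "W = coord c ` (cdom c \<inter> (U \<inter> F -` cdom d))"
  have cp: "cinv c x = p" unfolding x_def by (rule smooth_atlasD(3)[OF A c])
  have oW: "open W"
    unfolding W_def
    by (intro smooth_atlasD(7)[OF A c(1)] open_Int U(1) smooth_mapD(3)[OF A B F c(1) d(1)] smooth_atlasD(1)[OF B d(1)])
  have xW: "x \<in> W" using c d U by (auto simp: W_def x_def)
  have "smooth_on (coord c ` (cdom c \<inter> U \<inter> id -` cdom c)) y"
    using Y c(1) unfolding smooth_section_def y_def[abs_def] by simp
  then have "smooth_on W y" by (rule smooth_on_subset) (auto simp: W_def)
  then have y: "(y has_derivative FD y x) (at x)" by (rule smooth_on_has_derivative[OF _ oW xW])
  \<comment> \<open>In the preferred chart a tangent vector at \<open>p\<close> is its own component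
    vector.\<close>
  have yx: "y x = Y p" unfolding y_def cp unfolding c_def by (rule components_chart_at(1)[OF A])
  have f: "local_map W (metric_in_chart A g c) (coord d ` cdom d) (metric_in_chart B h d) f"
    unfolding f_def
    by (rule local_map_subset[OF local_map_chart[OF M N F c(1) d(1)] oW]) (auto simp: W_def rep_dom_def)
  have "((\<lambda>z. FD f z (y z)) has_derivative (\<lambda>w. FD (\<lambda>z. FD f z (y x)) x w + FD f x (FD y x w))) (at x)"
    by (rule has_derivative_linear_family[where L = "FD f" and L' = "\<lambda>v. FD (\<lambda>z. FD f z v) x",
          OF oW xW local_mapD(8)[OF f] local_mapD(9)[OF f xW] y])
  then have "((\<lambda>z. components B d (F (cinv c z)) (differential A B F (cinv c z) (Y (cinv c z)))) has_derivative
      (\<lambda>w. FD (\<lambda>z. FD f z (y x)) x w + FD f x (FD y x w))) (at x)"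
  proof (rule has_derivative_transform_within_open[OF _ oW xW])
    fix z assume "z \<in> W"
    then obtain q where q: "q \<in> cdom c" "F q \<in> cdom d" and z: "z = coord c q" by (auto simp: W_def)
    show "FD f z (y z) = components B d (F (cinv c z)) (differential A B F (cinv c z) (Y (cinv c z)))"
      unfolding z y_def smooth_atlasD(3)[OF A c(1) q(1)] components_differential[OF A B F c(1) q(1) d(1) q(2)]
      by (simp add: tdiff_def f_def)
  qed
  from FD_eq[OF this]
  have 1: "FD (\<lambda>z. components B d (F (cinv c z)) (differential A B F (cinv c z) (Y (cinv c z)))) x w =
      FD (\<lambda>z. FD f z (Y p)) x w + FD f x (FD y x w)" for w
    unfolding yx by simp
  have 2: "differential A B F p = FD f x"
    unfolding differential_tdiff tdiff_def f_def x_def c_def d_def ..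
  have 3: "coord d (F p) = f x" unfolding f_def x_def chart_rep_coord[OF A c] ..
  have 4: "cov_deriv A A g id p w Y = FD y x w + Chr (metric_in_chart A g c) x w (Y p)" for w
    unfolding cov_deriv_def Let_def id_apply christoffel_eq_Chr differential_id[OF A]
    by (simp add: y_def[abs_def] x_def c_def)
  have 5: "cov_deriv A B h F p w (\<lambda>q. differential A B F q (Y q)) =
      FD (\<lambda>z. FD f z (Y p)) x w + FD f x (FD y x w) + Chr (metric_in_chart B h d) (f x) (FD f x w) (FD f x (Y p))" for w
    unfolding cov_deriv_def Let_def christoffel_eq_Chr c_def[symmetric] d_def[symmetric] x_def[symmetric] 1 2 3 ..
  show ?thesis
    unfolding second_ff_def 4 5 unfolding 2 c_def[symmetric] d_def[symmetric] f_def[symmetric] x_def[symmetric] local_sff_def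
    by (simp add: linear_add[OF local_mapD(8)[OF f xW]])
qed

section \<open>Mean curvature of a composite\<close>

text \<open>Once some frame exists, the one chosen by \<open>SOME\<close> has the required
  properties. As the second fundamental form is tensorial, only the values at \<open>p\<close> of
  the chosen fields are kept.\<close>

lemma mean_curvature_frame:
  fixes A :: "('a::topological_space, 'e::euclidean_space) chart set"
    and B :: "('b::topological_space, 'f::euclidean_space) chart set"
  assumes M: "riemannian_manifold A g" and N: "riemannian_manifold B h" and F: "smooth_map A B F"
    and ex: "\<exists>e U. open U \<and> p \<in> U \<and> horizontal_frame A g B F (map_rank A B F p) U e"
  obtains e :: "nat \<Rightarrow> 'e" where "span (e ` {..<map_rank A B F p}) = horizontal A g B F p"
    "\<forall>i<map_rank A B F p. \<forall>j<map_rank A B F p. g p (e i) (e j) = (if i = j then 1 else 0)"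
    "mean_curvature A g B h F p = (1 / real (map_rank A B F p)) *\<^sub>R (\<Sum>i<map_rank A B F p.
      local_sff (metric_in_chart A g (chart_at A p)) (metric_in_chart B h (chart_at B (F p)))
      (chart_rep (chart_at A p) (chart_at B (F p)) F) (coord (chart_at A p) p) (e i) (e i))"
proof -
  define r where "r = map_rank A B F p"
  define E where "E = (SOME e. \<exists>U. open U \<and> p \<in> U \<and> horizontal_frame A g B F r U e)"
  have "\<exists>U. open U \<and> p \<in> U \<and> horizontal_frame A g B F r U E"
    using someI_ex[OF ex] unfolding E_def r_def .
  then obtain U where U: "open U" "p \<in> U" and E: "horizontal_frame A g B F r U E" by blast
  have 1: "span ((\<lambda>i. E i p) ` {..<r}) = horizontal A g B F p"
    and 2: "\<forall>i<r. \<forall>j<r. g p (E i p) (E j p) = (if i = j then 1 else 0)"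
    and s: "\<And>i. i < r \<Longrightarrow> smooth_section A A id U (E i)"
    using E U(2) unfolding horizontal_frame_def by blast+
  have "mean_curvature A g B h F p = (1 / real r) *\<^sub>R (\<Sum>i<r. second_ff A g B h F (E i) (E i) p)"
    unfolding mean_curvature_def Let_def r_def[symmetric] E_def[symmetric] ..
  also have "(\<Sum>i<r. second_ff A g B h F (E i) (E i) p) =
      (\<Sum>i<r. local_sff (metric_in_chart A g (chart_at A p)) (metric_in_chart B h (chart_at B (F p)))
      (chart_rep (chart_at A p) (chart_at B (F p)) F) (coord (chart_at A p) p) (E i p) (E i p))"
    by (intro sum.cong refl second_ff_eq_local_sff[OF M N F U s]) simp
  finally have 3: "mean_curvature A g B h F p = (1 / real r) *\<^sub>R (\<Sum>i<r.
      local_sff (metric_in_chart A g (chart_at A p)) (metric_in_chart B h (chart_at B (F p)))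
      (chart_rep (chart_at A p) (chart_at B (F p)) F) (coord (chart_at A p) p) (E i p) (E i p))" .
  show thesis by (rule that[of "\<lambda>i. E i p"]) (use 1 2 3 in \<open>simp_all add: r_def\<close>)
qed

lemma subspace_horizontal:
  assumes "riemannian_manifold A g"
  shows "subspace (horizontal A g B F p)"
proof -
  note l = inner_formD(5)[OF riemannian_manifoldD(2)[OF assms]]
  show ?thesis
    unfolding subspace_def
    by (auto simp: horizontal_iff linear_0[OF l] linear_add[OF l] linear_cmul[OF l])
qed

text \<open>The frame is the horizontal lift of a smooth orthonormal frame of the target of
  \<open>F\<close>. The frame condition involves \<open>F'\<close> through its horizontal spaces
  alone, so the frame also serves \<open>F\<close> followed by an immersion.\<close>

lemma horizontal_frame_exists:
  fixes A :: "('a::topological_space, 'e::euclidean_space) chart set"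
    and B :: "('b::topological_space, 'f::euclidean_space) chart set"
  assumes M: "riemannian_manifold A g" and N: "riemannian_manifold B h"
    and F: "riemannian_submersion A g B h F"
    and hor: "\<And>q. horizontal A g C F' q = horizontal A g B F q"
  shows "\<exists>e U. open U \<and> p \<in> U \<and> horizontal_frame A g C F' DIM('f) U e"
proof -
  note A = riemannian_manifoldD(1)[OF M] and B = riemannian_manifoldD(1)[OF N]
  have Fs: "smooth_map A B F" using F by (simp add: riemannian_submersion_def riemannian_map_def)
  define c where "c = chart_at A p"
  define d where "d = chart_at B (F p)"
  have c: "c \<in> A" "p \<in> cdom c" and d: "d \<in> B" "F p \<in> cdom d"
    unfolding c_def d_def by (rule chart_at[OF A] chart_at[OF B])+
  define f where "f = chart_rep c d F"
  define G where "G = metric_in_chart A g c"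
  define H where "H = metric_in_chart B h d"
  define R where "R = rep_dom c d F"
  have S: "local_submersion R G (coord d ` cdom d) H f"
    unfolding R_def G_def H_def f_def by (rule local_submersion_chart[OF M N F c(1) d(1)])
  have m: "local_map R G (coord d ` cdom d) H f" using S by (simp add: local_submersion_def)
  note mG = local_metricD(2)[OF local_mapD(1)[OF m]] and mH = local_metricD(2)[OF local_mapD(2)[OF m] local_mapD(6)[OF m]]
  obtain \<epsilon> where \<epsilon>: "\<forall>i<DIM('f). smooth_on (coord d ` cdom d) (\<epsilon> i)"
    "\<forall>y\<in>coord d ` cdom d. orthonormal_frame (H y) DIM('f) (\<lambda>i. \<epsilon> i y)"
    by (rule local_orthonormal_frame[OF local_mapD(2)[OF m]])
  obtain X where X: "\<forall>Y. smooth_on R Y \<longrightarrow> smooth_on R (\<lambda>x. X (Y x) x)"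
    "\<forall>x\<in>R. \<forall>a u. G x (X a x) u = H (f x) a (FD f x u)"
    by (rule horizontal_lift[OF S])
  \<comment> \<open>The vectors to be lifted vary with the point, which is why
    \<open>horizontal_lift\<close> covers all smooth \<open>Y\<close> and not merely
    constants.\<close>
  define y where "y i x = X (\<epsilon> i (f x)) x" for i x
  define E where "E i q = coord_vec A c q (y i (coord c q))" for i q
  define U where "U = cdom c \<inter> F -` cdom d"
  have oU: "open U" unfolding U_def
    by (intro open_Int smooth_atlasD(1)[OF A c(1)] smooth_mapD(3)[OF A B Fs c(1) d(1)] smooth_atlasD(1)[OF B d(1)])
  have pU: "p \<in> U" using c d by (simp add: U_def)
  have UR: "coord c ` U = R" by (simp add: U_def R_def rep_dom_def)
  have "smooth_section A A id U (E i)" if i: "i < DIM('f)" for i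
  proof (rule smooth_section_localI[OF A])
    fix q assume q: "q \<in> U"
    have "smooth_on R (\<lambda>x. \<epsilon> i (f x))"
      by (rule smooth_on_compose[where g = "\<epsilon> i", OF local_mapD(3,4)[OF m] _ local_mapD(5)[OF m] \<epsilon>(1)[rule_format, OF i]])
         (use m in \<open>simp add: local_map_def\<close>)
    then have "smooth_on (coord c ` U) (y i)"
      unfolding UR y_def[abs_def] using X(1) by blast
    then show "\<exists>W c y. open W \<and> q \<in> W \<and> c \<in> A \<and> W \<subseteq> cdom c \<and> smooth_on (coord c ` W) y \<and>
      (\<forall>q\<in>W. E i q = coord_vec A c q (y (coord c q)))"
      using oU q c(1) by (intro exI[of _ U] exI[of _ c] exI[of _ "y i"]) (simp add: U_def E_def)
  qed
  moreover have "span ((\<lambda>i. E i q) ` {..<DIM('f)}) = horizontal A g B F q \<and>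
      (\<forall>i<DIM('f). \<forall>j<DIM('f). g q (E i q) (E j q) = (if i = j then 1 else 0))" if q: "q \<in> U" for q
  proof -
    define x where "x = coord c q"
    have xR: "x \<in> R" using q UR by (auto simp: x_def)
    have qc: "q \<in> cdom c" "F q \<in> cdom d" using q by (auto simp: U_def)
    have lift: "G x (y i x) u = H (f x) (\<epsilon> i (f x)) (FD f x u)" for i u
      unfolding y_def using X(2) xR by blast
    have y_hor: "y i x \<in> local_hor G f x" and Dy: "FD f x (y i x) = \<epsilon> i (f x)" for i
      by (rule horizontal_liftD[OF S xR lift])+
    have frame: "orthonormal_frame (H (f x)) DIM('f) (\<lambda>i. \<epsilon> i (f x))"
      using \<epsilon>(2) local_mapD(6)[OF m xR] by blast
    have hor_iff: "u \<in> local_hor G f x \<longleftrightarrow> coord_vec A c q u \<in> horizontal A g B F q" for u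
      unfolding G_def f_def x_def by (rule local_hor_chart[OF A B Fs c(1) qc(1) d(1) qc(2)])
    have E: "E i q = coord_vec A c q (y i x)" for i by (simp add: E_def x_def)
    have "g q (E i q) (E j q) = (if i = j then 1 else 0)" if "i < DIM('f)" "j < DIM('f)" for i j
    proof -
      have "g q (E i q) (E j q) = G x (y i x) (y j x)"
        unfolding E G_def x_def metric_in_chart_coord[OF A c(1) qc(1)] ..
      also have "\<dots> = (if i = j then 1 else 0)"
        unfolding lift Dy using frame that by (simp add: orthonormal_frame_def)
      finally show ?thesis .
    qed
    moreover have "span ((\<lambda>i. E i q) ` {..<DIM('f)}) = horizontal A g B F q"
    proof
      show "span ((\<lambda>i. E i q) ` {..<DIM('f)}) \<subseteq> horizontal A g B F q"
        by (rule span_minimal[OF _ subspace_horizontal[OF M]]) (use y_hor hor_iff E in auto)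
      show "horizontal A g B F q \<subseteq> span ((\<lambda>i. E i q) ` {..<DIM('f)})"
      proof
        fix u assume u: "u \<in> horizontal A g B F q"
        define u' where "u' = components A c q u"
        \<comment> \<open>A horizontal \<open>u'\<close> is the lift of its image, so the expansion
          of the image in \<open>\<epsilon>\<close> lifts to an expansion of \<open>u'\<close> with
          the same coefficients.\<close>
        define s where "s i = H (f x) (FD f x u') (\<epsilon> i (f x))" for i
        have u': "u = coord_vec A c q u'" by (simp add: u'_def coord_vec_components[OF A c(1) qc(1)])
        have hor: "u' \<in> local_hor G f x" using u u' hor_iff by simp
        have "u' = (\<Sum>i<DIM('f). s i *\<^sub>R y i x)"
        proof (rule inner_form_eqI[OF mG[OF xR]])
          fix k
          note lG = inner_formD(5)[OF mG[OF xR]] and lH = inner_formD(5)[OF mH[OF xR]]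
          have "G x u' k = H (f x) (FD f x u') (FD f x k)"
            using local_submersion_hor[OF S xR hor, of k] inner_formD(2)[OF mG[OF xR], of k u']
              inner_formD(2)[OF mH[OF xR], of "FD f x k" "FD f x u'"] by simp
          also have "\<dots> = H (f x) (\<Sum>i<DIM('f). s i *\<^sub>R \<epsilon> i (f x)) (FD f x k)"
            unfolding s_def orthonormal_expand[OF mH[OF xR] frame, symmetric] ..
          also have "\<dots> = G x (\<Sum>i<DIM('f). s i *\<^sub>R y i x) k"
            by (simp add: linear_sum[OF lG] linear_sum[OF lH] linear_cmul[OF lG] linear_cmul[OF lH] lift)
          finally show "G x u' k = G x (\<Sum>i<DIM('f). s i *\<^sub>R y i x) k" .
        qed
        then have "u = (\<Sum>i<DIM('f). s i *\<^sub>R E i q)"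
          unfolding u' E by (simp add: linear_sum[OF linear_components(2)[OF A c(1) qc(1)]]
            linear_cmul[OF linear_components(2)[OF A c(1) qc(1)]])
        also have "\<dots> \<in> span ((\<lambda>i. E i q) ` {..<DIM('f)})"
          by (intro span_sum span_scale span_base) auto
        finally show "u \<in> span ((\<lambda>i. E i q) ` {..<DIM('f)})" .
      qed
    qed
    ultimately show ?thesis by blast
  qed
  ultimately have "horizontal_frame A g C F' DIM('f) U E"
    unfolding horizontal_frame_def hor by blast
  then show ?thesis using oU pU by blast
qed

section \<open>A submersion followed by an isometric immersion\<close>

lemma differential_zero_iff:
  assumes "isometric_immersion A g B h F"
  shows "differential A B F p v = 0 \<longleftrightarrow> v = 0"
  using assms by (auto simp: isometric_immersion_def map_ker_def)

lemma riemannian_submersion_smooth: "riemannian_submersion A g B h F \<Longrightarrow> smooth_map A B F"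
  by (simp add: riemannian_submersion_def riemannian_map_def)

lemma isometric_immersion_smooth: "isometric_immersion A g B h F \<Longrightarrow> smooth_map A B F"
  by (simp add: isometric_immersion_def riemannian_map_def)

context
  fixes A1 :: "('a::topological_space, 'e::euclidean_space) chart set"
    and A2 :: "('b::topological_space, 'f::euclidean_space) chart set"
    and A3 :: "('c::topological_space, 'k::euclidean_space) chart set"
    and g1 g2 g3 F1 F2
  assumes M1: "riemannian_manifold A1 g1" and M2: "riemannian_manifold A2 g2" and M3: "riemannian_manifold A3 g3"
    and F1: "riemannian_submersion A1 g1 A2 g2 F1" and F2: "isometric_immersion A2 g2 A3 g3 F2"
begin

lemma differential_composite:
  "differential A1 A3 (F2 \<circ> F1) p v = differential A2 A3 F2 (F1 p) (differential A1 A2 F1 p v)"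
  by (rule differential_compose[OF riemannian_manifoldD(1)[OF M1] riemannian_manifoldD(1)[OF M2]
        riemannian_manifoldD(1)[OF M3] riemannian_submersion_smooth[OF F1] isometric_immersion_smooth[OF F2]])

lemma smooth_map_composite: "smooth_map A1 A3 (F2 \<circ> F1)"
  by (rule smooth_map_compose[OF riemannian_manifoldD(1)[OF M1] riemannian_manifoldD(1)[OF M2]
        riemannian_manifoldD(1)[OF M3] riemannian_submersion_smooth[OF F1] isometric_immersion_smooth[OF F2]])

lemma horizontal_composite: "horizontal A1 g1 A3 (F2 \<circ> F1) p = horizontal A1 g1 A2 F1 p"
  unfolding horizontal_def map_ker_def differential_composite differential_zero_iff[OF F2] ..

lemma map_range_composite: "map_range A1 A3 (F2 \<circ> F1) p = map_range A2 A3 F2 (F1 p)"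
proof -
  have "surj (differential A1 A2 F1 p)" using F1 by (simp add: riemannian_submersion_def)
  then have "range (\<lambda>v. differential A2 A3 F2 (F1 p) (differential A1 A2 F1 p v)) = range (differential A2 A3 F2 (F1 p))"
    by (metis image_image)
  then show ?thesis by (simp add: map_range_def differential_composite[abs_def])
qed

lemma map_rank_composite: "map_rank A1 A3 (F2 \<circ> F1) p = DIM('f)"
proof -
  have l: "linear (differential A2 A3 F2 (F1 p))"
    by (rule linear_differential[OF riemannian_manifoldD(1)[OF M2] riemannian_manifoldD(1)[OF M3] isometric_immersion_smooth[OF F2]])
  have "inj (differential A2 A3 F2 (F1 p))"
    unfolding linear_injective_0[OF l] differential_zero_iff[OF F2] by simp
  then have "dim (differential A2 A3 F2 (F1 p) ` UNIV) = dim (UNIV :: 'f set)"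
    by (intro dim_image_eq[OF l]) (auto intro: inj_on_subset)
  then show ?thesis unfolding map_rank_def map_range_composite unfolding map_range_def by simp
qed

lemma riemannian_map_composite: "riemannian_map A1 g1 A3 g3 (F2 \<circ> F1)"
  unfolding riemannian_map_def
proof (intro conjI allI ballI smooth_map_composite)
  fix p
  have r1: "riemannian_map A1 g1 A2 g2 F1" and s: "surj (differential A1 A2 F1 p)"
    using F1 by (simp_all add: riemannian_submersion_def)
  have r2: "riemannian_map A2 g2 A3 g3 F2" using F2 by (simp add: isometric_immersion_def)
  show "map_rank A1 A3 (F2 \<circ> F1) p > 0" unfolding map_rank_composite by simp
  have "differential A1 A2 F1 p ` horizontal A1 g1 A2 F1 p = UNIV"
    using r1 s by (simp add: riemannian_map_def map_range_def)
  then have "differential A2 A3 F2 (F1 p) ` differential A1 A2 F1 p ` horizontal A1 g1 A2 F1 p = map_range A2 A3 F2 (F1 p)"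
    by (simp add: map_range_def)
  then show "differential A1 A3 (F2 \<circ> F1) p ` horizontal A1 g1 A3 (F2 \<circ> F1) p = map_range A1 A3 (F2 \<circ> F1) p"
    unfolding horizontal_composite map_range_composite differential_composite[abs_def] image_image .
  fix u v assume "u \<in> horizontal A1 g1 A3 (F2 \<circ> F1) p" "v \<in> horizontal A1 g1 A3 (F2 \<circ> F1) p"
  then have 1: "g2 (F1 p) (differential A1 A2 F1 p u) (differential A1 A2 F1 p v) = g1 p u v"
    unfolding horizontal_composite using r1 by (simp add: riemannian_map_def)
  have "horizontal A2 g2 A3 F2 (F1 p) = UNIV"
    using linear_0[OF inner_formD(4)[OF riemannian_manifoldD(2)[OF M2]]]
    by (auto simp: horizontal_iff differential_zero_iff[OF F2])
  then have "g3 (F2 (F1 p)) (differential A2 A3 F2 (F1 p) u') (differential A2 A3 F2 (F1 p) v') = g2 (F1 p) u' v'" for u' v'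
    using r2 by (simp add: riemannian_map_def)
  with 1 show "g3 ((F2 \<circ> F1) p) (differential A1 A3 (F2 \<circ> F1) p u) (differential A1 A3 (F2 \<circ> F1) p v) = g1 p u v"
    unfolding differential_composite by simp
qed

text \<open>The charts and the frame \<open>\<epsilon>\<close> are left free so that charts can stay
  fixed and frames vary smoothly while \<open>p\<close> moves. The submersion part of the
  composition formula vanishes on the horizontal frame, the image frame is exchanged for
  \<open>\<epsilon>\<close> because both give the same trace, and the value is carried from the
  preferred target chart to \<open>d\<close>.\<close>

lemma mean_curvature_composite:
  assumes c: "c \<in> A2" "F1 p \<in> cdom c" and d: "d \<in> A3" "F2 (F1 p) \<in> cdom d"
    and \<epsilon>: "orthonormal_frame (metric_in_chart A2 g2 c (coord c (F1 p))) n \<epsilon>"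
  shows "components A3 d (F2 (F1 p)) (mean_curvature A1 g1 A3 g3 (F2 \<circ> F1) p) =
    (1 / real DIM('f)) *\<^sub>R (\<Sum>i<n. local_sff (metric_in_chart A2 g2 c) (metric_in_chart A3 g3 d)
      (chart_rep c d F2) (coord c (F1 p)) (\<epsilon> i) (\<epsilon> i))"
proof -
  note s1 = riemannian_submersion_smooth[OF F1] and s2 = isometric_immersion_smooth[OF F2]
  note a1 = riemannian_manifoldD(1)[OF M1] and a2 = riemannian_manifoldD(1)[OF M2] and a3 = riemannian_manifoldD(1)[OF M3]
  define b where "b = chart_at A1 p"
  \<comment> \<open>\<open>mean_curvature\<close> takes its values in the components of this chart;
    \<open>d\<close> is reached only at the end.\<close>
  define d0 where "d0 = chart_at A3 ((F2 \<circ> F1) p)"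
  have b: "b \<in> A1" "p \<in> cdom b" and d0: "d0 \<in> A3" "F2 (F1 p) \<in> cdom d0"
    unfolding b_def d0_def using chart_at[OF a1, of p] chart_at[OF a3, of "F2 (F1 p)"] by simp_all
  define x where "x = coord b p"
  define f where "f = chart_rep b c F1"
  define G where "G = metric_in_chart A1 g1 b"
  define H where "H = metric_in_chart A2 g2 c"
  define S where "S = local_sff H (metric_in_chart A3 g3 d0) (chart_rep c d0 F2) (coord c (F1 p))"
  have sub: "local_submersion (rep_dom b c F1) G (coord c ` cdom c) H f"
    unfolding G_def H_def f_def by (rule local_submersion_chart[OF M1 M2 F1 b(1) c(1)])
  have m: "local_map (rep_dom b c F1) G (coord c ` cdom c) H f" using sub by (simp add: local_submersion_def)
  have xd: "x \<in> rep_dom b c F1" unfolding x_def by (rule coord_in_rep_dom[where F = F1, OF b(2) c(2)])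
  have fx: "f x = coord c (F1 p)" unfolding f_def x_def by (rule chart_rep_coord[OF a1 b])
  have hor: "local_hor G f x = horizontal A1 g1 A2 F1 p"
    using local_hor_chart[OF a1 a2 s1 b c, of _ g1] components_chart_at(2)[OF a1, of p]
    unfolding G_def f_def x_def b_def by auto
  have Gx: "G x u v = g1 p u v" for u v
    unfolding G_def x_def metric_in_chart_coord[OF a1 b] unfolding b_def components_chart_at(2)[OF a1] ..
  have ex: "\<exists>e U. open U \<and> p \<in> U \<and> horizontal_frame A1 g1 A3 (F2 \<circ> F1) (map_rank A1 A3 (F2 \<circ> F1) p) U e"
    unfolding map_rank_composite by (rule horizontal_frame_exists[OF M1 M2 F1 horizontal_composite])
  obtain e where e: "span (e ` {..<DIM('f)}) = horizontal A1 g1 A2 F1 p"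
    "\<forall>i<DIM('f). \<forall>j<DIM('f). g1 p (e i) (e j) = (if i = j then 1 else 0)"
    and mc: "mean_curvature A1 g1 A3 g3 (F2 \<circ> F1) p = (1 / real DIM('f)) *\<^sub>R (\<Sum>i<DIM('f).
      local_sff G (metric_in_chart A3 g3 d0) (chart_rep b d0 (F2 \<circ> F1)) x (e i) (e i))"
    by (rule mean_curvature_frame[OF M1 M3 smooth_map_composite ex, unfolded map_rank_composite horizontal_composite,
          folded b_def d0_def, folded G_def x_def])
  have e_hor: "e i \<in> local_hor G f x" if "i < DIM('f)" for i
    unfolding hor e(1)[symmetric] using that by (intro span_base) auto
  define a where "a i = FD f x (e i)" for i
  have "local_sff G (metric_in_chart A3 g3 d0) (chart_rep b d0 (F2 \<circ> F1)) x (e i) (e i) = S (a i) (a i)"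
    if i: "i < DIM('f)" for i
  proof -
    have z: "local_sff G H f x (e i) (e i) = 0"
      by (rule local_submersion_sff[OF sub xd e_hor[OF i] e_hor[OF i]])
    show ?thesis
      using chart_sff_compose[OF M1 M2 M3 s1 s2 b(1) c(1) d0(1) b(2) c(2) d0(2), of "e i" "e i"] z
        linear_0[OF tdiff_linear[OF a2 a3 s2 c(1) d0(1) c(2) d0(2)]]
      by (simp add: S_def a_def G_def H_def f_def x_def tdiff_def)
  qed
  then have mc2: "mean_curvature A1 g1 A3 g3 (F2 \<circ> F1) p = (1 / real DIM('f)) *\<^sub>R (\<Sum>i<DIM('f). S (a i) (a i))"
    unfolding mc by simp
  \<comment> \<open>The derivative of \<open>F1\<close> is an isometry of the horizontal space onto
    the tangent space below, so it carries the chosen frame to an orthonormal frame.\<close>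
  have a: "orthonormal_frame (H (coord c (F1 p))) DIM('f) a"
    unfolding orthonormal_frame_def
  proof (intro conjI allI impI)
    have "span (a ` {..<DIM('f)}) = FD f x ` span (e ` {..<DIM('f)})"
      unfolding a_def[abs_def] by (simp add: linear_span_image[OF local_mapD(8)[OF m xd], symmetric] image_image)
    also have "\<dots> = UNIV" unfolding e(1) hor[symmetric] using sub xd by (simp add: local_submersion_def)
    finally show "span (a ` {..<DIM('f)}) = UNIV" .
    fix i j assume ij: "i < DIM('f)" "j < DIM('f)"
    have "H (f x) (a i) (a j) = G x (e i) (e j)"
      unfolding a_def by (rule local_submersion_hor[OF sub xd e_hor[OF ij(2)]])
    then show "H (coord c (F1 p)) (a i) (a j) = (if i = j then 1 else 0)"
      using e(2) ij by (simp add: fx Gx)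
  qed
  have m2: "local_map (rep_dom c d0 F2) H (coord d0 ` cdom d0) (metric_in_chart A3 g3 d0) (chart_rep c d0 F2)"
    unfolding H_def by (rule local_map_chart[OF M2 M3 s2 c(1) d0(1)])
  have yd: "coord c (F1 p) \<in> rep_dom c d0 F2" by (rule coord_in_rep_dom[where F = F2, OF c(2) d0(2)])
  have "(\<Sum>i<DIM('f). S (a i) (a i)) = (\<Sum>i<n. S (\<epsilon> i) (\<epsilon> i))"
    unfolding S_def
    by (rule trace_frame_independent[OF local_metricD(2)[OF local_mapD(1)[OF m2] yd] a \<epsilon>[folded H_def] local_sff_bilinear[OF m2 yd]])
  then have mc3: "mean_curvature A1 g1 A3 g3 (F2 \<circ> F1) p = (1 / real DIM('f)) *\<^sub>R (\<Sum>i<n. S (\<epsilon> i) (\<epsilon> i))"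
    unfolding mc2 by simp
  have comp: "components A3 d (F2 (F1 p)) = tdiff d0 d id (F2 (F1 p))"
    by (simp add: components_tdiff d0_def)
  note l = linear_components(1)[OF a3 d]
  \<comment> \<open>\<open>id\<close> from \<open>d0\<close> to \<open>d\<close> has vanishing
    second fundamental form, so the composition formula for \<open>id \<circ> F2\<close> says that
    \<open>S\<close> transforms like a vector.\<close>
  have change: "components A3 d (F2 (F1 p)) (S u v) =
      local_sff H (metric_in_chart A3 g3 d) (chart_rep c d F2) (coord c (F1 p)) u v" for u v
  proof -
    have "local_sff (metric_in_chart A3 g3 d0) (metric_in_chart A3 g3 d) (chart_rep d0 d id) (coord d0 (F2 (F1 p))) u v = 0" for u v
      by (rule local_isometry_sff[OF local_isometry_chart[OF M3 d0(1) d(1)] coord_in_rep_dom[where F = id]])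
         (use d d0 in simp_all)
    then show ?thesis
      using chart_sff_compose[OF M2 M3 M3 s2 smooth_map_id[OF a3] c(1) d0(1) d(1) c(2) d0(2), of u v] d(2)
      by (simp add: comp S_def H_def)
  qed
  show ?thesis
    unfolding mc3 linear_cmul[OF l] linear_sum[OF l] change H_def ..
qed

end

section \<open>Pseudo-umbilical composites\<close>

text \<open>Taking \<open>F1 = id\<close> turns results on composites into results on
  \<open>F2\<close> alone.\<close>

lemma riemannian_submersion_id:
  fixes A :: "('a::topological_space, 'e::euclidean_space) chart set"
  assumes M: "riemannian_manifold A g"
  shows "riemannian_submersion A g A g id"
proof -
  note A = riemannian_manifoldD(1)[OF M]
  have D: "differential A A id p = (\<lambda>v. v)" for p
    by (intro ext) (rule differential_id[OF A])
  have hor: "horizontal A g A id p = UNIV" for p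
    using linear_0[OF inner_formD(4)[OF riemannian_manifoldD(2)[OF M]]] by (auto simp: horizontal_iff D)
  show ?thesis
    unfolding riemannian_submersion_def riemannian_map_def map_rank_def map_range_def hor
    by (simp add: smooth_map_id[OF A] D)
qed

lemma mean_curvature_immersion:
  fixes A :: "('a::topological_space, 'e::euclidean_space) chart set"
  assumes M: "riemannian_manifold A g" and N: "riemannian_manifold B h" and F: "isometric_immersion A g B h F"
    and c: "c \<in> A" "q \<in> cdom c" and d: "d \<in> B" "F q \<in> cdom d"
    and \<epsilon>: "orthonormal_frame (metric_in_chart A g c (coord c q)) n \<epsilon>"
  shows "components B d (F q) (mean_curvature A g B h F q) =
    (1 / real DIM('e)) *\<^sub>R (\<Sum>i<n. local_sff (metric_in_chart A g c) (metric_in_chart B h d)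
      (chart_rep c d F) (coord c q) (\<epsilon> i) (\<epsilon> i))"
proof -
  have "F \<circ> id = F" by simp
  then show ?thesis
    using mean_curvature_composite[OF M M N riemannian_submersion_id[OF M] F c(1) _ d(1), of q n \<epsilon>] c(2) d(2) \<epsilon>
    by simp
qed

text \<open>Since the trace formula admits any orthonormal frame at each point, a frame that is
  smooth on the whole chart can be inserted in place of the unrelated frames selected by
  \<open>mean_curvature\<close>. This leaves a smooth expression in fixed charts.\<close>

lemma smooth_on_mean_curvature:
  fixes A :: "('a::topological_space, 'e::euclidean_space) chart set"
  assumes M: "riemannian_manifold A g" and N: "riemannian_manifold B h" and F: "isometric_immersion A g B h F"
    and c: "c \<in> A" and d: "d \<in> B"
  shows "smooth_on (rep_dom c d F) (\<lambda>x. components B d (F (cinv c x)) (mean_curvature A g B h F (cinv c x)))"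
proof -
  note A = riemannian_manifoldD(1)[OF M]
  note m = local_map_chart[OF M N isometric_immersion_smooth[OF F] c d]
  obtain \<epsilon> where \<epsilon>: "\<forall>i<DIM('e). smooth_on (coord c ` cdom c) (\<epsilon> i)"
    "\<forall>x\<in>coord c ` cdom c. orthonormal_frame (metric_in_chart A g c x) DIM('e) (\<lambda>i. \<epsilon> i x)"
    by (rule local_orthonormal_frame[OF local_metric_chart[OF M c]])
  have "smooth_on (rep_dom c d F) (\<lambda>x. (1 / real DIM('e)) *\<^sub>R (\<Sum>i<DIM('e).
      local_sff (metric_in_chart A g c) (metric_in_chart B h d) (chart_rep c d F) x (\<epsilon> i x) (\<epsilon> i x)))"
  proof (intro smooth_on_scaleR smooth_on_const smooth_on_sum local_mapD(3)[OF m])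
    fix i assume "i \<in> {..<DIM('e)}"
    then have "smooth_on (coord c ` cdom c) (\<epsilon> i)" using \<epsilon>(1) by simp
    then have "smooth_on (rep_dom c d F) (\<epsilon> i)"
      by (rule smooth_on_subset) (auto simp: rep_dom_def)
    then show "smooth_on (rep_dom c d F) (\<lambda>x. local_sff (metric_in_chart A g c) (metric_in_chart B h d) (chart_rep c d F) x (\<epsilon> i x) (\<epsilon> i x))"
      by (intro smooth_on_local_sff[OF m])
  qed
  then show ?thesis
  proof (rule smooth_on_cong[OF local_mapD(3)[OF m]])
    fix x assume "x \<in> rep_dom c d F"
    then obtain q where q: "q \<in> cdom c" "F q \<in> cdom d" and x: "x = coord c q" by (auto simp: rep_dom_def)
    have "orthonormal_frame (metric_in_chart A g c (coord c q)) DIM('e) (\<lambda>i. \<epsilon> i x)"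
      using \<epsilon>(2) q(1) unfolding x by blast
    from mean_curvature_immersion[OF M N F c q(1) d q(2) this]
    show "(1 / real DIM('e)) *\<^sub>R (\<Sum>i<DIM('e).
      local_sff (metric_in_chart A g c) (metric_in_chart B h d) (chart_rep c d F) x (\<epsilon> i x) (\<epsilon> i x)) =
      components B d (F (cinv c x)) (mean_curvature A g B h F (cinv c x))"
      by (simp add: x smooth_atlasD(3)[OF A c q(1)])
  qed
qed

text \<open>With one orthonormal frame at \<open>F1 p\<close>, the trace formula gives both sides
  the same components; in the preferred chart these are the vectors themselves.\<close>

lemma mean_curvature_composite_eq:
  fixes A2 :: "('b::topological_space, 'f::euclidean_space) chart set"
  assumes M1: "riemannian_manifold A1 g1" and M2: "riemannian_manifold A2 g2" and M3: "riemannian_manifold A3 g3"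
    and F1: "riemannian_submersion A1 g1 A2 g2 F1" and F2: "isometric_immersion A2 g2 A3 g3 F2"
  shows "mean_curvature A1 g1 A3 g3 (F2 \<circ> F1) p = mean_curvature A2 g2 A3 g3 F2 (F1 p)"
proof -
  note a2 = riemannian_manifoldD(1)[OF M2] and a3 = riemannian_manifoldD(1)[OF M3]
  note c = chart_at[OF a2, of "F1 p"] and d = chart_at[OF a3, of "F2 (F1 p)"]
  obtain \<epsilon> where \<epsilon>: "\<forall>i<DIM('f). smooth_on (coord (chart_at A2 (F1 p)) ` cdom (chart_at A2 (F1 p))) (\<epsilon> i)"
    "\<forall>x\<in>coord (chart_at A2 (F1 p)) ` cdom (chart_at A2 (F1 p)).
      orthonormal_frame (metric_in_chart A2 g2 (chart_at A2 (F1 p)) x) DIM('f) (\<lambda>i. \<epsilon> i x)"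
    by (rule local_orthonormal_frame[OF local_metric_chart[OF M2 c(1)]])
  note frame = \<epsilon>(2)[rule_format, OF imageI[OF c(2)]]
  show ?thesis
    using mean_curvature_composite[OF M1 M2 M3 F1 F2 c d frame] mean_curvature_immersion[OF M2 M3 F2 c d frame]
    by (simp add: components_chart_at(1)[OF a3])
qed

text \<open>The Christoffel terms agree because differentials compose. The derivative terms agree by
  the chain rule for the components of \<open>V\<close> in fixed charts, whose differentiability is
  what the last assumption provides.\<close>

lemma cov_deriv_composite:
  assumes A: "smooth_atlas A" and B: "smooth_atlas B" and C: "smooth_atlas C"
    and F: "smooth_map A B F" and G: "smooth_map B C G"
    and V: "\<And>c d. c \<in> B \<Longrightarrow> d \<in> C \<Longrightarrow>
      smooth_on (rep_dom c d G) (\<lambda>y. components C d (G (cinv c y)) (V (cinv c y)))"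
  shows "cov_deriv A C k (G \<circ> F) p v (\<lambda>q. V (F q)) = cov_deriv B C k G (F p) (differential A B F p v) V"
proof -
  define b where "b = chart_at A p"
  define c where "c = chart_at B (F p)"
  define d where "d = chart_at C (G (F p))"
  have b: "b \<in> A" "p \<in> cdom b" and c: "c \<in> B" "F p \<in> cdom c" and d: "d \<in> C" "G (F p) \<in> cdom d"
    unfolding b_def c_def d_def by (rule chart_at[OF A] chart_at[OF B] chart_at[OF C])+
  define K where "K y = components C d (G (cinv c y)) (V (cinv c y))" for y
  define f where "f = chart_rep b c F"
  have fx: "f (coord b p) = coord c (F p)" unfolding f_def by (rule chart_rep_coord[OF A b])
  note s = smooth_mapD[OF A B F b(1) c(1)]
  have xd: "coord b p \<in> rep_dom b c F" by (rule coord_in_rep_dom[where F = F, OF b(2) c(2)])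
  have f: "(f has_derivative FD f (coord b p)) (at (coord b p))"
    unfolding f_def by (rule smooth_on_has_derivative[OF s(2,1) xd])
  have K: "(K has_derivative FD K (coord c (F p))) (at (f (coord b p)))"
    unfolding fx
    by (rule smooth_on_has_derivative[OF V[OF c(1) d(1), folded K_def] smooth_mapD(1)[OF B C G c(1) d(1)]
          coord_in_rep_dom[where F = G, OF c(2) d(2)]])
  have "((\<lambda>x. components C d (G (F (cinv b x))) (V (F (cinv b x)))) has_derivative
      (\<lambda>v. FD K (coord c (F p)) (FD f (coord b p) v))) (at (coord b p))"
  proof (rule has_derivative_transform_within_open[OF has_derivative_compose[OF f K] s(1) xd])
    fix x assume "x \<in> rep_dom b c F"
    then have "F (cinv b x) \<in> cdom c" by (simp add: rep_dom_iff[OF A b(1)])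
    then show "K (f x) = components C d (G (F (cinv b x))) (V (F (cinv b x)))"
      by (simp add: K_def f_def chart_rep_def smooth_atlasD(3)[OF B c(1)])
  qed
  from FD_eq[OF this] have 1: "FD (\<lambda>x. components C d (G (F (cinv b x))) (V (F (cinv b x)))) (coord b p) v =
      FD K (coord c (F p)) (differential A B F p v)"
    by (simp add: differential_tdiff tdiff_def f_def b_def c_def)
  show ?thesis
    unfolding cov_deriv_def Let_def differential_compose[OF A B C F G] o_apply
      b_def[symmetric] c_def[symmetric] d_def[symmetric] 1 K_def[abs_def] ..
qed

theorem theorem3p1:
  fixes A1 :: "('a::{t2_space,second_countable_topology}, 'e::euclidean_space) chart set"
    and g1 :: "'a \<Rightarrow> 'e \<Rightarrow> 'e \<Rightarrow> real"
    and A2 :: "('b::{t2_space,second_countable_topology}, 'f::euclidean_space) chart set"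
    and g2 :: "'b \<Rightarrow> 'f \<Rightarrow> 'f \<Rightarrow> real"
    and A3 :: "('c::{t2_space,second_countable_topology}, 'k::euclidean_space) chart set"
    and g3 :: "'c \<Rightarrow> 'k \<Rightarrow> 'k \<Rightarrow> real"
    and F1 :: "'a \<Rightarrow> 'b" and F2 :: "'b \<Rightarrow> 'c"
  assumes "riemannian_manifold A1 g1"
    and "riemannian_manifold A2 g2"
    and "riemannian_manifold A3 g3"
    and "riemannian_submersion A1 g1 A2 g2 F1"
    and "isometric_immersion A2 g2 A3 g3 F2"
    and "pseudo_umbilical A2 g2 A3 g3 F2"
  shows "riemannian_map A1 g1 A3 g3 (F2 \<circ> F1) \<and> pseudo_umbilical A1 g1 A3 g3 (F2 \<circ> F1)"
proof
  note M1 = assms(1) and M2 = assms(2) and M3 = assms(3) and F1 = assms(4) and F2 = assms(5)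
  note a1 = riemannian_manifoldD(1)[OF M1] and a2 = riemannian_manifoldD(1)[OF M2] and a3 = riemannian_manifoldD(1)[OF M3]
  note s1 = riemannian_submersion_smooth[OF F1] and s2 = isometric_immersion_smooth[OF F2]
  show "riemannian_map A1 g1 A3 g3 (F2 \<circ> F1)"
    by (rule riemannian_map_composite[OF M1 M2 M3 F1 F2])
  define H where "H = mean_curvature A2 g2 A3 g3 F2"
  obtain l where l: "smooth_fun A2 l" and umb: "\<And>X p. smooth_section A2 A2 id UNIV X \<Longrightarrow>
      (\<And>p. X p \<in> horizontal A2 g2 A3 F2 p) \<Longrightarrow>
      shape_op A2 A3 g3 F2 H X p = l p *\<^sub>R differential A2 A3 F2 p (X p)"
    using assms(6) unfolding pseudo_umbilical_def H_def by blast
  \<comment> \<open>An immersion has trivial kernel, so horizontality does not restrict the fields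
    to which the hypothesis applies.\<close>
  have hor2: "v \<in> horizontal A2 g2 A3 F2 p" for v p
    using linear_0[OF inner_formD(4)[OF riemannian_manifoldD(2)[OF M2]]]
    by (simp add: horizontal_iff differential_zero_iff[OF F2])
  \<comment> \<open>At \<open>q\<close> the identity for a field involves only the value of the
    field there, and any \<open>v\<close> is such a value.\<close>
  have umb': "- range_component A2 A3 g3 F2 q (cov_deriv A2 A3 g3 F2 q v H) = l q *\<^sub>R differential A2 A3 F2 q v" for q v
  proof -
    obtain Y where Y: "smooth_section A2 A2 id UNIV Y" "Y q = v"
      by (rule vector_field_extension[OF a2])
    show ?thesis using umb[OF Y(1) hor2, of q] unfolding shape_op_def Y(2) .
  qed
  have mc: "mean_curvature A1 g1 A3 g3 (F2 \<circ> F1) = (\<lambda>p. H (F1 p))"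
    unfolding H_def by (intro ext mean_curvature_composite_eq[OF M1 M2 M3 F1 F2])
  \<comment> \<open>The range component depends on the map through its range at the point, and the
    ranges agree because the derivative of \<open>F1\<close> is onto.\<close>
  have rc: "range_component A1 A3 g3 (F2 \<circ> F1) p w = range_component A2 A3 g3 F2 (F1 p) w" for p w
    unfolding range_component_def map_range_composite[OF M1 M2 M3 F1 F2] o_apply ..
  have cd: "cov_deriv A1 A3 g3 (F2 \<circ> F1) p v (\<lambda>p. H (F1 p)) =
      cov_deriv A2 A3 g3 F2 (F1 p) (differential A1 A2 F1 p v) H" for p v
    by (rule cov_deriv_composite[OF a1 a2 a3 s1 s2])
       (unfold H_def, rule smooth_on_mean_curvature[OF M2 M3 F2])
  have "shape_op A1 A3 g3 (F2 \<circ> F1) (mean_curvature A1 g1 A3 g3 (F2 \<circ> F1)) X p =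
      (l \<circ> F1) p *\<^sub>R differential A1 A3 (F2 \<circ> F1) p (X p)" for X p
    unfolding shape_op_def mc rc cd umb' differential_composite[OF M1 M2 M3 F1 F2] o_apply ..
  then show "pseudo_umbilical A1 g1 A3 g3 (F2 \<circ> F1)"
    unfolding pseudo_umbilical_def using smooth_fun_compose[OF a1 a2 s1 l] by blast
qed

end
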